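(* Let $k$ be a commutative ring. The category of $\mathrm{FI}\sharp$-modules over $k$ is equivalent to the category of FB-modules over $k$, via the functors $M(-)\colon \mathrm{FB\text{-}Mod}\to\mathrm{FI}\sharp\text{-}\mathrm{Mod}$ and $H_0(-)\colon\mathrm{FI}\sharp\text{-}\mathrm{Mod}\to\mathrm{FB\text{-}Mod}$, which are mutually inverse equivalences. Thus every $\mathrm{FI}\sharp$-module $V$ is of the form $V\simeq\bigoplus_{i=0}^\infty M(W_i)$, where $W_i$ is the $S_i$-representation $H_0(V)_i$.
   Context: FB is the category of finite sets and bijections; an FB-module over $k$ is a functor $W$ from FB to $k$-modules. An $S_a$-representation $W_a$ is regarded as an FB-module that is $W_a$ on sets of cardinality $a$ and $0$ on sets of other cardinalities. $\mathrm{FI}\sharp$ is the category of finite sets with morphisms $S\to T$ the partial injections: triples $(A,B,\phi)$ with $A\subseteq S$, $B\subseteq T$, $\phi\colon A\to B$ a bijection; the composite of $(A,B,\phi)\colon S\to T$ and $(C,D,\psi)\colon T\to U$ is $(\phi^{-1}(B\cap C),\psi(B\cap C),\psi\circ\phi)$. An $\mathrm{FI}\sharp$-module is a functor from $\mathrm{FI}\sharp$ to $k$-modules; morphisms in all these functor categories are natural transformations. FI (finite sets and injections) embeds in $\mathrm{FI}\sharp$ as the morphisms with $A=S$, so every $\mathrm{FI}\sharp$-module is an FI-module (a functor from FI to $k$-modules). For an FB-module $W$, the $\mathrm{FI}\sharp$-module $M(W)$ is defined by $M(W)_S=\bigoplus_{T\subseteq S}W_T$, and a morphism $f=(A,B,\phi)\colon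 S\to S'$ acts on the summand $W_T$ by $(\phi|_T)_*\colon W_T\to W_{\phi(T)}$ if $T\subseteq A$ and by $0$ if $T\not\subseteq A$. For an $\mathrm{FI}\sharp$-module $V$ regarded as an FI-module, $H_0(V)$ is the FB-module with $H_0(V)_S=V_S/U_S$, where $U_S\subseteq V_S$ is the submodule spanned by the images of all maps $V(f)\colon V_T\to V_S$ over injections $f\colon T\hookrightarrow S$ with $|T|<|S|$; bijections act by the induced maps. *)

theory Defs
  imports "HOL-Algebra.Module" "HOL-Algebra.AbelCoset" "HOL-Algebra.Group_Action"
begin

section \<open>Categories and functors\<close>

text \<open>Composition is indexed by the three objects involved, because an extensional function does
  not determine its domain.\<close>

record ('o, 'a) category =
  Ob :: "'o set"
  Hom :: "'o \<Rightarrow> 'o \<Rightarrow> 'a set"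
  Ident :: "'o \<Rightarrow> 'a"
  Comp :: "'o \<Rightarrow> 'o \<Rightarrow> 'o \<Rightarrow> 'a \<Rightarrow> 'a \<Rightarrow> 'a"

definition is_category :: "('o, 'a) category \<Rightarrow> bool" where
  "is_category C \<longleftrightarrow>
     (\<forall>x\<in>Ob C. Ident C x \<in> Hom C x x) \<and>
     (\<forall>x\<in>Ob C. \<forall>y\<in>Ob C. \<forall>z\<in>Ob C. \<forall>f\<in>Hom C x y. \<forall>g\<in>Hom C y z.
        Comp C x y z g f \<in> Hom C x z) \<and>
     (\<forall>x\<in>Ob C. \<forall>y\<in>Ob C. \<forall>f\<in>Hom C x y.
        Comp C x x y f (Ident C x) = f \<and> Comp C x y y (Ident C y) f = f) \<and>
     (\<forall>w\<in>Ob C. \<forall>x\<in>Ob C. \<forall>y\<in>Ob C. \<forall>z\<in>Ob C. \<forall>f\<in>Hom C w x. \<forall>g\<in>Hom C x y. \<forall>h\<in>Hom C y z.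
        Comp C w x z (Comp C x y z h g) f = Comp C w y z h (Comp C w x y g f))"

record ('o, 'a, 'p, 'b) cfunctor =
  ob_map :: "'o \<Rightarrow> 'p"
  hom_map :: "'o \<Rightarrow> 'o \<Rightarrow> 'a \<Rightarrow> 'b"

definition is_functor ::
    "('o, 'a) category \<Rightarrow> ('p, 'b) category \<Rightarrow> ('o, 'a, 'p, 'b) cfunctor \<Rightarrow> bool" where
  "is_functor C D F \<longleftrightarrow>
     (\<forall>x\<in>Ob C. ob_map F x \<in> Ob D) \<and>
     (\<forall>x\<in>Ob C. \<forall>y\<in>Ob C. \<forall>f\<in>Hom C x y. hom_map F x y f \<in> Hom D (ob_map F x) (ob_map F y)) \<and>
     (\<forall>x\<in>Ob C. hom_map F x x (Ident C x) = Ident D (ob_map F x)) \<and>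
     (\<forall>x\<in>Ob C. \<forall>y\<in>Ob C. \<forall>z\<in>Ob C. \<forall>f\<in>Hom C x y. \<forall>g\<in>Hom C y z.
        hom_map F x z (Comp C x y z g f) =
        Comp D (ob_map F x) (ob_map F y) (ob_map F z) (hom_map F y z g) (hom_map F x y f))"

definition id_functor :: "('o, 'a, 'o, 'a) cfunctor" where
  "id_functor = \<lparr>ob_map = (\<lambda>x. x), hom_map = (\<lambda>x y f. f)\<rparr>"

definition comp_functor ::
    "('p, 'b, 'q, 'c) cfunctor \<Rightarrow> ('o, 'a, 'p, 'b) cfunctor \<Rightarrow> ('o, 'a, 'q, 'c) cfunctor" where
  "comp_functor G F =
     \<lparr>ob_map = (\<lambda>x. ob_map G (ob_map F x)),
      hom_map = (\<lambda>x y f. hom_map G (ob_map F x) (ob_map F y) (hom_map F x y f))\<rparr>"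


section \<open>Finite sets with bijections, injections, and partial injections\<close>

text \<open>The objects are the finite subsets of a type of points. Functions are extensional, so that
  equal morphisms are equal HOL functions.\<close>

definition FB :: "('u set, 'u \<Rightarrow> 'u) category" where
  "FB = \<lparr>Ob = {S. finite S},
         Hom = (\<lambda>S T. {f \<in> extensional S. bij_betw f S T}),
         Ident = (\<lambda>S. \<lambda>x\<in>S. x),
         Comp = (\<lambda>S T U g f. compose S g f)\<rparr>"

definition FI :: "('u set, 'u \<Rightarrow> 'u) category" where
  "FI = \<lparr>Ob = {S. finite S},
         Hom = (\<lambda>S T. {f \<in> extensional S. inj_on f S \<and> f ` S \<subseteq> T}),
         Ident = (\<lambda>S. \<lambda>x\<in>S. x),
         Comp = (\<lambda>S T U g f. compose S g f)\<rparr>"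

definition FIsharp :: "('u set, 'u set \<times> 'u set \<times> ('u \<Rightarrow> 'u)) category" where
  "FIsharp =
     \<lparr>Ob = {S. finite S},
      Hom = (\<lambda>S T. {(A, B, \<phi>). A \<subseteq> S \<and> B \<subseteq> T \<and> \<phi> \<in> extensional A \<and> bij_betw \<phi> A B}),
      Ident = (\<lambda>S. (S, S, \<lambda>x\<in>S. x)),
      Comp = (\<lambda>S T U (C, D, \<psi>) (A, B, \<phi>).
        let A' = {x \<in> A. \<phi> x \<in> B \<inter> C} in (A', \<psi> ` (B \<inter> C), compose A' \<psi> \<phi>))\<rparr>"

lemma is_category_FB: "is_category (FB :: ('u set, 'u \<Rightarrow> 'u) category)"
  unfolding is_category_def
proof (intro conjI ballI)
  fix S T U :: "'u set" and f g
  assume "f \<in> Hom FB S T" "g \<in> Hom FB T U"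
  then show "Comp FB S T U g f \<in> Hom FB S U"
    by (auto simp: FB_def bij_betw_compose)
next
  fix S T :: "'u set" and f
  assume "f \<in> Hom FB S T"
  then have "f \<in> S \<rightarrow> T" "f \<in> extensional S"
    by (auto simp: FB_def bij_betw_imp_funcset)
  then show "Comp FB S S T f (Ident FB S) = f" and "Comp FB S T T (Ident FB T) f = f"
    by (simp_all add: FB_def compose_Id Id_compose)
next
  fix R S T U :: "'u set" and f g h
  assume "f \<in> Hom FB R S"
  then have "f \<in> R \<rightarrow> S"
    by (auto simp: FB_def bij_betw_imp_funcset)
  then show "Comp FB R S U (Comp FB S T U h g) f = Comp FB R T U h (Comp FB R S T g f)"
    by (simp add: FB_def compose_assoc)
qed (simp add: FB_def bij_betw_def inj_on_def)

lemma is_category_FI: "is_category (FI :: ('u set, 'u \<Rightarrow> 'u) category)"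
  unfolding is_category_def
proof (intro conjI ballI)
  fix S T U :: "'u set" and f g
  assume f: "f \<in> Hom FI S T" and g: "g \<in> Hom FI T U"
  then have "inj_on (g \<circ> f) S"
    by (auto simp: FI_def intro: comp_inj_on inj_on_subset)
  then have "inj_on (compose S g f) S"
    by (simp add: inj_on_def compose_def)
  then show "Comp FI S T U g f \<in> Hom FI S U"
    using f g by (auto simp: FI_def compose_def)
next
  fix S T :: "'u set" and f
  assume "f \<in> Hom FI S T"
  then have "f \<in> S \<rightarrow> T" "f \<in> extensional S"
    by (auto simp: FI_def)
  then show "Comp FI S S T f (Ident FI S) = f" and "Comp FI S T T (Ident FI T) f = f"
    by (simp_all add: FI_def compose_Id Id_compose)
next
  fix R S T U :: "'u set" and f g h
  assume "f \<in> Hom FI R S"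
  then have "f \<in> R \<rightarrow> S"
    by (auto simp: FI_def)
  then show "Comp FI R S U (Comp FI S T U h g) f = Comp FI R T U h (Comp FI R S T g f)"
    by (simp add: FI_def compose_assoc)
qed (simp add: FI_def inj_on_def)

lemma is_category_FIsharp:
  "is_category (FIsharp :: ('u set, 'u set \<times> 'u set \<times> ('u \<Rightarrow> 'u)) category)"
  unfolding is_category_def
proof (intro conjI ballI)
  fix S T U :: "'u set" and f g :: "'u set \<times> 'u set \<times> ('u \<Rightarrow> 'u)"
  assume f: "f \<in> Hom FIsharp S T" and g: "g \<in> Hom FIsharp T U"
  obtain A B \<phi> C D \<psi> where eq: "f = (A, B, \<phi>)" "g = (C, D, \<psi>)"
    by (metis prod_cases3)
  have \<phi>: "A \<subseteq> S" "inj_on \<phi> A" "\<phi> ` A = B" and \<psi>: "D \<subseteq> U" "inj_on \<psi> C" "\<psi> ` C = D"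
    using f g by (auto simp: FIsharp_def bij_betw_def eq)
  let ?A = "{x \<in> A. \<phi> x \<in> B \<inter> C}"
  have im: "\<phi> ` ?A = B \<inter> C"
    using \<phi>(3) by blast
  have "inj_on \<phi> ?A"
    using \<phi>(2) by (rule inj_on_subset) auto
  moreover have "inj_on \<psi> (B \<inter> C)"
    using \<psi>(2) by (rule inj_on_subset) auto
  ultimately have "bij_betw (compose ?A \<psi> \<phi>) ?A (\<psi> ` (B \<inter> C))"
    using im by (intro bij_betw_compose[of _ _ "B \<inter> C"]) (simp_all add: bij_betw_def)
  moreover have "\<psi> ` (B \<inter> C) \<subseteq> U"
    using \<psi> by blast
  ultimately show "Comp FIsharp S T U g f \<in> Hom FIsharp S U"
    using \<phi>(1) by (simp add: FIsharp_def Let_def eq) blast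
next
  fix R S T U :: "'u set" and f g h :: "'u set \<times> 'u set \<times> ('u \<Rightarrow> 'u)"
  assume f: "f \<in> Hom FIsharp R S" and g: "g \<in> Hom FIsharp S T" and h: "h \<in> Hom FIsharp T U"
  obtain A B \<phi> C D \<psi> E F \<chi> where eq: "f = (A, B, \<phi>)" "g = (C, D, \<psi>)" "h = (E, F, \<chi>)"
    by (metis prod_cases3)
  have im: "B = \<phi> ` A" "D = \<psi> ` C"
    using f g by (auto simp: FIsharp_def bij_betw_def eq)
  have dom: "{x \<in> A. \<phi> x \<in> B \<inter> {y \<in> C. \<psi> y \<in> D \<inter> E}} =
      {x \<in> {x \<in> A. \<phi> x \<in> B \<inter> C}. compose {x \<in> A. \<phi> x \<in> B \<inter> C} \<psi> \<phi> x \<in> \<psi> ` (B \<inter> C) \<inter> E}"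
    by (auto simp: im compose_def)
  have ran: "compose {y \<in> C. \<psi> y \<in> D \<inter> E} \<chi> \<psi> ` (B \<inter> {y \<in> C. \<psi> y \<in> D \<inter> E}) =
      \<chi> ` (\<psi> ` (B \<inter> C) \<inter> E)"
    by (auto simp: im compose_def image_iff)
  show "Comp FIsharp R S U (Comp FIsharp S T U h g) f =
      Comp FIsharp R T U h (Comp FIsharp R S T g f)"
    by (simp add: FIsharp_def Let_def eq ran flip: dom) (auto simp: compose_def im fun_eq_iff)
next
  fix S T :: "'u set" and f :: "'u set \<times> 'u set \<times> ('u \<Rightarrow> 'u)"
  assume f: "f \<in> Hom FIsharp S T"
  obtain A B \<phi> where eq: "f = (A, B, \<phi>)"
    by (metis prod_cases3)
  have \<phi>: "A \<subseteq> S" "B \<subseteq> T" "\<phi> \<in> extensional A" "\<phi> ` A = B"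
    using f by (auto simp: FIsharp_def bij_betw_def eq)
  have 1: "{x \<in> S. (\<lambda>x\<in>S. x) x \<in> A} = A" "S \<inter> A = A"
    and 2: "{x \<in> A. \<phi> x \<in> B} = A" "B \<inter> T = B"
    using \<phi> by auto
  have 3: "compose A \<phi> (\<lambda>x\<in>S. x) = \<phi>" "compose A (\<lambda>x\<in>T. x) \<phi> = \<phi>" "(\<lambda>x\<in>T. x) ` B = B"
    using \<phi> by (auto simp: compose_def extensional_def fun_eq_iff image_iff subset_iff)
  show "Comp FIsharp S S T f (Ident FIsharp S) = f"
    unfolding FIsharp_def eq category.simps prod.case Let_def 1 3 \<phi>(4) by simp
  show "Comp FIsharp S T T (Ident FIsharp T) f = f"
    unfolding FIsharp_def eq category.simps prod.case Let_def 2 3 by simp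
qed (simp add: FIsharp_def bij_betw_def inj_on_def)

definition FI_to_FIsharp ::
    "('u set, 'u \<Rightarrow> 'u, 'u set, 'u set \<times> 'u set \<times> ('u \<Rightarrow> 'u)) cfunctor" where
  "FI_to_FIsharp = \<lparr>ob_map = (\<lambda>S. S), hom_map = (\<lambda>S T f. (S, f ` S, f))\<rparr>"

lemma is_functor_FI_to_FIsharp: "is_functor FI FIsharp FI_to_FIsharp"
  unfolding is_functor_def
proof (intro conjI ballI)
  fix S T U :: "'u set" and f g
  assume f: "f \<in> Hom FI S T" and g: "g \<in> Hom FI T U"
  then have 1: "{x \<in> S. f x \<in> f ` S} = S" "f ` S \<inter> T = f ` S"
    by (auto simp: FI_def)
  have 2: "compose S g f ` S = g ` f ` S"
    by (auto simp: compose_def)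
  show "hom_map FI_to_FIsharp S U (Comp FI S T U g f) =
      Comp FIsharp (ob_map FI_to_FIsharp S) (ob_map FI_to_FIsharp T) (ob_map FI_to_FIsharp U)
        (hom_map FI_to_FIsharp T U g) (hom_map FI_to_FIsharp S T f)"
    unfolding FI_to_FIsharp_def FI_def FIsharp_def category.simps cfunctor.simps prod.case
      Let_def 1 2 ..
qed (auto simp: FI_def FIsharp_def FI_to_FIsharp_def bij_betw_def)

section \<open>Modules\<close>

definition mod_hom ::
    "('k, 'x) ring_scheme \<Rightarrow> ('k, 'm) module \<Rightarrow> ('k, 'n) module \<Rightarrow> ('m \<Rightarrow> 'n) set" where
  "mod_hom k M N =
     {f \<in> carrier M \<rightarrow>\<^sub>E carrier N.
        (\<forall>x\<in>carrier M. \<forall>y\<in>carrier M. f (x \<oplus>\<^bsub>M\<^esub> y) = f x \<oplus>\<^bsub>N\<^esub> f y) \<and>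
        (\<forall>a\<in>carrier k. \<forall>x\<in>carrier M. f (a \<odot>\<^bsub>M\<^esub> x) = a \<odot>\<^bsub>N\<^esub> f x)}"

definition kMod :: "('k, 'x) ring_scheme \<Rightarrow> (('k, 'm) module, 'm \<Rightarrow> 'm) category" where
  "kMod k = \<lparr>Ob = {M. module k M},
             Hom = mod_hom k,
             Ident = (\<lambda>M. \<lambda>x\<in>carrier M. x),
             Comp = (\<lambda>M N P g f. compose (carrier M) g f)\<rparr>"

lemma is_category_kMod: "is_category (kMod k :: (('k, 'm) module, 'm \<Rightarrow> 'm) category)"
proof -
  have "(\<lambda>x\<in>carrier M. x) \<in> mod_hom k M M" if "module k M" for M :: "('k, 'm) module"
  proof -
    interpret module k M by (rule that)
    show ?thesis by (auto simp: mod_hom_def)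
  qed
  moreover have "compose (carrier M) g f \<in> mod_hom k M P"
    if "module k M" "f \<in> mod_hom k M N" "g \<in> mod_hom k N P" for M N P :: "('k, 'm) module" and f g
  proof -
    interpret module k M by (rule that)
    show ?thesis
      using that(2,3) by (auto simp: mod_hom_def compose_def PiE_iff)
  qed
  moreover have "compose (carrier M) f (\<lambda>x\<in>carrier M. x) = f \<and>
      compose (carrier M) (\<lambda>x\<in>carrier N. x) f = f"
    if "f \<in> mod_hom k M N" for M N :: "('k, 'm) module" and f
    using that by (auto simp: mod_hom_def PiE_def compose_Id Id_compose)
  moreover have "compose (carrier L) (compose (carrier M) h g) f =
      compose (carrier L) h (compose (carrier L) g f)"
    if "f \<in> mod_hom k L M" for L M :: "('k, 'm) module" and f and g h :: "'m \<Rightarrow> 'm"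
    using that by (auto simp: mod_hom_def compose_def PiE_iff)
  ultimately show ?thesis
    unfolding is_category_def kMod_def by simp
qed

definition mod_span ::
    "('k, 'x) ring_scheme \<Rightarrow> ('k, 'm) module \<Rightarrow> 'm set \<Rightarrow> 'm set" where
  "mod_span k M A = \<Inter>{N. submodule N k M \<and> A \<subseteq> N}"

text \<open>The ring fields \<open>mult\<close> and \<open>one\<close> of a module record carry no meaning.\<close>

definition quot_mod :: "('k, 'm) module \<Rightarrow> 'm set \<Rightarrow> ('k, 'm set) module" where
  "quot_mod M U =
     \<lparr>carrier = a_rcosets\<^bsub>M\<^esub> U, mult = undefined, one = undefined,
      zero = U, add = (\<lambda>c d. c <+>\<^bsub>M\<^esub> d),
      smult = (\<lambda>a c. \<Union>x\<in>c. U +>\<^bsub>M\<^esub> (a \<odot>\<^bsub>M\<^esub> x))\<rparr>"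

definition quot_map ::
    "('k, 'm) module \<Rightarrow> 'm set \<Rightarrow> ('k, 'n) module \<Rightarrow> 'n set \<Rightarrow> ('m \<Rightarrow> 'n) \<Rightarrow> 'm set \<Rightarrow> 'n set" where
  "quot_map M U N U' f = (\<lambda>c\<in>a_rcosets\<^bsub>M\<^esub> U. \<Union>x\<in>c. U' +>\<^bsub>N\<^esub> f x)"

definition dsum_mod :: "'i set \<Rightarrow> ('i \<Rightarrow> ('k, 'm) module) \<Rightarrow> ('k, 'i \<Rightarrow> 'm) module" where
  "dsum_mod I G =
     \<lparr>carrier = {x \<in> \<Pi>\<^sub>E i\<in>I. carrier (G i). finite {i \<in> I. x i \<noteq> \<zero>\<^bsub>G i\<^esub>}},
      mult = undefined, one = undefined,
      zero = (\<lambda>i\<in>I. \<zero>\<^bsub>G i\<^esub>), add = (\<lambda>x y. \<lambda>i\<in>I. x i \<oplus>\<^bsub>G i\<^esub> y i),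
      smult = (\<lambda>a x. \<lambda>i\<in>I. a \<odot>\<^bsub>G i\<^esub> x i)\<rparr>"


section \<open>Functors to modules\<close>

type_synonym ('o, 'a, 'k, 'm) cmodule = "('o, 'a, ('k, 'm) module, 'm \<Rightarrow> 'm) cfunctor"

text \<open>Source and target may have their values in modules over different types: a direct sum or a
  quotient of modules does not live on the type of the modules it is made from.\<close>

definition nat_trans ::
    "('o, 'a) category \<Rightarrow> ('k, 'x) ring_scheme \<Rightarrow> ('o, 'a, 'k, 'm) cmodule \<Rightarrow>
     ('o, 'a, 'k, 'n) cmodule \<Rightarrow> ('o \<Rightarrow> 'm \<Rightarrow> 'n) set" where
  "nat_trans C k V W =
     {\<eta> \<in> \<Pi>\<^sub>E S\<in>Ob C. mod_hom k (ob_map V S) (ob_map W S).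
        \<forall>S\<in>Ob C. \<forall>T\<in>Ob C. \<forall>f\<in>Hom C S T.
          compose (carrier (ob_map V S)) (\<eta> T) (hom_map V S T f) =
          compose (carrier (ob_map V S)) (hom_map W S T f) (\<eta> S)}"

definition nat_id :: "('o, 'a) category \<Rightarrow> ('o, 'a, 'k, 'm) cmodule \<Rightarrow> 'o \<Rightarrow> 'm \<Rightarrow> 'm" where
  "nat_id C V = (\<lambda>S\<in>Ob C. \<lambda>x\<in>carrier (ob_map V S). x)"

definition nat_comp ::
    "('o, 'a) category \<Rightarrow> ('o, 'a, 'k, 'm) cmodule \<Rightarrow> ('o \<Rightarrow> 'n \<Rightarrow> 'p) \<Rightarrow> ('o \<Rightarrow> 'm \<Rightarrow> 'n) \<Rightarrow>
     'o \<Rightarrow> 'm \<Rightarrow> 'p" where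
  "nat_comp C V \<theta> \<eta> = (\<lambda>S\<in>Ob C. compose (carrier (ob_map V S)) (\<theta> S) (\<eta> S))"

definition Mod_cat ::
    "('o, 'a) category \<Rightarrow> ('k, 'x) ring_scheme \<Rightarrow>
     (('o, 'a, 'k, 'm) cmodule, 'o \<Rightarrow> 'm \<Rightarrow> 'm) category" where
  "Mod_cat C k = \<lparr>Ob = {V. is_functor C (kMod k) V},
                  Hom = nat_trans C k,
                  Ident = nat_id C,
                  Comp = (\<lambda>U V W \<theta> \<eta>. nat_comp C U \<theta> \<eta>)\<rparr>"

lemma is_category_Mod_cat:
  "is_category (Mod_cat C k :: (('o, 'a, 'k, 'm) cmodule, 'o \<Rightarrow> 'm \<Rightarrow> 'm) category)"
proof -
  let ?C = "Mod_cat C k :: (('o, 'a, 'k, 'm) cmodule, 'o \<Rightarrow> 'm \<Rightarrow> 'm) category"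
  have K: "is_category (kMod k :: (('k, 'm) module, 'm \<Rightarrow> 'm) category)"
    by (rule is_category_kMod)
  have K_id: "(\<lambda>x\<in>carrier M. x) \<in> mod_hom k M M" if "module k M" for M :: "('k, 'm) module"
    using K that by (simp add: is_category_def kMod_def)
  have K_comp: "compose (carrier M) g f \<in> mod_hom k M P"
    if "module k M" "module k N" "module k P" "f \<in> mod_hom k M N" "g \<in> mod_hom k N P"
    for M N P :: "('k, 'm) module" and f g
    using K that by (fastforce simp: is_category_def kMod_def)
  have ob: "module k (ob_map V S)" if "V \<in> Ob ?C" "S \<in> Ob C" for V S
    using that by (simp add: Mod_cat_def is_functor_def kMod_def)
  have hom: "hom_map V S T f \<in> carrier (ob_map V S) \<rightarrow>\<^sub>E carrier (ob_map V T)"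
    if "V \<in> Ob ?C" "S \<in> Ob C" "T \<in> Ob C" "f \<in> Hom C S T" for V S T f
    using that by (simp add: Mod_cat_def is_functor_def kMod_def mod_hom_def)
  have comp_in: "nat_comp C U \<theta> \<eta> \<in> nat_trans C k U W"
    if U: "U \<in> Ob ?C" and V: "V \<in> Ob ?C" and W: "W \<in> Ob ?C"
      and \<eta>: "\<eta> \<in> nat_trans C k U V" and \<theta>: "\<theta> \<in> nat_trans C k V W"
    for U V W :: "('o, 'a, 'k, 'm) cmodule" and \<eta> \<theta>
    unfolding nat_trans_def
  proof (intro CollectI conjI ballI)
    show "nat_comp C U \<theta> \<eta> \<in> (\<Pi>\<^sub>E S\<in>Ob C. mod_hom k (ob_map U S) (ob_map W S))"
    proof (unfold nat_comp_def, rule restrict_PiE_iff[THEN iffD2], rule ballI)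
      fix S assume S: "S \<in> Ob C"
      have "\<eta> S \<in> mod_hom k (ob_map U S) (ob_map V S)" "\<theta> S \<in> mod_hom k (ob_map V S) (ob_map W S)"
        using \<eta> \<theta> S by (auto simp: nat_trans_def)
      then show "compose (carrier (ob_map U S)) (\<theta> S) (\<eta> S) \<in> mod_hom k (ob_map U S) (ob_map W S)"
        by (rule K_comp[OF ob[OF U S] ob[OF V S] ob[OF W S]])
    qed
  next
    fix S T f assume S: "S \<in> Ob C" and T: "T \<in> Ob C" and f: "f \<in> Hom C S T"
    have 1: "\<eta> T (hom_map U S T f x) = hom_map V S T f (\<eta> S x)" if "x \<in> carrier (ob_map U S)" for x
      using \<eta> S T f that unfolding nat_trans_def compose_def
      by (auto dest!: bspec simp: restrict_def fun_eq_iff split: if_splits)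
    have 2: "\<theta> T (hom_map V S T f x) = hom_map W S T f (\<theta> S x)" if "x \<in> carrier (ob_map V S)" for x
      using \<theta> S T f that unfolding nat_trans_def compose_def
      by (auto dest!: bspec simp: restrict_def fun_eq_iff split: if_splits)
    have 3: "\<eta> S x \<in> carrier (ob_map V S)" if "x \<in> carrier (ob_map U S)" for x
      using \<eta> S that by (auto simp: nat_trans_def mod_hom_def PiE_iff)
    have 4: "hom_map U S T f x \<in> carrier (ob_map U T)" if "x \<in> carrier (ob_map U S)" for x
      using hom[OF U S T f] that by auto
    show "compose (carrier (ob_map U S)) (nat_comp C U \<theta> \<eta> T) (hom_map U S T f) =
        compose (carrier (ob_map U S)) (hom_map W S T f) (nat_comp C U \<theta> \<eta> S)"
      using S T by (auto simp: nat_comp_def compose_def 1 2 3 4)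
  qed
  have id_in: "nat_id C V \<in> nat_trans C k V V" if V: "V \<in> Ob ?C"
    for V :: "('o, 'a, 'k, 'm) cmodule"
    unfolding nat_trans_def
  proof (intro CollectI conjI ballI)
    show "nat_id C V \<in> (\<Pi>\<^sub>E S\<in>Ob C. mod_hom k (ob_map V S) (ob_map V S))"
      unfolding nat_id_def using ob[OF V] by (auto intro!: K_id)
  next
    fix S T f assume S: "S \<in> Ob C" and T: "T \<in> Ob C" and f: "f \<in> Hom C S T"
    show "compose (carrier (ob_map V S)) (nat_id C V T) (hom_map V S T f) =
        compose (carrier (ob_map V S)) (hom_map V S T f) (nat_id C V S)"
      using S T PiE_mem[OF hom[OF V S T f]] by (auto simp: nat_id_def compose_def)
  qed
  have mem: "\<eta> S x \<in> carrier (ob_map V S)"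
    if "\<eta> \<in> nat_trans C k U V" "S \<in> Ob C" "x \<in> carrier (ob_map U S)"
    for U V :: "('o, 'a, 'k, 'm) cmodule" and \<eta> S x
    using that by (auto simp: nat_trans_def mod_hom_def PiE_iff)
  have ext: "\<eta> S x = undefined" if "\<eta> \<in> nat_trans C k U V" "S \<in> Ob C" "x \<notin> carrier (ob_map U S)"
    for U V :: "('o, 'a, 'k, 'm) cmodule" and \<eta> S x
    using that by (auto simp: nat_trans_def mod_hom_def PiE_iff extensional_def)
  have ext': "\<eta> S = undefined" if "\<eta> \<in> nat_trans C k U V" "S \<notin> Ob C"
    for U V :: "('o, 'a, 'k, 'm) cmodule" and \<eta> S
    using that by (auto simp: nat_trans_def PiE_iff extensional_def)
  have unit: "nat_comp C U \<eta> (nat_id C U) = \<eta> \<and> nat_comp C U (nat_id C V) \<eta> = \<eta>"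
    if "\<eta> \<in> nat_trans C k U V" for U V :: "('o, 'a, 'k, 'm) cmodule" and \<eta>
    using mem[OF that] ext[OF that] ext'[OF that]
    by (auto simp: nat_comp_def nat_id_def compose_def restrict_def fun_eq_iff)
  have assoc: "nat_comp C T (nat_comp C U \<theta> \<zeta>) \<eta> = nat_comp C T \<theta> (nat_comp C T \<zeta> \<eta>)"
    if "\<eta> \<in> nat_trans C k T U" for T U :: "('o, 'a, 'k, 'm) cmodule"
      and \<eta> and \<zeta> \<theta> :: "'o \<Rightarrow> 'm \<Rightarrow> 'm"
    using mem[OF that] by (auto simp: nat_comp_def compose_def restrict_def fun_eq_iff)
  show ?thesis
    unfolding is_category_def
    using comp_in id_in unit assoc by (simp add: Mod_cat_def)
qed


definition nat_isos ::
    "('o, 'a) category \<Rightarrow> ('k, 'x) ring_scheme \<Rightarrow> ('o, 'a, 'k, 'm) cmodule \<Rightarrow>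
     ('o, 'a, 'k, 'n) cmodule \<Rightarrow> ('o \<Rightarrow> 'm \<Rightarrow> 'n) set" where
  "nat_isos C k V W =
     {\<eta> \<in> nat_trans C k V W.
        \<exists>\<theta>\<in>nat_trans C k W V. nat_comp C V \<theta> \<eta> = nat_id C V \<and> nat_comp C W \<eta> \<theta> = nat_id C W}"

text \<open>\<open>F\<close> and \<open>G\<close> are functors from \<open>A\<close> to the functors from \<open>C\<close> to \<open>k\<close>-modules. A natural
  isomorphism between them is a family of isomorphisms of functors on \<open>C\<close>, natural in the object
  of \<open>A\<close>.\<close>

definition functors_isomorphic ::
    "('b, 'c) category \<Rightarrow> ('o, 'a) category \<Rightarrow> ('k, 'x) ring_scheme \<Rightarrow>
     ('b, 'c, ('o, 'a, 'k, 'm) cmodule, 'o \<Rightarrow> 'm \<Rightarrow> 'm) cfunctor \<Rightarrow>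
     ('b, 'c, ('o, 'a, 'k, 'n) cmodule, 'o \<Rightarrow> 'n \<Rightarrow> 'n) cfunctor \<Rightarrow> bool" where
  "functors_isomorphic A C k F G \<longleftrightarrow>
     (\<exists>\<alpha>. (\<forall>x\<in>Ob A. \<alpha> x \<in> nat_isos C k (ob_map F x) (ob_map G x)) \<and>
          (\<forall>x\<in>Ob A. \<forall>y\<in>Ob A. \<forall>f\<in>Hom A x y.
             nat_comp C (ob_map F x) (\<alpha> y) (hom_map F x y f) =
             nat_comp C (ob_map F x) (hom_map G x y f) (\<alpha> x)))"

definition dsum_cmodule ::
    "'i set \<Rightarrow> ('i \<Rightarrow> ('o, 'a, 'k, 'm) cmodule) \<Rightarrow> ('o, 'a, 'k, 'i \<Rightarrow> 'm) cmodule" where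
  "dsum_cmodule I V =
     \<lparr>ob_map = (\<lambda>S. dsum_mod I (\<lambda>i. ob_map (V i) S)),
      hom_map = (\<lambda>S T f. \<lambda>x\<in>carrier (dsum_mod I (\<lambda>i. ob_map (V i) S)).
        \<lambda>i\<in>I. hom_map (V i) S T f (x i))\<rparr>"


section \<open>The functor \<open>M\<close>\<close>

text \<open>The component at \<open>T'\<close> of the image of \<open>x\<close> collects the contributions of the summands \<open>W\<^sub>T\<close> with
  \<open>T \<subseteq> A\<close> that are sent to \<open>W\<^sub>T\<^sub>'\<close>; the summands with \<open>T\<close> not inside \<open>A\<close> are sent to zero.\<close>

definition M_ob ::
    "('u set, 'u \<Rightarrow> 'u, 'k, 'm) cmodule \<Rightarrow>
     ('u set, 'u set \<times> 'u set \<times> ('u \<Rightarrow> 'u), 'k, 'u set \<Rightarrow> 'm) cmodule" where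
  "M_ob W =
     \<lparr>ob_map = (\<lambda>S. dsum_mod (Pow S) (ob_map W)),
      hom_map = (\<lambda>S S' (A, B, \<phi>). \<lambda>x\<in>carrier (dsum_mod (Pow S) (ob_map W)). \<lambda>T'\<in>Pow S'.
        \<Oplus>\<^bsub>ob_map W T'\<^esub>T\<in>{T. T \<subseteq> A \<and> \<phi> ` T = T'}. hom_map W T T' (restrict \<phi> T) (x T))\<rparr>"

definition M_functor ::
    "(('u set, 'u \<Rightarrow> 'u, 'k, 'm) cmodule, 'u set \<Rightarrow> 'm \<Rightarrow> 'm,
      ('u set, 'u set \<times> 'u set \<times> ('u \<Rightarrow> 'u), 'k, 'u set \<Rightarrow> 'm) cmodule,
      'u set \<Rightarrow> ('u set \<Rightarrow> 'm) \<Rightarrow> ('u set \<Rightarrow> 'm)) cfunctor" where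
  "M_functor =
     \<lparr>ob_map = M_ob,
      hom_map = (\<lambda>W W' \<eta>. \<lambda>S\<in>Ob FIsharp. \<lambda>x\<in>carrier (ob_map (M_ob W) S). \<lambda>T\<in>Pow S. \<eta> T (x T))\<rparr>"


section \<open>The functor \<open>H\<^sub>0\<close>\<close>

definition FI_decomposables ::
    "('k, 'x) ring_scheme \<Rightarrow> ('u set, 'u \<Rightarrow> 'u, 'k, 'm) cmodule \<Rightarrow> 'u set \<Rightarrow> 'm set" where
  "FI_decomposables k V S = mod_span k (ob_map V S)
     (\<Union>T\<in>{T \<in> Ob FI. card T < card S}. \<Union>f\<in>Hom FI T S. hom_map V T S f ` carrier (ob_map V T))"

definition FI_H0 ::
    "('k, 'x) ring_scheme \<Rightarrow> ('u set, 'u \<Rightarrow> 'u, 'k, 'm) cmodule \<Rightarrow>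
     ('u set, 'u \<Rightarrow> 'u, 'k, 'm set) cmodule" where
  "FI_H0 k V =
     \<lparr>ob_map = (\<lambda>S. quot_mod (ob_map V S) (FI_decomposables k V S)),
      hom_map = (\<lambda>S T f. quot_map (ob_map V S) (FI_decomposables k V S)
        (ob_map V T) (FI_decomposables k V T) (hom_map V S T f))\<rparr>"

definition H0_ob ::
    "('k, 'x) ring_scheme \<Rightarrow> ('u set, 'u set \<times> 'u set \<times> ('u \<Rightarrow> 'u), 'k, 'm) cmodule \<Rightarrow>
     ('u set, 'u \<Rightarrow> 'u, 'k, 'm set) cmodule" where
  "H0_ob k V = FI_H0 k (comp_functor V FI_to_FIsharp)"

definition H0_functor ::
    "('k, 'x) ring_scheme \<Rightarrow>
     (('u set, 'u set \<times> 'u set \<times> ('u \<Rightarrow> 'u), 'k, 'm) cmodule, 'u set \<Rightarrow> 'm \<Rightarrow> 'm,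
      ('u set, 'u \<Rightarrow> 'u, 'k, 'm set) cmodule, 'u set \<Rightarrow> 'm set \<Rightarrow> 'm set) cfunctor" where
  "H0_functor k =
     \<lparr>ob_map = H0_ob k,
      hom_map = (\<lambda>V V' \<eta>. \<lambda>S\<in>Ob FB.
        quot_map (ob_map V S) (FI_decomposables k (comp_functor V FI_to_FIsharp) S)
          (ob_map V' S) (FI_decomposables k (comp_functor V' FI_to_FIsharp) S) (\<eta> S))\<rparr>"


section \<open>Representations of symmetric groups as FB-modules\<close>

text \<open>The symmetric group \<open>S\<^sub>a\<close> is realised as \<open>BijGroup P\<close> for a set \<open>P\<close> with \<open>a\<close> elements.\<close>

definition representation ::
    "('k, 'x) ring_scheme \<Rightarrow> ('g, 'y) monoid_scheme \<Rightarrow> ('k, 'm) module \<Rightarrow> ('g \<Rightarrow> 'm \<Rightarrow> 'm) \<Rightarrow> bool" where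
  "representation k G W \<rho> \<longleftrightarrow>
     module k W \<and> group_action G (carrier W) \<rho> \<and> (\<forall>g\<in>carrier G. \<rho> g \<in> mod_hom k W W)"

definition frame :: "'u set \<Rightarrow> 'u set \<Rightarrow> 'u \<Rightarrow> 'u" where
  "frame P S = (SOME e. bij_betw e P S)"

text \<open>The value on every set with as many elements as \<open>P\<close> is \<open>W\<close> itself, and such a set is
  identified with \<open>P\<close> by a chosen bijection; another choice gives an isomorphic FB-module.\<close>

definition rep_FB ::
    "'u set \<Rightarrow> ('k, 'm) module \<Rightarrow> (('u \<Rightarrow> 'u) \<Rightarrow> 'm \<Rightarrow> 'm) \<Rightarrow>
     ('u set, 'u \<Rightarrow> 'u, 'k, 'm) cmodule" where
  "rep_FB P W \<rho> =
     \<lparr>ob_map = (\<lambda>S. if card S = card P then W else W\<lparr>carrier := {\<zero>\<^bsub>W\<^esub>}\<rparr>),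
      hom_map = (\<lambda>S T f.
        if card S = card P
        then \<rho> (\<lambda>x\<in>P. inv_into P (frame P T) (f (frame P S x)))
        else (\<lambda>w\<in>{\<zero>\<^bsub>W\<^esub>}. w))\<rparr>"

end

theory Submission
  imports Defs
begin

text \<open>
  Why the theorem holds. In an \<open>FI\<sharp>\<close>-module \<open>V\<close> every inclusion \<open>T \<subseteq> S\<close> has, besides the map
  \<open>V\<^sub>T \<rightarrow> V\<^sub>S\<close>, a restriction map \<open>V\<^sub>S \<rightarrow> V\<^sub>T\<close> splitting it, both given by the partial identity
  of \<open>T\<close>. The composites \<open>V\<^sub>S \<rightarrow> V\<^sub>T \<rightarrow> V\<^sub>S\<close> are commuting idempotents \<open>e\<^sub>T\<close> with
  \<open>e\<^sub>T e\<^sub>R = e\<^sub>T\<^sub>\<inter>\<^sub>R\<close>. The elements of \<open>V\<^sub>S\<close> that come from smaller sets form the sum \<open>U\<^sub>S\<close> of the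
  images of the \<open>e\<^sub>T\<close> for proper subsets \<open>T\<close>, and the product of the maps \<open>1 - e\<^sub>S\<^sub>-\<^sub>{\<^sub>s\<^sub>}\<close> is a projection
  along \<open>U\<^sub>S\<close> onto the elements all of whose proper restrictions vanish
  (\<open>decomposables_complement\<close>). So \<open>H\<^sub>0(V)\<^sub>S = V\<^sub>S / U\<^sub>S\<close> is a direct summand of \<open>V\<^sub>S\<close>.

  The natural map \<open>V \<rightarrow> M (H\<^sub>0 V)\<close> sends \<open>v \<in> V\<^sub>S\<close> to the family of the classes of its restrictions to
  the subsets of \<open>S\<close>. It commutes with partial injections because a restriction that leaves the
  image of a partial injection factors through a smaller set (\<open>H0_class_restriction\<close>). It is
  injective because an element in the kernel has, by induction on the set, vanishing proper
  restrictions and lies in \<open>U\<^sub>S\<close> (\<open>restrictions_decomposable_imp_zero\<close>), and surjective because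
  representatives in the complement of \<open>U\<^sub>T\<close>, included into \<open>S\<close>, have a nonzero class at \<open>T\<close> only
  (\<open>restriction_classes_surj\<close>).

  For an FB-module \<open>W\<close> the decomposable elements of \<open>M(W)\<^sub>S\<close> are those with zero component at \<open>S\<close>
  itself, again by the projection (\<open>decomposables_M\<close>). So the quotient is \<open>W\<^sub>S\<close>, which gives the
  isomorphism from \<open>W\<close> to \<open>H\<^sub>0 (M W)\<close>.

  Finally, \<open>M\<close> of any FB-module is the direct sum over \<open>i\<close> of \<open>M\<close> of its restrictions to sets with
  \<open>i\<close> elements. Identifying each such set with the model set \<open>P i\<close> turns these restrictions into the
  FB-modules of the representations on the values at \<open>P i\<close> (\<open>split_nat_trans\<close>, \<open>split_bij\<close>); apply this
  to \<open>H\<^sub>0 V\<close>.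
\<close>

section \<open>Linear maps, quotients and direct sums\<close>

lemma minus_zero_right:
  assumes "abelian_group G" "x \<in> carrier G" shows "x \<ominus>\<^bsub>G\<^esub> \<zero>\<^bsub>G\<^esub> = x"
proof -
  interpret abelian_group G by fact
  show ?thesis using assms(2) by (simp add: a_minus_def)
qed

lemma minus_eq_zero_iff:
  assumes "abelian_group G" "x \<in> carrier G" "y \<in> carrier G"
  shows "x \<ominus>\<^bsub>G\<^esub> y = \<zero>\<^bsub>G\<^esub> \<longleftrightarrow> x = y"
proof -
  interpret abelian_group G by fact
  have "x = y" if "x \<oplus>\<^bsub>G\<^esub> \<ominus>\<^bsub>G\<^esub> y = \<zero>\<^bsub>G\<^esub>"
    using minus_equality[OF that] assms(2,3) by simp
  then show ?thesis using assms(2,3) by (auto simp: a_minus_def r_neg)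
qed

lemma mod_hom_closed: "f \<in> mod_hom k M N \<Longrightarrow> x \<in> carrier M \<Longrightarrow> f x \<in> carrier N"
  and mod_hom_add: "f \<in> mod_hom k M N \<Longrightarrow> x \<in> carrier M \<Longrightarrow> y \<in> carrier M \<Longrightarrow>
    f (x \<oplus>\<^bsub>M\<^esub> y) = f x \<oplus>\<^bsub>N\<^esub> f y"
  and mod_hom_smult: "f \<in> mod_hom k M N \<Longrightarrow> a \<in> carrier k \<Longrightarrow> x \<in> carrier M \<Longrightarrow>
    f (a \<odot>\<^bsub>M\<^esub> x) = a \<odot>\<^bsub>N\<^esub> f x"
  and mod_hom_extensional: "f \<in> mod_hom k M N \<Longrightarrow> f \<in> extensional (carrier M)"
  by (auto simp: mod_hom_def PiE_iff)

lemma mod_homI: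
  assumes "f \<in> extensional (carrier M)"
    and "\<And>x. x \<in> carrier M \<Longrightarrow> f x \<in> carrier N"
    and "\<And>x y. x \<in> carrier M \<Longrightarrow> y \<in> carrier M \<Longrightarrow> f (x \<oplus>\<^bsub>M\<^esub> y) = f x \<oplus>\<^bsub>N\<^esub> f y"
    and "\<And>a x. a \<in> carrier k \<Longrightarrow> x \<in> carrier M \<Longrightarrow> f (a \<odot>\<^bsub>M\<^esub> x) = a \<odot>\<^bsub>N\<^esub> f x"
  shows "f \<in> mod_hom k M N"
  using assms by (auto simp: mod_hom_def PiE_iff)

lemma mod_hom_restrictI:
  assumes "module k M"
    and "\<And>x. x \<in> carrier M \<Longrightarrow> f x \<in> carrier N"
    and "\<And>x y. x \<in> carrier M \<Longrightarrow> y \<in> carrier M \<Longrightarrow> f (x \<oplus>\<^bsub>M\<^esub> y) = f x \<oplus>\<^bsub>N\<^esub> f y"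
    and "\<And>a x. a \<in> carrier k \<Longrightarrow> x \<in> carrier M \<Longrightarrow> f (a \<odot>\<^bsub>M\<^esub> x) = a \<odot>\<^bsub>N\<^esub> f x"
  shows "(\<lambda>x\<in>carrier M. f x) \<in> mod_hom k M N"
proof -
  interpret module k M by fact
  show ?thesis by (rule mod_homI) (auto simp: assms)
qed

lemma mod_hom_zero:
  assumes "module k M" "module k N" "f \<in> mod_hom k M N"
  shows "f \<zero>\<^bsub>M\<^esub> = \<zero>\<^bsub>N\<^esub>"
proof -
  interpret M: module k M by fact
  interpret N: module k N by fact
  have "f (\<zero>\<^bsub>k\<^esub> \<odot>\<^bsub>M\<^esub> \<zero>\<^bsub>M\<^esub>) = \<zero>\<^bsub>k\<^esub> \<odot>\<^bsub>N\<^esub> f \<zero>\<^bsub>M\<^esub>"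
    using mod_hom_smult[OF assms(3), of "\<zero>\<^bsub>k\<^esub>"] by simp
  then show ?thesis
    using mod_hom_closed[OF assms(3)] by simp
qed

lemma mod_hom_minus:
  assumes "module k M" "module k N" "f \<in> mod_hom k M N" "x \<in> carrier M" "y \<in> carrier M"
  shows "f (x \<ominus>\<^bsub>M\<^esub> y) = f x \<ominus>\<^bsub>N\<^esub> f y"
proof -
  interpret M: module k M by fact
  interpret N: module k N by fact
  note cl = mod_hom_closed[OF assms(3)]
  have "f (\<ominus>\<^bsub>M\<^esub> y) \<oplus>\<^bsub>N\<^esub> f y = \<zero>\<^bsub>N\<^esub>"
    using mod_hom_add[OF assms(3), of "\<ominus>\<^bsub>M\<^esub> y" y] assms(5)
    by (simp add: M.l_neg mod_hom_zero[OF assms(1-3)])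
  then have "f (\<ominus>\<^bsub>M\<^esub> y) = \<ominus>\<^bsub>N\<^esub> f y"
    using cl assms(5) by (simp add: N.minus_equality)
  then show ?thesis
    using mod_hom_add[OF assms(3), of x "\<ominus>\<^bsub>M\<^esub> y"] assms(4,5)
    by (simp add: a_minus_def)
qed

lemma mod_hom_compose:
  assumes "f \<in> mod_hom k M N" "g \<in> mod_hom k N P" "module k M"
  shows "compose (carrier M) g f \<in> mod_hom k M P"
  unfolding compose_def using assms
  by (intro mod_hom_restrictI) (auto simp: mod_hom_closed mod_hom_add mod_hom_smult)

lemma submodule_mem:
  assumes "module k M" "submodule U k M"
  shows "U \<subseteq> carrier M" "\<zero>\<^bsub>M\<^esub> \<in> U"
    and "\<And>x y. x \<in> U \<Longrightarrow> y \<in> U \<Longrightarrow> x \<oplus>\<^bsub>M\<^esub> y \<in> U"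
    and "\<And>x y. x \<in> U \<Longrightarrow> y \<in> U \<Longrightarrow> x \<ominus>\<^bsub>M\<^esub> y \<in> U"
    and "\<And>a x. a \<in> carrier k \<Longrightarrow> x \<in> U \<Longrightarrow> a \<odot>\<^bsub>M\<^esub> x \<in> U"
proof -
  interpret M: module k M by fact
  note U = M.submoduleE[OF assms(2)]
  show "U \<subseteq> carrier M"
    "\<And>x y. x \<in> U \<Longrightarrow> y \<in> U \<Longrightarrow> x \<oplus>\<^bsub>M\<^esub> y \<in> U"
    "\<And>x y. x \<in> U \<Longrightarrow> y \<in> U \<Longrightarrow> x \<ominus>\<^bsub>M\<^esub> y \<in> U"
    "\<And>a x. a \<in> carrier k \<Longrightarrow> x \<in> U \<Longrightarrow> a \<odot>\<^bsub>M\<^esub> x \<in> U"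
    using U by (auto simp: a_minus_def)
  obtain u where u: "u \<in> U" "u \<in> carrier M" using U(1,2) by auto
  have "u \<oplus>\<^bsub>M\<^esub> \<ominus>\<^bsub>M\<^esub> u \<in> U" using U(3,5) u by auto
  then show "\<zero>\<^bsub>M\<^esub> \<in> U" using u by (simp add: M.r_neg)
qed

lemma mod_span_submodule:
  assumes "module k M" "A \<subseteq> carrier M"
  shows "submodule (mod_span k M A) k M"
proof -
  interpret M: module k M by fact
  have c: "mod_span k M A \<subseteq> carrier M"
    using M.carrier_is_submodule assms(2) by (auto simp: mod_span_def)
  show ?thesis
    by (rule M.submoduleI)
      (use c submodule_mem[OF assms(1)] M.submoduleE(3) in \<open>auto simp: mod_span_def\<close>)
qed

lemma mod_span_minimal:
  assumes "submodule N k M" "A \<subseteq> N" shows "mod_span k M A \<subseteq> N"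
  using assms by (auto simp: mod_span_def)

lemma mod_span_superset: "A \<subseteq> mod_span k M A"
  by (auto simp: mod_span_def)

lemma submodule_vimage:
  assumes M: "module k M" and N: "module k N" and f: "f \<in> mod_hom k M N" and U: "submodule U k N"
  shows "submodule {x \<in> carrier M. f x \<in> U} k M"
proof -
  interpret M: module k M by fact
  interpret N: module k N by fact
  have "f (\<ominus>\<^bsub>M\<^esub> x) = f (\<zero>\<^bsub>M\<^esub> \<ominus>\<^bsub>M\<^esub> x)" if "x \<in> carrier M" for x
    using that by (simp add: a_minus_def)
  then have "f (\<ominus>\<^bsub>M\<^esub> x) \<in> U" if "x \<in> carrier M" "f x \<in> U" for x
    using that submodule_mem[OF N U]
    by (simp add: mod_hom_minus[OF M N f] mod_hom_zero[OF M N f])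
  then show ?thesis
    using submodule_mem[OF N U]
    by (intro M.submoduleI)
      (auto simp: mod_hom_zero[OF M N f] mod_hom_add[OF f] mod_hom_smult[OF f])
qed

lemma zero_submodule:
  assumes "module k M" shows "submodule {\<zero>\<^bsub>M\<^esub>} k M"
proof -
  interpret M: module k M by fact
  show ?thesis by (rule M.submoduleI) auto
qed

subsection \<open>Quotients\<close>

context
  fixes k :: "('k, 'x) ring_scheme" and M :: "('k, 'm) module" and U
  assumes M: "module k M" and U: "submodule U k M"
begin

interpretation M: module k M by (rule M)

lemma submodule_abelian_subgroup: "abelian_subgroup U M"
  using U by (intro abelian_subgroupI3) (auto simp: submodule_def additive_subgroup_def M.abelian_group_axioms)

interpretation U: abelian_subgroup U M by (rule submodule_abelian_subgroup)

lemma carrier_quot_mod: "carrier (quot_mod M U) = (\<lambda>x. U +>\<^bsub>M\<^esub> x) ` carrier M"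
  by (auto simp: quot_mod_def A_RCOSETS_def')

lemma coset_carrier: "x \<in> carrier M \<Longrightarrow> U +>\<^bsub>M\<^esub> x \<in> carrier (quot_mod M U)"
  by (simp add: carrier_quot_mod)

lemma coset_cases:
  assumes "c \<in> carrier (quot_mod M U)" obtains x where "x \<in> carrier M" "c = U +>\<^bsub>M\<^esub> x"
  using assms by (auto simp: carrier_quot_mod)

lemma coset_eq_iff:
  assumes "x \<in> carrier M" "y \<in> carrier M"
  shows "U +>\<^bsub>M\<^esub> x = U +>\<^bsub>M\<^esub> y \<longleftrightarrow> x \<ominus>\<^bsub>M\<^esub> y \<in> U"
proof -
  have "U +>\<^bsub>M\<^esub> x = U +>\<^bsub>M\<^esub> y \<longleftrightarrow> x \<in> U +>\<^bsub>M\<^esub> y"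
    using U.a_rcos_self[OF assms(1)] U.a_repr_independence'[OF _ assms(2), of x] by auto
  also have "\<dots> \<longleftrightarrow> x \<ominus>\<^bsub>M\<^esub> y \<in> U"
    using U.a_rcos_module[OF assms(2,1)] by (simp add: a_minus_def)
  finally show ?thesis .
qed

lemma coset_eq_self_iff:
  assumes "x \<in> carrier M"
  shows "U +>\<^bsub>M\<^esub> x = U \<longleftrightarrow> x \<in> U"
  using assms U.a_rcos_const U.a_rcos_self by blast

lemma coset_add:
  assumes "x \<in> carrier M" "y \<in> carrier M"
  shows "(U +>\<^bsub>M\<^esub> x) \<oplus>\<^bsub>quot_mod M U\<^esub> (U +>\<^bsub>M\<^esub> y) = U +>\<^bsub>M\<^esub> (x \<oplus>\<^bsub>M\<^esub> y)"
  using assms by (simp add: quot_mod_def U.a_rcos_sum)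

text \<open>Scalar multiplication and induced maps on a quotient are unions over all representatives. Such a
  union collapses once the value does not depend on the representative.\<close>

lemma coset_UN:
  assumes x: "x \<in> carrier M"
    and "\<And>y. y \<in> carrier M \<Longrightarrow> x \<ominus>\<^bsub>M\<^esub> y \<in> U \<Longrightarrow> g y = g x"
  shows "(\<Union>y\<in>U +>\<^bsub>M\<^esub> x. g y) = g x"
proof -
  have "g y = g x" if "y \<in> U +>\<^bsub>M\<^esub> x" for y
  proof -
    have "y \<in> carrier M" using that x by (rule U.a_elemrcos_carrier[rotated])
    moreover from this have "x \<ominus>\<^bsub>M\<^esub> y \<in> U"
      using U.a_repr_independence'[OF that x] x by (simp add: coset_eq_iff)
    ultimately show ?thesis by (rule assms(2))
  qed
  then show ?thesis using U.a_rcos_self[OF x] by blast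
qed

lemma coset_smult:
  assumes "a \<in> carrier k" "x \<in> carrier M"
  shows "a \<odot>\<^bsub>quot_mod M U\<^esub> (U +>\<^bsub>M\<^esub> x) = U +>\<^bsub>M\<^esub> (a \<odot>\<^bsub>M\<^esub> x)"
proof -
  have "U +>\<^bsub>M\<^esub> (a \<odot>\<^bsub>M\<^esub> y) = U +>\<^bsub>M\<^esub> (a \<odot>\<^bsub>M\<^esub> x)"
    if y: "y \<in> carrier M" "x \<ominus>\<^bsub>M\<^esub> y \<in> U" for y
  proof -
    have "a \<odot>\<^bsub>M\<^esub> (x \<ominus>\<^bsub>M\<^esub> y) \<in> U" using submodule_mem(5)[OF M U] y assms by auto
    also have "a \<odot>\<^bsub>M\<^esub> (x \<ominus>\<^bsub>M\<^esub> y) = a \<odot>\<^bsub>M\<^esub> x \<ominus>\<^bsub>M\<^esub> a \<odot>\<^bsub>M\<^esub> y"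
      using y assms by (simp add: a_minus_def M.smult_r_distr M.smult_r_minus)
    finally show ?thesis using y assms by (simp add: coset_eq_iff[symmetric])
  qed
  then show ?thesis using assms by (simp add: quot_mod_def coset_UN)
qed

lemma coset_zero: "\<zero>\<^bsub>quot_mod M U\<^esub> = U +>\<^bsub>M\<^esub> \<zero>\<^bsub>M\<^esub>"
  using coset_eq_self_iff[of "\<zero>\<^bsub>M\<^esub>"] submodule_mem(2)[OF M U] by (simp add: quot_mod_def)

lemma coset_eq_zero_iff:
  "x \<in> carrier M \<Longrightarrow> U +>\<^bsub>M\<^esub> x = \<zero>\<^bsub>quot_mod M U\<^esub> \<longleftrightarrow> x \<in> U"
  by (simp add: quot_mod_def coset_eq_self_iff)

lemma module_quot_mod: "module k (quot_mod M U)"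
proof (rule moduleI)
  show "cring k" by (rule M.R.is_cring)
  have neg: "\<exists>d\<in>carrier (quot_mod M U). d \<oplus>\<^bsub>quot_mod M U\<^esub> c = \<zero>\<^bsub>quot_mod M U\<^esub>"
    if c: "c \<in> carrier (quot_mod M U)" for c
  proof -
    obtain x where x: "x \<in> carrier M" "c = U +>\<^bsub>M\<^esub> x" using c by (rule coset_cases)
    then have "(U +>\<^bsub>M\<^esub> (\<ominus>\<^bsub>M\<^esub> x)) \<oplus>\<^bsub>quot_mod M U\<^esub> c = \<zero>\<^bsub>quot_mod M U\<^esub>"
      by (simp add: coset_add M.l_neg coset_zero)
    then show ?thesis using x coset_carrier[of "\<ominus>\<^bsub>M\<^esub> x"] by auto
  qed
  show "abelian_group (quot_mod M U)"
  proof (rule abelian_groupI)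
    fix c d
    assume "c \<in> carrier (quot_mod M U)" "d \<in> carrier (quot_mod M U)"
    then show "c \<oplus>\<^bsub>quot_mod M U\<^esub> d = d \<oplus>\<^bsub>quot_mod M U\<^esub> c"
      by (elim coset_cases) (simp add: coset_add M.M.a_comm)
  qed (use neg in \<open>auto simp: carrier_quot_mod coset_add coset_zero M.M.a_assoc\<close>)
qed (auto simp: carrier_quot_mod coset_add coset_smult M.smult_l_distr M.smult_r_distr M.smult_assoc1)

end

context
  fixes k :: "('k, 'x) ring_scheme" and M :: "('k, 'm) module" and U
    and N :: "('k, 'n) module" and U' f
  assumes M: "module k M" and U: "submodule U k M"
    and N: "module k N" and U': "submodule U' k N"
    and f: "f \<in> mod_hom k M N" and f_U: "\<And>x. x \<in> U \<Longrightarrow> f x \<in> U'"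
begin

lemma quot_map_coset:
  assumes x: "x \<in> carrier M"
  shows "quot_map M U N U' f (U +>\<^bsub>M\<^esub> x) = U' +>\<^bsub>N\<^esub> f x"
proof -
  have "U' +>\<^bsub>N\<^esub> f y = U' +>\<^bsub>N\<^esub> f x" if y: "y \<in> carrier M" "x \<ominus>\<^bsub>M\<^esub> y \<in> U" for y
  proof -
    have "f x \<ominus>\<^bsub>N\<^esub> f y \<in> U'" using f_U[OF y(2)] x y by (simp add: mod_hom_minus[OF M N f])
    then have "U' +>\<^bsub>N\<^esub> f x = U' +>\<^bsub>N\<^esub> f y"
      using x y by (simp add: coset_eq_iff[OF N U'] mod_hom_closed[OF f])
    then show ?thesis ..
  qed
  then have "(\<Union>y\<in>U +>\<^bsub>M\<^esub> x. U' +>\<^bsub>N\<^esub> f y) = U' +>\<^bsub>N\<^esub> f x"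
    using coset_UN[OF M U x, of "\<lambda>y. U' +>\<^bsub>N\<^esub> f y"] by simp
  moreover have "U +>\<^bsub>M\<^esub> x \<in> a_rcosets\<^bsub>M\<^esub> U"
    using coset_carrier[OF M U x] by (simp add: quot_mod_def)
  ultimately show ?thesis by (simp add: quot_map_def)
qed

lemma quot_map_mod_hom: "quot_map M U N U' f \<in> mod_hom k (quot_mod M U) (quot_mod N U')"
proof (rule mod_homI)
  show "quot_map M U N U' f \<in> extensional (carrier (quot_mod M U))"
    by (simp add: quot_map_def quot_mod_def)
next
  fix c assume "c \<in> carrier (quot_mod M U)"
  then show "quot_map M U N U' f c \<in> carrier (quot_mod N U')"
    by (elim coset_cases[OF M U]) (simp add: quot_map_coset coset_carrier[OF N U'] mod_hom_closed[OF f])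
next
  interpret M: module k M by (rule M)
  fix c d assume "c \<in> carrier (quot_mod M U)" "d \<in> carrier (quot_mod M U)"
  then show "quot_map M U N U' f (c \<oplus>\<^bsub>quot_mod M U\<^esub> d) =
      quot_map M U N U' f c \<oplus>\<^bsub>quot_mod N U'\<^esub> quot_map M U N U' f d"
    by (elim coset_cases[OF M U])
      (simp add: quot_map_coset coset_add[OF M U] coset_add[OF N U'] mod_hom_closed[OF f]
        mod_hom_add[OF f])
next
  interpret M: module k M by (rule M)
  fix a c assume "a \<in> carrier k" "c \<in> carrier (quot_mod M U)"
  then show "quot_map M U N U' f (a \<odot>\<^bsub>quot_mod M U\<^esub> c) =
      a \<odot>\<^bsub>quot_mod N U'\<^esub> quot_map M U N U' f c"
    by (elim coset_cases[OF M U])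
      (simp add: quot_map_coset coset_smult[OF M U] coset_smult[OF N U'] mod_hom_closed[OF f]
        mod_hom_smult[OF f])
qed

end

subsection \<open>Direct sums\<close>

lemma dsum_mod_simps:
  "\<zero>\<^bsub>dsum_mod I G\<^esub> = (\<lambda>i\<in>I. \<zero>\<^bsub>G i\<^esub>)"
  "x \<oplus>\<^bsub>dsum_mod I G\<^esub> y = (\<lambda>i\<in>I. x i \<oplus>\<^bsub>G i\<^esub> y i)"
  "a \<odot>\<^bsub>dsum_mod I G\<^esub> x = (\<lambda>i\<in>I. a \<odot>\<^bsub>G i\<^esub> x i)"
  by (simp_all add: dsum_mod_def)

lemma carrier_dsum_mod_finite:
  "finite I \<Longrightarrow> carrier (dsum_mod I G) = (\<Pi>\<^sub>E i\<in>I. carrier (G i))"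
  by (auto simp: dsum_mod_def)

lemma dsum_mod_component: "x \<in> carrier (dsum_mod I G) \<Longrightarrow> i \<in> I \<Longrightarrow> x i \<in> carrier (G i)"
  by (auto simp: dsum_mod_def)

lemma dsum_mod_eqI:
  assumes "x \<in> carrier (dsum_mod I G)" "y \<in> carrier (dsum_mod I G)"
    and "\<And>i. i \<in> I \<Longrightarrow> x i = y i"
  shows "x = y"
  using assms by (auto simp: dsum_mod_def PiE_iff intro: extensionalityI)

lemma module_dsum_mod:
  assumes k: "cring k" and fin: "finite I" and G: "\<And>i. i \<in> I \<Longrightarrow> module k (G i)"
  shows "module k (dsum_mod I G)"
proof -
  have [simp]: "carrier (dsum_mod I G) = (\<Pi>\<^sub>E i\<in>I. carrier (G i))"
    by (rule carrier_dsum_mod_finite[OF fin])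
  have ab: "abelian_group (G i)" if "i \<in> I" for i using G[OF that] by (simp add: module_def)
  note [simp] = abelian_groupE(1-3,5)[OF ab] module.smult_closed[OF G] module.smult_l_distr[OF G]
    module.smult_r_distr[OF G] module.smult_assoc1[OF G] module.smult_one[OF G]
  show ?thesis
  proof (rule moduleI)
    have neg: "\<exists>y\<in>carrier (dsum_mod I G). y \<oplus>\<^bsub>dsum_mod I G\<^esub> x = \<zero>\<^bsub>dsum_mod I G\<^esub>"
      if "x \<in> carrier (dsum_mod I G)" for x
    proof (rule bexI[where x = "\<lambda>i\<in>I. \<ominus>\<^bsub>G i\<^esub> x i"])
      show "(\<lambda>i\<in>I. \<ominus>\<^bsub>G i\<^esub> x i) \<in> carrier (dsum_mod I G)"
        using that by (auto simp: abelian_group.a_inv_closed[OF ab] PiE_iff)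
      show "(\<lambda>i\<in>I. \<ominus>\<^bsub>G i\<^esub> x i) \<oplus>\<^bsub>dsum_mod I G\<^esub> x = \<zero>\<^bsub>dsum_mod I G\<^esub>"
        using that by (auto simp: dsum_mod_simps abelian_group.l_neg[OF ab] PiE_iff fun_eq_iff)
    qed
    show "abelian_group (dsum_mod I G)"
    proof (rule abelian_groupI)
      fix x y z
      assume xyz: "x \<in> carrier (dsum_mod I G)" "y \<in> carrier (dsum_mod I G)"
        "z \<in> carrier (dsum_mod I G)"
      show "x \<oplus>\<^bsub>dsum_mod I G\<^esub> y \<oplus>\<^bsub>dsum_mod I G\<^esub> z = x \<oplus>\<^bsub>dsum_mod I G\<^esub> (y \<oplus>\<^bsub>dsum_mod I G\<^esub> z)"
        using xyz by (auto simp: dsum_mod_simps fun_eq_iff PiE_iff)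
    next
      fix x y
      assume xy: "x \<in> carrier (dsum_mod I G)" "y \<in> carrier (dsum_mod I G)"
      show "x \<oplus>\<^bsub>dsum_mod I G\<^esub> y = y \<oplus>\<^bsub>dsum_mod I G\<^esub> x"
        using xy abelian_groupE(4)[OF ab] by (auto simp: dsum_mod_simps fun_eq_iff PiE_iff)
      show "x \<oplus>\<^bsub>dsum_mod I G\<^esub> y \<in> carrier (dsum_mod I G)"
        using xy by (auto simp: dsum_mod_simps PiE_iff)
    next
      fix x assume x: "x \<in> carrier (dsum_mod I G)"
      show "\<zero>\<^bsub>dsum_mod I G\<^esub> \<oplus>\<^bsub>dsum_mod I G\<^esub> x = x"
        using x by (auto simp: dsum_mod_simps fun_eq_iff PiE_iff extensional_def)
    qed (use neg in \<open>auto simp: dsum_mod_simps\<close>)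
  qed (use k in \<open>auto simp: dsum_mod_simps PiE_iff fun_eq_iff extensional_def\<close>)
qed

lemma dsum_mod_projection:
  assumes "module k (dsum_mod I G)" "i \<in> I"
  shows "(\<lambda>x\<in>carrier (dsum_mod I G). x i) \<in> mod_hom k (dsum_mod I G) (G i)"
  using assms by (intro mod_hom_restrictI) (auto simp: dsum_mod_component dsum_mod_simps)

section \<open>Functors to modules and their natural transformations\<close>

lemma category_Ident: "is_category C \<Longrightarrow> S \<in> Ob C \<Longrightarrow> Ident C S \<in> Hom C S S"
  and category_Comp: "is_category C \<Longrightarrow> S \<in> Ob C \<Longrightarrow> T \<in> Ob C \<Longrightarrow> U \<in> Ob C \<Longrightarrow>
    f \<in> Hom C S T \<Longrightarrow> g \<in> Hom C T U \<Longrightarrow> Comp C S T U g f \<in> Hom C S U"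
  unfolding is_category_def by blast+

lemma cmodule_module: "is_functor C (kMod k) V \<Longrightarrow> S \<in> Ob C \<Longrightarrow> module k (ob_map V S)"
  and cmodule_hom: "is_functor C (kMod k) V \<Longrightarrow> S \<in> Ob C \<Longrightarrow> T \<in> Ob C \<Longrightarrow> f \<in> Hom C S T \<Longrightarrow>
    hom_map V S T f \<in> mod_hom k (ob_map V S) (ob_map V T)"
  and cmodule_Ident: "is_functor C (kMod k) V \<Longrightarrow> S \<in> Ob C \<Longrightarrow> x \<in> carrier (ob_map V S) \<Longrightarrow>
    hom_map V S S (Ident C S) x = x"
  and cmodule_Comp: "is_functor C (kMod k) V \<Longrightarrow> S \<in> Ob C \<Longrightarrow> T \<in> Ob C \<Longrightarrow> U \<in> Ob C \<Longrightarrow>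
    f \<in> Hom C S T \<Longrightarrow> g \<in> Hom C T U \<Longrightarrow> x \<in> carrier (ob_map V S) \<Longrightarrow>
    hom_map V S U (Comp C S T U g f) x = hom_map V T U g (hom_map V S T f x)"
  by (auto simp: is_functor_def kMod_def compose_eq)

lemma cmoduleI:
  assumes module: "\<And>S. S \<in> Ob C \<Longrightarrow> module k (ob_map V S)"
    and hom: "\<And>S T f. S \<in> Ob C \<Longrightarrow> T \<in> Ob C \<Longrightarrow> f \<in> Hom C S T \<Longrightarrow>
      hom_map V S T f \<in> mod_hom k (ob_map V S) (ob_map V T)"
    and Ident: "\<And>S x. S \<in> Ob C \<Longrightarrow> x \<in> carrier (ob_map V S) \<Longrightarrow> hom_map V S S (Ident C S) x = x"
    and Comp: "\<And>S T U f g x. S \<in> Ob C \<Longrightarrow> T \<in> Ob C \<Longrightarrow> U \<in> Ob C \<Longrightarrow> f \<in> Hom C S T \<Longrightarrow>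
      g \<in> Hom C T U \<Longrightarrow> x \<in> carrier (ob_map V S) \<Longrightarrow>
      hom_map V S U (Comp C S T U g f) x = hom_map V T U g (hom_map V S T f x)"
    and C: "is_category C"
  shows "is_functor C (kMod k) V"
  unfolding is_functor_def
proof (intro conjI ballI)
  fix S assume S: "S \<in> Ob C"
  then show "ob_map V S \<in> Ob (kMod k)" by (simp add: kMod_def module)
  have "Ident C S \<in> Hom C S S" using C S by (rule category_Ident)
  then have "hom_map V S S (Ident C S) \<in> extensional (carrier (ob_map V S))"
    by (intro mod_hom_extensional[of _ k _ "ob_map V S"] hom S)
  then show "hom_map V S S (Ident C S) = Ident (kMod k) (ob_map V S)"
    using Ident[OF S] by (auto simp: kMod_def intro!: extensionalityI)
next
  fix S T f assume "S \<in> Ob C" "T \<in> Ob C" "f \<in> Hom C S T"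
  then show "hom_map V S T f \<in> Hom (kMod k) (ob_map V S) (ob_map V T)"
    by (simp add: kMod_def hom)
next
  fix S T U f g
  assume *: "S \<in> Ob C" "T \<in> Ob C" "U \<in> Ob C" "f \<in> Hom C S T" "g \<in> Hom C T U"
  then have "Comp C S T U g f \<in> Hom C S U" by (rule category_Comp[OF C])
  then have "hom_map V S U (Comp C S T U g f) \<in> extensional (carrier (ob_map V S))"
    by (intro mod_hom_extensional[of _ k _ "ob_map V U"] hom *)
  then show "hom_map V S U (Comp C S T U g f) =
      Comp (kMod k) (ob_map V S) (ob_map V T) (ob_map V U) (hom_map V T U g) (hom_map V S T f)"
    using Comp[OF *] by (auto simp: kMod_def compose_eq intro!: extensionalityI)
qed

lemma nat_trans_mod_hom: "\<eta> \<in> nat_trans C k V W \<Longrightarrow> S \<in> Ob C \<Longrightarrow>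
    \<eta> S \<in> mod_hom k (ob_map V S) (ob_map W S)"
  by (auto simp: nat_trans_def)

lemma nat_trans_natural:
  assumes "\<eta> \<in> nat_trans C k V W" "S \<in> Ob C" "T \<in> Ob C" "f \<in> Hom C S T" "x \<in> carrier (ob_map V S)"
  shows "\<eta> T (hom_map V S T f x) = hom_map W S T f (\<eta> S x)"
proof -
  have "compose (carrier (ob_map V S)) (\<eta> T) (hom_map V S T f) x =
      compose (carrier (ob_map V S)) (hom_map W S T f) (\<eta> S) x"
    using assms by (simp add: nat_trans_def)
  then show ?thesis using assms(5) by (simp add: compose_eq)
qed

lemma nat_transI:
  assumes "\<And>S. S \<in> Ob C \<Longrightarrow> \<eta> S \<in> mod_hom k (ob_map V S) (ob_map W S)"
    and "\<eta> \<in> extensional (Ob C)"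
    and "\<And>S T f x. S \<in> Ob C \<Longrightarrow> T \<in> Ob C \<Longrightarrow> f \<in> Hom C S T \<Longrightarrow> x \<in> carrier (ob_map V S) \<Longrightarrow>
      \<eta> T (hom_map V S T f x) = hom_map W S T f (\<eta> S x)"
  shows "\<eta> \<in> nat_trans C k V W"
  unfolding nat_trans_def
  using assms by (auto simp: PiE_iff compose_def intro!: restrict_ext)

lemma nat_comp_apply: "S \<in> Ob C \<Longrightarrow> x \<in> carrier (ob_map V S) \<Longrightarrow> nat_comp C V \<theta> \<eta> S x = \<theta> S (\<eta> S x)"
  by (simp add: nat_comp_def compose_eq)

lemma nat_id_apply: "S \<in> Ob C \<Longrightarrow> x \<in> carrier (ob_map V S) \<Longrightarrow> nat_id C V S x = x"
  by (simp add: nat_id_def)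

lemma nat_comp_eqI:
  assumes "\<And>S x. S \<in> Ob C \<Longrightarrow> x \<in> carrier (ob_map V S) \<Longrightarrow> \<theta> S (\<eta> S x) = \<theta>' S (\<eta>' S x)"
  shows "nat_comp C V \<theta> \<eta> = nat_comp C V \<theta>' \<eta>'"
  using assms by (auto simp: nat_comp_def compose_def intro!: restrict_ext)

text \<open>Components of natural transformations are extensional, so agreement on the carriers is enough.\<close>

lemma nat_trans_eqI:
  assumes "\<eta> \<in> nat_trans C k V W" "\<theta> \<in> nat_trans C k V W'"
    and "\<And>S x. S \<in> Ob C \<Longrightarrow> x \<in> carrier (ob_map V S) \<Longrightarrow> \<eta> S x = \<theta> S x"
  shows "\<eta> = \<theta>"
proof (rule extensionalityI)
  show "\<eta> \<in> extensional (Ob C)" "\<theta> \<in> extensional (Ob C)"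
    using assms by (auto simp: nat_trans_def PiE_iff)
  show "\<eta> S = \<theta> S" if "S \<in> Ob C" for S
    using assms(3)[OF that] mod_hom_extensional[OF nat_trans_mod_hom[OF assms(1) that]]
      mod_hom_extensional[OF nat_trans_mod_hom[OF assms(2) that]]
    by (intro extensionalityI)
qed

lemma nat_comp_nat_trans:
  assumes V: "is_functor C (kMod k) V"
    and \<eta>: "\<eta> \<in> nat_trans C k V W" and \<theta>: "\<theta> \<in> nat_trans C k W X"
  shows "nat_comp C V \<theta> \<eta> \<in> nat_trans C k V X"
proof (rule nat_transI)
  fix S assume S: "S \<in> Ob C"
  show "nat_comp C V \<theta> \<eta> S \<in> mod_hom k (ob_map V S) (ob_map X S)"
    using mod_hom_compose[OF nat_trans_mod_hom[OF \<eta> S] nat_trans_mod_hom[OF \<theta> S] cmodule_module[OF V S]]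
    by (simp add: nat_comp_def S)
next
  fix S T f x assume *: "S \<in> Ob C" "T \<in> Ob C" "f \<in> Hom C S T" and x: "x \<in> carrier (ob_map V S)"
  then show "nat_comp C V \<theta> \<eta> T (hom_map V S T f x) = hom_map X S T f (nat_comp C V \<theta> \<eta> S x)"
    by (simp add: nat_comp_apply mod_hom_closed[OF cmodule_hom[OF V]] nat_trans_natural[OF \<eta> *]
        nat_trans_natural[OF \<theta> *] mod_hom_closed[OF nat_trans_mod_hom[OF \<eta>]])
qed (simp add: nat_comp_def)

text \<open>Every element of the target is the image of a unique element of the source, and the laws of
  modules and functors are carried over from there. This covers targets such as a direct sum of
  functors, of which just the record is given.\<close>

lemma nat_inverse:
  assumes V: "is_functor C (kMod k) V" and \<eta>: "\<eta> \<in> nat_trans C k V W"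
    and bij: "\<And>S. S \<in> Ob C \<Longrightarrow> bij_betw (\<eta> S) (carrier (ob_map V S)) (carrier (ob_map W S))"
  obtains \<theta> where "\<theta> \<in> nat_trans C k W V"
    and "\<And>S x. S \<in> Ob C \<Longrightarrow> x \<in> carrier (ob_map V S) \<Longrightarrow> \<theta> S (\<eta> S x) = x"
    and "\<And>S y. S \<in> Ob C \<Longrightarrow> y \<in> carrier (ob_map W S) \<Longrightarrow> \<eta> S (\<theta> S y) = y"
proof -
  define \<theta> where "\<theta> = (\<lambda>S\<in>Ob C. \<lambda>y\<in>carrier (ob_map W S). inv_into (carrier (ob_map V S)) (\<eta> S) y)"
  note \<eta>_hom = nat_trans_mod_hom[OF \<eta>]
  have \<theta>\<eta>: "\<theta> S (\<eta> S x) = x" if "S \<in> Ob C" "x \<in> carrier (ob_map V S)" for S x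
    using that bij[OF that(1)] mod_hom_closed[OF \<eta>_hom] by (simp add: \<theta>_def bij_betw_def)
  have surj: "\<exists>x\<in>carrier (ob_map V S). y = \<eta> S x" if "S \<in> Ob C" "y \<in> carrier (ob_map W S)" for S y
    using that bij[OF that(1)] by (auto simp: bij_betw_def)
  have "\<theta> \<in> nat_trans C k W V"
  proof (rule nat_transI)
    fix S assume S: "S \<in> Ob C"
    interpret module k "ob_map V S" by (rule cmodule_module[OF V S])
    show "\<theta> S \<in> mod_hom k (ob_map W S) (ob_map V S)"
    proof (rule mod_homI)
      fix y z assume "y \<in> carrier (ob_map W S)" "z \<in> carrier (ob_map W S)"
      then obtain x w where "x \<in> carrier (ob_map V S)" "y = \<eta> S x"
        "w \<in> carrier (ob_map V S)" "z = \<eta> S w"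
        using surj[OF S] by metis
      then show "\<theta> S (y \<oplus>\<^bsub>ob_map W S\<^esub> z) = \<theta> S y \<oplus>\<^bsub>ob_map V S\<^esub> \<theta> S z"
        by (simp add: mod_hom_add[OF \<eta>_hom[OF S], symmetric] \<theta>\<eta>[OF S])
    next
      fix a y assume "a \<in> carrier k" "y \<in> carrier (ob_map W S)"
      moreover from this obtain x where "x \<in> carrier (ob_map V S)" "y = \<eta> S x"
        using surj[OF S] by metis
      ultimately show "\<theta> S (a \<odot>\<^bsub>ob_map W S\<^esub> y) = a \<odot>\<^bsub>ob_map V S\<^esub> \<theta> S y"
        by (simp add: mod_hom_smult[OF \<eta>_hom[OF S], symmetric] \<theta>\<eta>[OF S])
    next
      fix y assume "y \<in> carrier (ob_map W S)"
      then show "\<theta> S y \<in> carrier (ob_map V S)" using surj[OF S] \<theta>\<eta>[OF S] by metis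
    qed (simp add: \<theta>_def S)
  next
    fix S T f y assume *: "S \<in> Ob C" "T \<in> Ob C" "f \<in> Hom C S T" and y: "y \<in> carrier (ob_map W S)"
    obtain x where "x \<in> carrier (ob_map V S)" "y = \<eta> S x" using surj[OF *(1) y] by metis
    then show "\<theta> T (hom_map W S T f y) = hom_map V S T f (\<theta> S y)"
      by (simp add: nat_trans_natural[OF \<eta> *, symmetric] \<theta>\<eta> * mod_hom_closed[OF cmodule_hom[OF V *]])
  qed (simp add: \<theta>_def)
  moreover have "\<eta> S (\<theta> S y) = y" if "S \<in> Ob C" "y \<in> carrier (ob_map W S)" for S y
    using surj[OF that] \<theta>\<eta>[OF that(1)] by metis
  ultimately show thesis using \<theta>\<eta> by (intro that)
qed

lemma nat_isosI:
  assumes V: "is_functor C (kMod k) V" and \<eta>: "\<eta> \<in> nat_trans C k V W"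
    and bij: "\<And>S. S \<in> Ob C \<Longrightarrow> bij_betw (\<eta> S) (carrier (ob_map V S)) (carrier (ob_map W S))"
  shows "\<eta> \<in> nat_isos C k V W"
proof -
  obtain \<theta> where \<theta>: "\<theta> \<in> nat_trans C k W V"
    and 1: "\<And>S x. S \<in> Ob C \<Longrightarrow> x \<in> carrier (ob_map V S) \<Longrightarrow> \<theta> S (\<eta> S x) = x"
    and 2: "\<And>S y. S \<in> Ob C \<Longrightarrow> y \<in> carrier (ob_map W S) \<Longrightarrow> \<eta> S (\<theta> S y) = y"
    using nat_inverse[OF assms] by metis
  have "nat_comp C V \<theta> \<eta> = nat_id C V" "nat_comp C W \<eta> \<theta> = nat_id C W"
    by (auto simp: nat_comp_def nat_id_def compose_def 1 2 intro!: restrict_ext)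
  then show ?thesis using \<eta> \<theta> by (auto simp: nat_isos_def)
qed

lemma functors_isomorphicI:
  assumes "\<And>V. V \<in> Ob A \<Longrightarrow> is_functor C (kMod k) (ob_map F V)"
    and "\<And>V. V \<in> Ob A \<Longrightarrow> \<alpha> V \<in> nat_trans C k (ob_map F V) (ob_map G V)"
    and "\<And>V S. V \<in> Ob A \<Longrightarrow> S \<in> Ob C \<Longrightarrow>
      bij_betw (\<alpha> V S) (carrier (ob_map (ob_map F V) S)) (carrier (ob_map (ob_map G V) S))"
    and "\<And>V W f S x. V \<in> Ob A \<Longrightarrow> W \<in> Ob A \<Longrightarrow> f \<in> Hom A V W \<Longrightarrow> S \<in> Ob C \<Longrightarrow>
      x \<in> carrier (ob_map (ob_map F V) S) \<Longrightarrow>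
      \<alpha> W S (hom_map F V W f S x) = hom_map G V W f S (\<alpha> V S x)"
  shows "functors_isomorphic A C k F G"
  unfolding functors_isomorphic_def
  using assms by (intro exI[of _ \<alpha>] conjI ballI nat_isosI nat_comp_eqI)

lemma functors_isomorphic_sym:
  assumes F: "\<And>V. V \<in> Ob A \<Longrightarrow> is_functor C (kMod k) (ob_map F V)"
    and hom: "\<And>V W f. V \<in> Ob A \<Longrightarrow> W \<in> Ob A \<Longrightarrow> f \<in> Hom A V W \<Longrightarrow>
      hom_map F V W f \<in> nat_trans C k (ob_map F V) (ob_map F W)"
    and iso: "functors_isomorphic A C k F G"
  shows "functors_isomorphic A C k G F"
proof -
  obtain \<alpha> where \<alpha>: "\<And>V. V \<in> Ob A \<Longrightarrow> \<alpha> V \<in> nat_isos C k (ob_map F V) (ob_map G V)"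
    and nat: "\<And>V W f. V \<in> Ob A \<Longrightarrow> W \<in> Ob A \<Longrightarrow> f \<in> Hom A V W \<Longrightarrow>
      nat_comp C (ob_map F V) (\<alpha> W) (hom_map F V W f) =
      nat_comp C (ob_map F V) (hom_map G V W f) (\<alpha> V)"
    using iso unfolding functors_isomorphic_def by blast
  have "\<exists>\<theta>. \<theta> \<in> nat_trans C k (ob_map G V) (ob_map F V) \<and>
      nat_comp C (ob_map F V) \<theta> (\<alpha> V) = nat_id C (ob_map F V) \<and>
      nat_comp C (ob_map G V) (\<alpha> V) \<theta> = nat_id C (ob_map G V)" if "V \<in> Ob A" for V
    using \<alpha>[OF that] by (auto simp: nat_isos_def)
  then obtain \<beta> where \<beta>: "\<And>V. V \<in> Ob A \<Longrightarrow> \<beta> V \<in> nat_trans C k (ob_map G V) (ob_map F V) \<and>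
      nat_comp C (ob_map F V) (\<beta> V) (\<alpha> V) = nat_id C (ob_map F V) \<and>
      nat_comp C (ob_map G V) (\<alpha> V) (\<beta> V) = nat_id C (ob_map G V)" by metis
  have \<alpha>_trans: "\<alpha> V \<in> nat_trans C k (ob_map F V) (ob_map G V)" if "V \<in> Ob A" for V
    using \<alpha>[OF that] by (simp add: nat_isos_def)
  have \<beta>\<alpha>: "\<beta> V S (\<alpha> V S x) = x"
    if "V \<in> Ob A" "S \<in> Ob C" "x \<in> carrier (ob_map (ob_map F V) S)" for V S x
    using \<beta>[OF that(1)] that nat_comp_apply[of S C x "ob_map F V" "\<beta> V" "\<alpha> V"]
    by (simp add: nat_id_apply)
  have \<alpha>\<beta>: "\<alpha> V S (\<beta> V S x) = x"
    if "V \<in> Ob A" "S \<in> Ob C" "x \<in> carrier (ob_map (ob_map G V) S)" for V S x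
    using \<beta>[OF that(1)] that nat_comp_apply[of S C x "ob_map G V" "\<alpha> V" "\<beta> V"]
    by (simp add: nat_id_apply)
  have "\<beta> V \<in> nat_isos C k (ob_map G V) (ob_map F V)" if "V \<in> Ob A" for V
    using \<beta>[OF that] \<alpha>_trans[OF that] by (auto simp: nat_isos_def)
  moreover have "nat_comp C (ob_map G V) (\<beta> W) (hom_map G V W f) =
      nat_comp C (ob_map G V) (hom_map F V W f) (\<beta> V)"
    if V: "V \<in> Ob A" and W: "W \<in> Ob A" and f: "f \<in> Hom A V W" for V W f
  proof (rule nat_comp_eqI)
    fix S y assume S: "S \<in> Ob C" and y: "y \<in> carrier (ob_map (ob_map G V) S)"
    define x where "x = \<beta> V S y"
    have x: "x \<in> carrier (ob_map (ob_map F V) S)"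
      using \<beta>[OF V] y S by (auto simp: x_def intro: mod_hom_closed[OF nat_trans_mod_hom])
    have "\<beta> W S (hom_map G V W f S y) = \<beta> W S (hom_map G V W f S (\<alpha> V S x))"
      by (simp add: x_def \<alpha>\<beta>[OF V S y])
    also have "\<dots> = \<beta> W S (\<alpha> W S (hom_map F V W f S x))"
      using fun_cong[OF fun_cong[OF nat[OF V W f]], of S x] S x by (simp add: nat_comp_apply)
    also have "\<dots> = hom_map F V W f S x"
      using \<beta>\<alpha>[OF W S] mod_hom_closed[OF nat_trans_mod_hom[OF hom[OF V W f] S] x] by simp
    finally show "\<beta> W S (hom_map G V W f S y) = hom_map F V W f S (\<beta> V S y)"
      by (simp add: x_def)
  qed
  ultimately show ?thesis unfolding functors_isomorphic_def by blast
qed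

lemma is_functor_comp_functor:
  assumes "is_functor C D F" "is_functor D E G" shows "is_functor C E (comp_functor G F)"
  using assms by (simp add: is_functor_def comp_functor_def)

text \<open>The functor laws between categories of modules are equalities of natural transformations; here
  they are reduced to equalities at elements.\<close>

lemma is_functor_Mod_catI:
  assumes ob: "\<And>V. is_functor C (kMod k) V \<Longrightarrow> is_functor D (kMod k) (ob_map F V)"
    and hom: "\<And>V W \<eta>. is_functor C (kMod k) V \<Longrightarrow> is_functor C (kMod k) W \<Longrightarrow>
      \<eta> \<in> nat_trans C k V W \<Longrightarrow> hom_map F V W \<eta> \<in> nat_trans D k (ob_map F V) (ob_map F W)"
    and Ident: "\<And>V S x. is_functor C (kMod k) V \<Longrightarrow> S \<in> Ob D \<Longrightarrow> x \<in> carrier (ob_map (ob_map F V) S) \<Longrightarrow>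
      hom_map F V V (nat_id C V) S x = x"
    and Comp: "\<And>U V W \<eta> \<theta> S x. is_functor C (kMod k) U \<Longrightarrow> is_functor C (kMod k) V \<Longrightarrow>
      is_functor C (kMod k) W \<Longrightarrow> \<eta> \<in> nat_trans C k U V \<Longrightarrow> \<theta> \<in> nat_trans C k V W \<Longrightarrow>
      S \<in> Ob D \<Longrightarrow> x \<in> carrier (ob_map (ob_map F U) S) \<Longrightarrow>
      hom_map F U W (nat_comp C U \<theta> \<eta>) S x = hom_map F V W \<theta> S (hom_map F U V \<eta> S x)"
  shows "is_functor (Mod_cat C k) (Mod_cat D k) F"
proof -
  have id_in: "nat_id C V \<in> nat_trans C k V V" if "is_functor C (kMod k) V" for V
    using category_Ident[OF is_category_Mod_cat[of C k]] that by (simp add: Mod_cat_def)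
  have id_in': "nat_id D V \<in> nat_trans D k V V" if "is_functor D (kMod k) V" for V
    using category_Ident[OF is_category_Mod_cat[of D k]] that by (simp add: Mod_cat_def)
  have "hom_map F V V (nat_id C V) = nat_id D (ob_map F V)" if V: "is_functor C (kMod k) V" for V
    using Ident[OF V] by (intro nat_trans_eqI[OF hom[OF V V id_in[OF V]] id_in'[OF ob[OF V]]])
      (simp add: nat_id_apply)
  moreover have "hom_map F U W (nat_comp C U \<theta> \<eta>) =
      nat_comp D (ob_map F U) (hom_map F V W \<theta>) (hom_map F U V \<eta>)"
    if *: "is_functor C (kMod k) U" "is_functor C (kMod k) V" "is_functor C (kMod k) W"
      "\<eta> \<in> nat_trans C k U V" "\<theta> \<in> nat_trans C k V W" for U V W \<eta> \<theta>
    using Comp[OF *]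
    by (intro nat_trans_eqI[OF hom[OF *(1,3) nat_comp_nat_trans[OF *(1,4,5)]]
          nat_comp_nat_trans[OF ob[OF *(1)] hom[OF *(1,2,4)] hom[OF *(2,3,5)]]])
      (simp add: nat_comp_apply)
  ultimately show ?thesis
    using ob hom
    unfolding is_functor_def[of "Mod_cat C k" "Mod_cat D k" F] by (simp add: Mod_cat_def)
qed

section \<open>Commuting idempotents\<close>

text \<open>The projection is the product of the maps \<open>1 - e\<^sub>i\<close>. The factor \<open>1 - e\<^sub>i\<close> can be moved to either end
  because the idempotents commute, so the product kills the images of all \<open>e\<^sub>i\<close> and lands in all their
  kernels. Multiplying out, the product differs from the identity by values of the \<open>e\<^sub>i\<close>, which lie in
  \<open>U\<close>.\<close>

lemma commuting_idempotents_projection: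
  fixes k :: "('k, 'x) ring_scheme" and M :: "('k, 'm) module"
  assumes M: "module k M" and I: "finite I"
    and e: "\<And>i. i \<in> I \<Longrightarrow> e i \<in> mod_hom k M M"
    and idem: "\<And>i x. i \<in> I \<Longrightarrow> x \<in> carrier M \<Longrightarrow> e i (e i x) = e i x"
    and comm: "\<And>i j x. i \<in> I \<Longrightarrow> j \<in> I \<Longrightarrow> x \<in> carrier M \<Longrightarrow> e i (e j x) = e j (e i x)"
    and U: "submodule U k M" "\<And>i x. i \<in> I \<Longrightarrow> x \<in> carrier M \<Longrightarrow> e i x \<in> U"
  obtains p where "p \<in> mod_hom k M M"
    and "\<And>i x. i \<in> I \<Longrightarrow> x \<in> carrier M \<Longrightarrow> p (e i x) = \<zero>\<^bsub>M\<^esub>"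
    and "\<And>i x. i \<in> I \<Longrightarrow> x \<in> carrier M \<Longrightarrow> e i (p x) = \<zero>\<^bsub>M\<^esub>"
    and "\<And>x. x \<in> carrier M \<Longrightarrow> (\<And>i. i \<in> I \<Longrightarrow> e i x = \<zero>\<^bsub>M\<^esub>) \<Longrightarrow> p x = x"
    and "\<And>x. x \<in> carrier M \<Longrightarrow> x \<ominus>\<^bsub>M\<^esub> p x \<in> U"
proof -
  interpret M: module k M by (rule M)
  note e_closed = mod_hom_closed[OF e] and e_minus = mod_hom_minus[OF M M e]
  \<comment> \<open>The factors are multiplied in one at a time. That \<open>p\<close> commutes with all idempotents, also with those
    not yet used, keeps the induction going.\<close>
  have "\<exists>p\<in>mod_hom k M M.
      (\<forall>i\<in>J. \<forall>x\<in>carrier M. p (e i x) = \<zero>\<^bsub>M\<^esub> \<and> e i (p x) = \<zero>\<^bsub>M\<^esub>) \<and>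
      (\<forall>x\<in>carrier M. (\<forall>i\<in>J. e i x = \<zero>\<^bsub>M\<^esub>) \<longrightarrow> p x = x) \<and>
      (\<forall>x\<in>carrier M. x \<ominus>\<^bsub>M\<^esub> p x \<in> U) \<and>
      (\<forall>i\<in>I. \<forall>x\<in>carrier M. e i (p x) = p (e i x))" if "J \<subseteq> I" for J
    using finite_subset[OF that I] that
  proof (induction J rule: finite_induct)
    case empty
    have "(\<lambda>x\<in>carrier M. x) \<in> mod_hom k M M" by (rule mod_hom_restrictI[OF M]) auto
    moreover have "x \<ominus>\<^bsub>M\<^esub> x \<in> U" if "x \<in> carrier M" for x
      using that submodule_mem(2)[OF M U(1)] by (simp add: a_minus_def M.r_neg)
    ultimately show ?case using e_closed by (intro bexI[where x = "\<lambda>x\<in>carrier M. x"]) auto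
  next
    case (insert j J)
    then obtain p where p: "p \<in> mod_hom k M M"
      and p0: "\<And>i x. i \<in> J \<Longrightarrow> x \<in> carrier M \<Longrightarrow> p (e i x) = \<zero>\<^bsub>M\<^esub> \<and> e i (p x) = \<zero>\<^bsub>M\<^esub>"
      and p1: "\<And>x. x \<in> carrier M \<Longrightarrow> \<forall>i\<in>J. e i x = \<zero>\<^bsub>M\<^esub> \<Longrightarrow> p x = x"
      and pU: "\<And>x. x \<in> carrier M \<Longrightarrow> x \<ominus>\<^bsub>M\<^esub> p x \<in> U"
      and pe: "\<And>i x. i \<in> I \<Longrightarrow> x \<in> carrier M \<Longrightarrow> e i (p x) = p (e i x)"
      by auto
    have j: "j \<in> I" and J: "J \<subseteq> I" using insert by auto
    note p_closed = mod_hom_closed[OF p]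
    define q where "q = (\<lambda>x\<in>carrier M. p (x \<ominus>\<^bsub>M\<^esub> e j x))"
    have q: "q x = p x \<ominus>\<^bsub>M\<^esub> p (e j x)" if "x \<in> carrier M" for x
      using that by (simp add: q_def mod_hom_minus[OF M M p] e_closed j)
    have "q \<in> mod_hom k M M" unfolding q_def
      by (rule mod_hom_restrictI[OF M])
        (simp_all add: a_minus_def e_closed[OF j] p_closed mod_hom_add[OF e[OF j]]
          mod_hom_smult[OF e[OF j]] M.minus_add M.smult_r_distr M.smult_r_minus M.M.a_ac
          mod_hom_add[OF p, symmetric] mod_hom_smult[OF p, symmetric])
    moreover have "q (e i x) = \<zero>\<^bsub>M\<^esub> \<and> e i (q x) = \<zero>\<^bsub>M\<^esub>" if "i \<in> insert j J" "x \<in> carrier M" for i x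
    proof -
      have i: "i \<in> I" using that j J by auto
      have eq: "e i (q x) = q (e i x)"
        using that i j by (simp add: q e_closed p_closed e_minus pe comm[of j i])
      have "p (e i x) \<ominus>\<^bsub>M\<^esub> p (e j (e i x)) = \<zero>\<^bsub>M\<^esub>"
      proof (cases "i = j")
        case True
        then show ?thesis using that j by (simp add: idem e_closed p_closed a_minus_def M.r_neg)
      next
        case False
        then have "i \<in> J" using that by simp
        then show ?thesis
          using that i j p0 by (simp add: comm[of j i] e_closed a_minus_def)
      qed
      then show ?thesis using eq that i by (simp add: q e_closed)
    qed
    moreover have "q x = x" if "x \<in> carrier M" "\<forall>i\<in>insert j J. e i x = \<zero>\<^bsub>M\<^esub>" for x
      using that p1[OF that(1)] by (simp add: q mod_hom_zero[OF M M p] a_minus_def)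
    moreover have "x \<ominus>\<^bsub>M\<^esub> q x \<in> U" if "x \<in> carrier M" for x
    proof -
      let ?y = "x \<ominus>\<^bsub>M\<^esub> e j x"
      have y: "?y \<in> carrier M" using that j by (simp add: e_closed)
      have "(?y \<ominus>\<^bsub>M\<^esub> p ?y) \<oplus>\<^bsub>M\<^esub> e j x \<in> U"
        using pU[OF y] U(2)[OF j that] submodule_mem(3)[OF M U(1)] by blast
      also have "(?y \<ominus>\<^bsub>M\<^esub> p ?y) \<oplus>\<^bsub>M\<^esub> e j x = (?y \<oplus>\<^bsub>M\<^esub> e j x) \<ominus>\<^bsub>M\<^esub> p ?y"
        using y p_closed[OF y] e_closed[OF j that]
        by (simp add: a_minus_def[of M _ "p ?y"] M.M.a_ac)
      also have "?y \<oplus>\<^bsub>M\<^esub> e j x = x"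
        using that e_closed[OF j that] by (simp add: a_minus_def M.M.a_assoc M.l_neg)
      finally show ?thesis using that by (simp add: q_def)
    qed
    moreover have "e i (q x) = q (e i x)" if "i \<in> I" "x \<in> carrier M" for i x
      using that j by (simp add: q e_closed p_closed e_minus pe comm[of j i])
    ultimately show ?case by (intro bexI[where x = q]) auto
  qed
  from this[OF subset_refl] show thesis by (auto intro: that)
qed

section \<open>Partial identities\<close>

lemma Ob_simps [simp]: "S \<in> Ob FB \<longleftrightarrow> finite S" "S \<in> Ob FI \<longleftrightarrow> finite S"
  "S \<in> Ob FIsharp \<longleftrightarrow> finite S"
  by (simp_all add: FB_def FI_def FIsharp_def)

lemma Hom_FB: "f \<in> Hom FB S T \<longleftrightarrow> f \<in> extensional S \<and> bij_betw f S T"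
  by (simp add: FB_def)

lemma Hom_FI: "f \<in> Hom FI S T \<longleftrightarrow> f \<in> extensional S \<and> inj_on f S \<and> f ` S \<subseteq> T"
  by (simp add: FI_def)

lemma Hom_FIsharp: "(A, B, \<phi>) \<in> Hom FIsharp S T \<longleftrightarrow>
    A \<subseteq> S \<and> B \<subseteq> T \<and> \<phi> \<in> extensional A \<and> bij_betw \<phi> A B"
  by (simp add: FIsharp_def)

lemma Comp_FB: "Comp FB S T U g f = compose S g f" and Comp_FI: "Comp FI S T U g f = compose S g f"
  by (simp_all add: FB_def FI_def)

lemma Comp_FIsharp: "Comp FIsharp S T U (C, D, \<psi>) (A, B, \<phi>) =
    ({x \<in> A. \<phi> x \<in> B \<inter> C}, \<psi> ` (B \<inter> C), compose {x \<in> A. \<phi> x \<in> B \<inter> C} \<psi> \<phi>)"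
  by (simp add: FIsharp_def Let_def)

lemma Ident_simps: "Ident FB S = (\<lambda>x\<in>S. x)" "Ident FI S = (\<lambda>x\<in>S. x)"
  by (simp_all add: FB_def FI_def)

text \<open>The same triple serves as three kinds of morphism: the inclusion of \<open>T\<close> into a larger set, the
  restriction of a larger set to \<open>T\<close>, and the idempotent endomorphism of a larger set supported
  on \<open>T\<close>. A single composition rule then covers all their combinations.\<close>

definition partial_id :: "'u set \<Rightarrow> 'u set \<times> 'u set \<times> ('u \<Rightarrow> 'u)" where
  "partial_id T = (T, T, \<lambda>x\<in>T. x)"

lemma partial_id_Hom: "partial_id R \<in> Hom FIsharp S T \<longleftrightarrow> R \<subseteq> S \<inter> T"
  by (auto simp: partial_id_def Hom_FIsharp bij_betw_def inj_on_def)

lemma partial_id_Ident: "partial_id S = Ident FIsharp S"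
  by (simp add: partial_id_def FIsharp_def)

lemma partial_id_Comp: "Comp FIsharp S T U (partial_id R) (partial_id Q) = partial_id (Q \<inter> R)"
  by (auto simp: partial_id_def Comp_FIsharp compose_def fun_eq_iff)

lemma partial_id_Comp_left:
  assumes "(A, B, \<phi>) \<in> Hom FIsharp S T" "B \<subseteq> R"
  shows "Comp FIsharp S T U (partial_id R) (A, B, \<phi>) = (A, B, \<phi>)"
proof -
  have "{x \<in> A. \<phi> x \<in> B \<inter> R} = A" "B \<inter> R = B"
    using assms by (auto simp: Hom_FIsharp bij_betw_def)
  then show ?thesis
    using assms
    by (auto simp: partial_id_def Comp_FIsharp compose_def Hom_FIsharp extensional_def fun_eq_iff
        bij_betw_def subset_iff)
qed

lemma preimage_Hom_FB:
  assumes "(A, B, \<phi>) \<in> Hom FIsharp S T" "T' \<subseteq> B"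
  shows "restrict \<phi> {a \<in> A. \<phi> a \<in> T'} \<in> Hom FB {a \<in> A. \<phi> a \<in> T'} T'"
  using assms by (auto simp: Hom_FB Hom_FIsharp bij_betw_def inj_on_def image_iff)

text \<open>This makes restriction to subsets natural on \<open>FI\<sharp>\<close>: a partial injection followed by the restriction
  to \<open>T'\<close> is the restriction to the preimage of \<open>T'\<close> followed by the bijection that remains.\<close>

lemma restriction_Comp:
  assumes "(A, B, \<phi>) \<in> Hom FIsharp S T" "T' \<subseteq> B"
  defines "R \<equiv> {a \<in> A. \<phi> a \<in> T'}"
  shows "Comp FIsharp S T T' (partial_id T') (A, B, \<phi>) =
    Comp FIsharp S R T' (R, T', restrict \<phi> R) (partial_id R)"
  using assms(1,2)
  by (auto simp: partial_id_def Comp_FIsharp compose_def Hom_FIsharp bij_betw_def R_def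
      fun_eq_iff image_iff)

context
  fixes k :: "('k, 'x) ring_scheme" and V :: "('u set, 'u set \<times> 'u set \<times> ('u \<Rightarrow> 'u), 'k, 'm) cmodule"
  assumes V: "is_functor FIsharp (kMod k) V"
begin

lemma partial_id_mod_hom:
  "finite S \<Longrightarrow> finite T \<Longrightarrow> R \<subseteq> S \<inter> T \<Longrightarrow>
    hom_map V S T (partial_id R) \<in> mod_hom k (ob_map V S) (ob_map V T)"
  by (simp add: cmodule_hom[OF V] partial_id_Hom)

lemma partial_id_partial_id:
  assumes "finite S" "finite T" "finite U" "Q \<subseteq> S \<inter> T" "R \<subseteq> T \<inter> U" "x \<in> carrier (ob_map V S)"
  shows "hom_map V T U (partial_id R) (hom_map V S T (partial_id Q) x) =
    hom_map V S U (partial_id (Q \<inter> R)) x"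
  using assms by (simp add: cmodule_Comp[OF V, symmetric] partial_id_Hom partial_id_Comp)

lemma partial_id_self:
  "finite S \<Longrightarrow> x \<in> carrier (ob_map V S) \<Longrightarrow> hom_map V S S (partial_id S) x = x"
  using cmodule_Ident[OF V] by (simp add: partial_id_Ident)

end

section \<open>The submodule of decomposable elements\<close>

lemma cmodule_FI:
  "is_functor FIsharp (kMod k) V \<Longrightarrow> is_functor FI (kMod k) (comp_functor V FI_to_FIsharp)"
  by (rule is_functor_comp_functor[OF is_functor_FI_to_FIsharp])

lemma FI_decomposables_generator:
  assumes V: "is_functor FI (kMod k) V" and "finite S" "finite T" "card T < card S"
    and f: "f \<in> Hom FI T S" and x: "x \<in> carrier (ob_map V T)"
  shows "hom_map V T S f x \<in> FI_decomposables k V S"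
  unfolding FI_decomposables_def
  by (rule subsetD[OF mod_span_superset]) (use assms in auto)

lemma FI_decomposables_induct:
  assumes V: "is_functor FI (kMod k) V" and S: "finite S"
    and N: "submodule N k (ob_map V S)"
    and "\<And>T f x. finite T \<Longrightarrow> card T < card S \<Longrightarrow> f \<in> Hom FI T S \<Longrightarrow> x \<in> carrier (ob_map V T) \<Longrightarrow>
      hom_map V T S f x \<in> N"
  shows "FI_decomposables k V S \<subseteq> N"
  unfolding FI_decomposables_def by (rule mod_span_minimal[OF N]) (use assms in auto)

lemma FI_decomposables_submodule:
  assumes V: "is_functor FI (kMod k) V" and S: "finite S"
  shows "submodule (FI_decomposables k V S) k (ob_map V S)"
  unfolding FI_decomposables_def
  by (rule mod_span_submodule)
    (use S mod_hom_closed[OF cmodule_hom[OF V]] in \<open>auto simp: cmodule_module[OF V]\<close>)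

lemma FB_Hom_FI: "f \<in> Hom FB S T \<Longrightarrow> f \<in> Hom FI S T"
  by (auto simp: Hom_FB Hom_FI bij_betw_def)

text \<open>Bijections preserve cardinality, so that composing with one maps generators to generators.\<close>

lemma FI_decomposables_bijection:
  assumes V: "is_functor FI (kMod k) V" and S: "finite S" and T: "finite T"
    and f: "f \<in> Hom FB S T" and x: "x \<in> FI_decomposables k V S"
  shows "hom_map V S T f x \<in> FI_decomposables k V T"
proof -
  have "FI_decomposables k V S \<subseteq>
      {x \<in> carrier (ob_map V S). hom_map V S T f x \<in> FI_decomposables k V T}"
  proof (rule FI_decomposables_induct[OF V S])
    show "submodule {x \<in> carrier (ob_map V S). hom_map V S T f x \<in> FI_decomposables k V T} k (ob_map V S)"
      using S T FB_Hom_FI[OF f]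
      by (intro submodule_vimage[of k _ "ob_map V T"] FI_decomposables_submodule[OF V])
        (auto simp: cmodule_module[OF V] cmodule_hom[OF V])
  next
    fix R g x
    assume R: "finite R" "card R < card S" and g: "g \<in> Hom FI R S" and x: "x \<in> carrier (ob_map V R)"
    have "hom_map V S T f (hom_map V R S g x) = hom_map V R T (Comp FI R S T f g) x"
      using R S T g x FB_Hom_FI[OF f] by (simp add: cmodule_Comp[OF V])
    moreover have "Comp FI R S T f g \<in> Hom FI R T"
      using R S T g FB_Hom_FI[OF f] by (intro category_Comp[OF is_category_FI]) auto
    moreover have "card S = card T" using f by (auto simp: Hom_FB dest: bij_betw_same_card)
    ultimately show "hom_map V R S g x \<in>
        {x \<in> carrier (ob_map V S). hom_map V S T f x \<in> FI_decomposables k V T}"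
      using R S T x g FI_decomposables_generator[OF V T R(1)]
        mod_hom_closed[OF cmodule_hom[OF V, of R S]] by simp
  qed
  then show ?thesis using x by blast
qed

lemma FI_decomposables_natural:
  assumes V: "is_functor FI (kMod k) V" and W: "is_functor FI (kMod k) W"
    and \<eta>: "\<eta> \<in> nat_trans FI k V W" and S: "finite S" and x: "x \<in> FI_decomposables k V S"
  shows "\<eta> S x \<in> FI_decomposables k W S"
proof -
  have \<eta>_hom: "\<eta> S \<in> mod_hom k (ob_map V S) (ob_map W S)" if "finite S" for S
    using nat_trans_mod_hom[OF \<eta>] that by simp
  have "FI_decomposables k V S \<subseteq> {x \<in> carrier (ob_map V S). \<eta> S x \<in> FI_decomposables k W S}"
  proof (rule FI_decomposables_induct[OF V S])
    show "submodule {x \<in> carrier (ob_map V S). \<eta> S x \<in> FI_decomposables k W S} k (ob_map V S)"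
      using S by (intro submodule_vimage[of k _ "ob_map W S"] FI_decomposables_submodule[OF W] \<eta>_hom)
        (auto simp: cmodule_module[OF V] cmodule_module[OF W])
  next
    fix R g x
    assume *: "finite R" "card R < card S" "g \<in> Hom FI R S" "x \<in> carrier (ob_map V R)"
    then show "hom_map V R S g x \<in> {x \<in> carrier (ob_map V S). \<eta> S x \<in> FI_decomposables k W S}"
      using S nat_trans_natural[OF \<eta>, of R S g x]
        FI_decomposables_generator[OF W S *(1-3), of "\<eta> R x"] mod_hom_closed[OF \<eta>_hom]
        mod_hom_closed[OF cmodule_hom[OF V, of R S]] by simp
  qed
  then show ?thesis using x by blast
qed

lemma FI_H0_hom_coset:
  assumes V: "is_functor FI (kMod k) V" and S: "finite S" and T: "finite T" and f: "f \<in> Hom FB S T"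
  shows "x \<in> carrier (ob_map V S) \<Longrightarrow>
      hom_map (FI_H0 k V) S T f (FI_decomposables k V S +>\<^bsub>ob_map V S\<^esub> x) =
      FI_decomposables k V T +>\<^bsub>ob_map V T\<^esub> hom_map V S T f x"
    and "hom_map (FI_H0 k V) S T f \<in> mod_hom k (ob_map (FI_H0 k V) S) (ob_map (FI_H0 k V) T)"
proof -
  have hom: "hom_map V S T f \<in> mod_hom k (ob_map V S) (ob_map V T)"
    using cmodule_hom[OF V, of S T f] S T FB_Hom_FI[OF f] by simp
  have mod: "module k (ob_map V S)" "module k (ob_map V T)" using cmodule_module[OF V] S T by auto
  note * = mod(1) FI_decomposables_submodule[OF V S] mod(2) FI_decomposables_submodule[OF V T] hom
    FI_decomposables_bijection[OF V S T f]
  show "x \<in> carrier (ob_map V S) \<Longrightarrow>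
      hom_map (FI_H0 k V) S T f (FI_decomposables k V S +>\<^bsub>ob_map V S\<^esub> x) =
      FI_decomposables k V T +>\<^bsub>ob_map V T\<^esub> hom_map V S T f x"
    by (simp add: FI_H0_def quot_map_coset[OF *])
  show "hom_map (FI_H0 k V) S T f \<in> mod_hom k (ob_map (FI_H0 k V) S) (ob_map (FI_H0 k V) T)"
    by (simp add: FI_H0_def quot_map_mod_hom[OF *])
qed

lemma is_functor_FI_H0:
  assumes V: "is_functor FI (kMod k) V"
  shows "is_functor FB (kMod k) (FI_H0 k V)"
proof (rule cmoduleI[OF _ _ _ _ is_category_FB])
  note sub = FI_decomposables_submodule[OF V]
  have mod: "module k (ob_map V S)" if "finite S" for S using cmodule_module[OF V] that by simp
  note qm = FI_H0_hom_coset(1)[OF V]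
  fix S :: "'a set" assume "S \<in> Ob FB" then have S: "finite S" by simp
  show "module k (ob_map (FI_H0 k V) S)"
    by (simp add: FI_H0_def module_quot_mod mod sub S)
  show "hom_map (FI_H0 k V) S S (Ident FB S) c = c" if c: "c \<in> carrier (ob_map (FI_H0 k V) S)" for c
  proof -
    obtain x where x: "x \<in> carrier (ob_map V S)" "c = FI_decomposables k V S +>\<^bsub>ob_map V S\<^esub> x"
      using c by (auto simp: FI_H0_def elim!: coset_cases[OF mod[OF S] sub[OF S]])
    have "Ident FB S \<in> Hom FB S S" using S by (intro category_Ident[OF is_category_FB]) simp
    moreover have "hom_map V S S (Ident FB S) x = x"
      using cmodule_Ident[OF V, of S] S x by (simp add: Ident_simps)
    ultimately show ?thesis using x S by (simp add: qm)
  qed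
  fix T :: "'a set" assume "T \<in> Ob FB" then have T: "finite T" by simp
  fix f assume f: "f \<in> Hom FB S T"
  show "hom_map (FI_H0 k V) S T f \<in> mod_hom k (ob_map (FI_H0 k V) S) (ob_map (FI_H0 k V) T)"
    using FI_H0_hom_coset(2)[OF V S T f] .
  fix U g c assume "U \<in> Ob FB" and g: "g \<in> Hom FB T U" and c: "c \<in> carrier (ob_map (FI_H0 k V) S)"
  then have U: "finite U" by simp
  obtain x where x: "x \<in> carrier (ob_map V S)" "c = FI_decomposables k V S +>\<^bsub>ob_map V S\<^esub> x"
    using c by (auto simp: FI_H0_def elim!: coset_cases[OF mod[OF S] sub[OF S]])
  have "Comp FB S T U g f \<in> Hom FB S U" using S T U f g
    by (intro category_Comp[OF is_category_FB]) auto
  moreover have "hom_map V S U (Comp FB S T U g f) x = hom_map V T U g (hom_map V S T f x)"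
    using cmodule_Comp[OF V, of S T U f g x] S T U x f g by (simp add: Comp_FB Comp_FI FB_Hom_FI)
  ultimately show "hom_map (FI_H0 k V) S U (Comp FB S T U g f) c =
      hom_map (FI_H0 k V) T U g (hom_map (FI_H0 k V) S T f c)"
    using S T U x f g by (simp add: qm mod_hom_closed[OF cmodule_hom[OF V]] FB_Hom_FI)
qed

abbreviation decomposables where
  "decomposables k V S \<equiv> FI_decomposables k (comp_functor V FI_to_FIsharp) S"

abbreviation H0_class where
  "H0_class k V S x \<equiv> decomposables k V S +>\<^bsub>ob_map V S\<^esub> x"

lemma comp_FI_simps: "ob_map (comp_functor V FI_to_FIsharp) S = ob_map V S"
  "hom_map (comp_functor V FI_to_FIsharp) S T f = hom_map V S T (S, f ` S, f)"
  by (simp_all add: comp_functor_def FI_to_FIsharp_def)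

lemma ob_map_H0: "ob_map (H0_ob k V) S = quot_mod (ob_map V S) (decomposables k V S)"
  by (simp add: H0_ob_def FI_H0_def comp_FI_simps)

lemma is_functor_H0_ob:
  "is_functor FIsharp (kMod k) V \<Longrightarrow> is_functor FB (kMod k) (H0_ob k V)"
  unfolding H0_ob_def by (intro is_functor_FI_H0 cmodule_FI)

context
  fixes k :: "('k, 'x) ring_scheme" and V :: "('u set, 'u set \<times> 'u set \<times> ('u \<Rightarrow> 'u), 'k, 'm) cmodule"
  assumes V: "is_functor FIsharp (kMod k) V"
begin

lemma module_finite: "finite S \<Longrightarrow> module k (ob_map V S)"
  using cmodule_module[OF V] by simp

lemma decomposables_submodule: "finite S \<Longrightarrow> submodule (decomposables k V S) k (ob_map V S)"
  using FI_decomposables_submodule[OF cmodule_FI[OF V]] by (simp add: comp_FI_simps)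

lemmas H0_class_eq_iff = coset_eq_iff[OF module_finite decomposables_submodule]
  and H0_class_carrier = coset_carrier[OF module_finite decomposables_submodule, folded ob_map_H0]
  and H0_class_cases = coset_cases[OF module_finite decomposables_submodule, folded ob_map_H0]
  and H0_class_zero = coset_zero[OF module_finite decomposables_submodule, folded ob_map_H0]
  and H0_class_eq_zero_iff = coset_eq_zero_iff[OF module_finite decomposables_submodule, folded ob_map_H0]
  and H0_class_add = coset_add[OF module_finite decomposables_submodule, folded ob_map_H0]
  and H0_class_smult = coset_smult[OF module_finite decomposables_submodule, folded ob_map_H0]

lemma H0_hom_class:
  assumes "finite S" "finite T" "f \<in> Hom FB S T" "x \<in> carrier (ob_map V S)"
  shows "hom_map (H0_ob k V) S T f (H0_class k V S x) =
    H0_class k V T (hom_map V S T (S, T, f) x)"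
proof -
  have "f ` S = T" using assms(3) by (auto simp: Hom_FB bij_betw_def)
  then show ?thesis
    using FI_H0_hom_coset(1)[OF cmodule_FI[OF V] assms(1-3), of x] assms(4)
    by (simp add: H0_ob_def comp_FI_simps)
qed

lemma inclusion_decomposable:
  assumes S: "finite S" and R: "R \<subset> S" and x: "x \<in> carrier (ob_map V R)"
  shows "hom_map V R S (partial_id R) x \<in> decomposables k V S"
  using FI_decomposables_generator[OF cmodule_FI[OF V] S, of R "\<lambda>x\<in>R. x" x] R S x
    finite_subset[of R S] psubset_card_mono[OF S R]
  by (auto simp: comp_FI_simps partial_id_def Hom_FI inj_on_def image_def)

text \<open>If \<open>T'\<close> is not inside the image \<open>B\<close>, the restriction to \<open>T'\<close> of an element coming through
  \<open>(A, B, \<phi>)\<close> factors through the proper subset \<open>B \<inter> T'\<close>, so that it vanishes modulo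
  decomposables. This is the rule by which a partial injection acts on \<open>M\<close>.\<close>

lemma H0_class_restriction:
  assumes f: "(A, B, \<phi>) \<in> Hom FIsharp S T" and S: "finite S" and T: "finite T" and T': "T' \<subseteq> T"
    and x: "x \<in> carrier (ob_map V S)"
  defines "R \<equiv> {a \<in> A. \<phi> a \<in> T'}"
  shows "H0_class k V T' (hom_map V T T' (partial_id T') (hom_map V S T (A, B, \<phi>) x)) =
    (if T' \<subseteq> B
     then hom_map (H0_ob k V) R T' (restrict \<phi> R) (H0_class k V R (hom_map V S R (partial_id R) x))
     else \<zero>\<^bsub>ob_map (H0_ob k V) T'\<^esub>)"
proof -
  have fin: "finite T'" using T T' by (rule rev_finite_subset)
  have y: "hom_map V S T (A, B, \<phi>) x \<in> carrier (ob_map V T)"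
    using mod_hom_closed[OF cmodule_hom[OF V]] S T f x by simp
  have AB: "A \<subseteq> S" "B \<subseteq> T" using f by (auto simp: Hom_FIsharp)
  show ?thesis
  proof (cases "T' \<subseteq> B")
    case True
    have "R \<subseteq> S" using AB by (auto simp: R_def)
    note R = this finite_subset[OF this S]
    have hom: "restrict \<phi> R \<in> Hom FB R T'" unfolding R_def by (rule preimage_Hom_FB[OF f True])
    then have hom': "(R, T', restrict \<phi> R) \<in> Hom FIsharp R T'" by (auto simp: Hom_FB Hom_FIsharp)
    have "hom_map V T T' (partial_id T') (hom_map V S T (A, B, \<phi>) x) =
        hom_map V R T' (R, T', restrict \<phi> R) (hom_map V S R (partial_id R) x)"
      using restriction_Comp[OF f True, folded R_def] S T fin R f x hom' T'
      by (simp add: cmodule_Comp[OF V, symmetric] partial_id_Hom)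
    moreover have "hom_map V S R (partial_id R) x \<in> carrier (ob_map V R)"
      using mod_hom_closed[OF partial_id_mod_hom[OF V]] S R x by simp
    ultimately show ?thesis using True by (simp add: H0_hom_class R fin hom)
  next
    case False
    let ?y = "hom_map V S T (A, B, \<phi>) x"
    have fB: "finite (B \<inter> T')" using fin by simp
    have "?y = hom_map V T T (partial_id B) ?y"
      using partial_id_Comp_left[OF f subset_refl, of T] S T f x AB
      by (simp add: cmodule_Comp[OF V, symmetric] partial_id_Hom)
    then have "hom_map V T T' (partial_id T') ?y =
        hom_map V T T' (partial_id T') (hom_map V T T (partial_id B) ?y)" by simp
    also have "\<dots> = hom_map V T T' (partial_id (B \<inter> T')) ?y"
      using T T' fin AB y by (simp add: partial_id_partial_id[OF V])
    also have "\<dots> = hom_map V (B \<inter> T') T' (partial_id (B \<inter> T'))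
        (hom_map V T (B \<inter> T') (partial_id (B \<inter> T')) ?y)"
      using T T' fin fB AB y by (subst partial_id_partial_id[OF V]) auto
    also have "\<dots> \<in> decomposables k V T'"
      using False
      by (intro inclusion_decomposable[OF fin] mod_hom_closed[OF partial_id_mod_hom[OF V T fB] y])
        (use AB in auto)
    finally show ?thesis
      using False y T T' fin mod_hom_closed[OF partial_id_mod_hom[OF V]]
      by (simp add: H0_class_eq_zero_iff)
  qed
qed

text \<open>The idempotents \<open>e\<^sub>s\<close> given by the partial identities on \<open>S - {s}\<close> commute. An injection from
  a smaller set misses some \<open>s\<close>, so that the elements coming through it are fixed by \<open>e\<^sub>s\<close>; conversely \<open>e\<^sub>s\<close> factors through
  \<open>S - {s}\<close>. So the decomposable elements are the sum of the images of the \<open>e\<^sub>s\<close>, and the projection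
  that kills these images has as its image the elements whose restriction to every proper subset
  vanishes. These elements are a complement of the decomposables, isomorphic to \<open>H\<^sub>0(V)\<^sub>S\<close>.\<close>

lemma decomposables_complement:
  assumes S: "finite S"
  obtains p where "p \<in> mod_hom k (ob_map V S) (ob_map V S)"
    and "\<And>u. u \<in> decomposables k V S \<Longrightarrow> p u = \<zero>\<^bsub>ob_map V S\<^esub>"
    and "\<And>v R. v \<in> carrier (ob_map V S) \<Longrightarrow> R \<subset> S \<Longrightarrow>
      hom_map V S R (partial_id R) (p v) = \<zero>\<^bsub>ob_map V R\<^esub>"
    and "\<And>v. v \<in> carrier (ob_map V S) \<Longrightarrow>
      (\<And>R. R \<subset> S \<Longrightarrow> hom_map V S R (partial_id R) v = \<zero>\<^bsub>ob_map V R\<^esub>) \<Longrightarrow> p v = v"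
    and "\<And>v. v \<in> carrier (ob_map V S) \<Longrightarrow> v \<ominus>\<^bsub>ob_map V S\<^esub> p v \<in> decomposables k V S"
proof -
  let ?e = "\<lambda>s. hom_map V S S (partial_id (S - {s}))"
  note mod = module_finite[OF S]
  interpret M: module k "ob_map V S" by (rule mod)
  have e: "?e s \<in> mod_hom k (ob_map V S) (ob_map V S)" for s
    using S by (intro partial_id_mod_hom[OF V]) auto
  have factor: "?e s v = hom_map V (S - {s}) S (partial_id (S - {s}))
      (hom_map V S (S - {s}) (partial_id (S - {s})) v)" if "v \<in> carrier (ob_map V S)" for s v
    using S that by (subst partial_id_partial_id[OF V]) auto
  have restr: "hom_map V S R (partial_id R) v \<in> carrier (ob_map V R)"
    if "v \<in> carrier (ob_map V S)" "R \<subseteq> S" for R v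
    using that finite_subset[OF that(2) S] mod_hom_closed[OF partial_id_mod_hom[OF V]] S by auto
  have eU: "?e s v \<in> decomposables k V S" if "s \<in> S" "v \<in> carrier (ob_map V S)" for s v
    unfolding factor[OF that(2)] by (rule inclusion_decomposable[OF S]) (use that restr in auto)
  have comm: "?e s (?e t v) = ?e t (?e s v)" if "v \<in> carrier (ob_map V S)" for s t v
    using S that by (simp add: partial_id_partial_id[OF V] Diff_subset Int_commute)
  obtain p where p: "p \<in> mod_hom k (ob_map V S) (ob_map V S)"
    and pe: "\<And>s v. s \<in> S \<Longrightarrow> v \<in> carrier (ob_map V S) \<Longrightarrow> p (?e s v) = \<zero>\<^bsub>ob_map V S\<^esub>"
    and ep: "\<And>s v. s \<in> S \<Longrightarrow> v \<in> carrier (ob_map V S) \<Longrightarrow> ?e s (p v) = \<zero>\<^bsub>ob_map V S\<^esub>"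
    and fix_p: "\<And>v. v \<in> carrier (ob_map V S) \<Longrightarrow> (\<And>s. s \<in> S \<Longrightarrow> ?e s v = \<zero>\<^bsub>ob_map V S\<^esub>) \<Longrightarrow> p v = v"
    and pU: "\<And>v. v \<in> carrier (ob_map V S) \<Longrightarrow> v \<ominus>\<^bsub>ob_map V S\<^esub> p v \<in> decomposables k V S"
    by (rule commuting_idempotents_projection[OF mod S e _ comm decomposables_submodule[OF S] eU])
      (use S in \<open>auto simp: partial_id_partial_id[OF V] Diff_subset\<close>)
  have kill: "decomposables k V S \<subseteq> {v \<in> carrier (ob_map V S). p v \<in> {\<zero>\<^bsub>ob_map V S\<^esub>}}"
  proof (rule FI_decomposables_induct[OF cmodule_FI[OF V] S], unfold comp_FI_simps)
    show "submodule {v \<in> carrier (ob_map V S). p v \<in> {\<zero>\<^bsub>ob_map V S\<^esub>}} k (ob_map V S)"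
      by (rule submodule_vimage[OF mod mod p zero_submodule[OF mod]])
  next
    fix T f x
    assume T: "finite T" "card T < card S" and f: "f \<in> Hom FI T S" and x: "x \<in> carrier (ob_map V T)"
    let ?y = "hom_map V T S (T, f ` T, f) x"
    have hom: "(T, f ` T, f) \<in> Hom FIsharp T S" using f by (auto simp: Hom_FI Hom_FIsharp bij_betw_def)
    have y: "?y \<in> carrier (ob_map V S)" using mod_hom_closed[OF cmodule_hom[OF V]] S T hom x by simp
    have "f ` T \<noteq> S" using card_image_le[OF T(1), of f] T(2) by auto
    then obtain s where s: "s \<in> S" "f ` T \<subseteq> S - {s}" using f by (auto simp: Hom_FI)
    have "?e s ?y = ?y"
      using partial_id_Comp_left[OF hom s(2), of S] S T hom x
      by (simp add: cmodule_Comp[OF V, symmetric] partial_id_Hom Diff_subset)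
    then have "p ?y = \<zero>\<^bsub>ob_map V S\<^esub>" using pe[OF s(1) y] by simp
    then show "?y \<in> {v \<in> carrier (ob_map V S). p v \<in> {\<zero>\<^bsub>ob_map V S\<^esub>}}" using y by simp
  qed
  have restr_p: "hom_map V S R (partial_id R) (p v) = \<zero>\<^bsub>ob_map V R\<^esub>"
    if v: "v \<in> carrier (ob_map V S)" and R: "R \<subset> S" for v R
  proof -
    obtain s where s: "s \<in> S" "s \<notin> R" using R by auto
    have fR: "finite R" using R S finite_subset by auto
    have R': "(S - {s}) \<inter> R = R" using s R by auto
    have "hom_map V S R (partial_id R) (p v) = hom_map V S R (partial_id R) (?e s (p v))"
      using S R R' fR mod_hom_closed[OF p v] by (subst partial_id_partial_id[OF V]) auto
    also have "\<dots> = \<zero>\<^bsub>ob_map V R\<^esub>"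
      using ep[OF s(1) v] R by (simp add: mod_hom_zero[OF mod module_finite[OF fR]
            partial_id_mod_hom[OF V S fR]] subset_iff psubset_eq)
    finally show ?thesis .
  qed
  have p_fix: "p v = v" if v: "v \<in> carrier (ob_map V S)"
    and 0: "\<And>R. R \<subset> S \<Longrightarrow> hom_map V S R (partial_id R) v = \<zero>\<^bsub>ob_map V R\<^esub>" for v
  proof (rule fix_p[OF v])
    fix s assume "s \<in> S"
    then have "S - {s} \<subset> S" by auto
    then show "?e s v = \<zero>\<^bsub>ob_map V S\<^esub>"
      unfolding factor[OF v] using 0 S
      by (simp add: mod_hom_zero[OF module_finite mod partial_id_mod_hom[OF V]] Diff_subset)
  qed
  show thesis
    by (rule that[OF p _ restr_p p_fix pU]) (use kill in auto)
qed

end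

section \<open>Functoriality of \<open>M\<close>\<close>

lemma ob_map_M: "ob_map (M_ob W) S = dsum_mod (Pow S) (ob_map W)"
  by (simp add: M_ob_def)

lemma carrier_M: "finite S \<Longrightarrow> carrier (ob_map (M_ob W) S) = (\<Pi>\<^sub>E T\<in>Pow S. carrier (ob_map W T))"
  by (simp add: ob_map_M carrier_dsum_mod_finite)

lemma M_component: "x \<in> carrier (ob_map (M_ob W) S) \<Longrightarrow> T \<subseteq> S \<Longrightarrow> x T \<in> carrier (ob_map W T)"
  by (simp add: ob_map_M dsum_mod_component)

lemma M_eqI:
  "x \<in> carrier (ob_map (M_ob W) S) \<Longrightarrow> y \<in> carrier (ob_map (M_ob W) S) \<Longrightarrow>
    (\<And>T. T \<subseteq> S \<Longrightarrow> x T = y T) \<Longrightarrow> x = y"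
  unfolding ob_map_M by (erule dsum_mod_eqI) auto

context
  fixes k :: "('k, 'x) ring_scheme" and W :: "('u set, 'u \<Rightarrow> 'u, 'k, 'm) cmodule"
  assumes W: "is_functor FB (kMod k) W"
begin

lemma FB_module: "finite S \<Longrightarrow> module k (ob_map W S)"
  using cmodule_module[OF W] by simp

lemma FB_hom: "finite S \<Longrightarrow> finite T \<Longrightarrow> f \<in> Hom FB S T \<Longrightarrow>
    hom_map W S T f \<in> mod_hom k (ob_map W S) (ob_map W T)"
  using cmodule_hom[OF W] by simp

lemma FB_Comp: "finite S \<Longrightarrow> finite T \<Longrightarrow> finite U \<Longrightarrow> f \<in> Hom FB S T \<Longrightarrow> g \<in> Hom FB T U \<Longrightarrow>
    x \<in> carrier (ob_map W S) \<Longrightarrow>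
    hom_map W T U g (hom_map W S T f x) = hom_map W S U (compose S g f) x"
  using cmodule_Comp[OF W, of S T U f g x] by (simp add: Comp_FB)

lemma FB_Ident: "finite S \<Longrightarrow> x \<in> carrier (ob_map W S) \<Longrightarrow> hom_map W S S (\<lambda>s\<in>S. s) x = x"
  using cmodule_Ident[OF W, of S x] by (simp add: Ident_simps)

lemma M_module:
  assumes S: "finite S"
  shows "module k (ob_map (M_ob W) S)"
  unfolding ob_map_M
  by (rule module_dsum_mod[OF module.axioms(1)[OF FB_module[OF S]]])
    (use finite_subset[OF _ S] S in \<open>auto simp: FB_module\<close>)

text \<open>A partial injection maps at most one subset of its domain onto a given \<open>T'\<close>, so the sum defining
  the action on \<open>M\<close> has at most one term.\<close>

lemma M_hom_component:
  assumes f: "(A, B, \<phi>) \<in> Hom FIsharp S S'" and S: "finite S" and S': "finite S'"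
    and x: "x \<in> carrier (ob_map (M_ob W) S)" and T': "T' \<subseteq> S'"
  defines "T \<equiv> {a \<in> A. \<phi> a \<in> T'}"
  shows "hom_map (M_ob W) S S' (A, B, \<phi>) x T' =
    (if T' \<subseteq> B then hom_map W T T' (restrict \<phi> T) (x T) else \<zero>\<^bsub>ob_map W T'\<^esub>)"
proof -
  have fin: "finite T'" using S' T' by (rule rev_finite_subset)
  interpret module k "ob_map W T'" by (rule FB_module[OF fin])
  have bij: "inj_on \<phi> A" "\<phi> ` A = B" "A \<subseteq> S" using f by (auto simp: Hom_FIsharp bij_betw_def)
  have eq: "hom_map (M_ob W) S S' (A, B, \<phi>) x T' =
      (\<Oplus>\<^bsub>ob_map W T'\<^esub>R\<in>{R. R \<subseteq> A \<and> \<phi> ` R = T'}. hom_map W R T' (restrict \<phi> R) (x R))"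
    using x T' by (simp add: M_ob_def)
  show ?thesis
  proof (cases "T' \<subseteq> B")
    case True
    have "R = T" if "R \<subseteq> A" "\<phi> ` R = T'" for R
    proof -
      have "a \<in> R \<longleftrightarrow> \<phi> a \<in> T'" if "a \<in> A" for a
        using inj_on_image_mem_iff[OF bij(1) \<open>a \<in> A\<close> \<open>R \<subseteq> A\<close>] \<open>\<phi> ` R = T'\<close> by simp
      then show ?thesis using \<open>R \<subseteq> A\<close> by (auto simp: T_def)
    qed
    moreover have "T \<subseteq> A" "\<phi> ` T = T'" using True bij(2) unfolding T_def by blast+
    ultimately have *: "{R. R \<subseteq> A \<and> \<phi> ` R = T'} = {T}" by blast
    have "T \<subseteq> S" using \<open>T \<subseteq> A\<close> bij(3) by blast
    note T = this finite_subset[OF this S]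
    have "hom_map W T T' (restrict \<phi> T) (x T) \<in> carrier (ob_map W T')"
      using mod_hom_closed[OF FB_hom[OF T(2) fin]] preimage_Hom_FB[OF f True] M_component[OF x T(1)]
      by (simp add: T_def)
    then show ?thesis unfolding eq * using True by simp
  next
    case False
    then have "{R. R \<subseteq> A \<and> \<phi> ` R = T'} = {}" using bij by auto
    then show ?thesis using False by (simp only: eq finsum_empty if_False)
  qed
qed

lemma M_hom_mod_hom:
  assumes f: "f \<in> Hom FIsharp S S'" and S: "finite S" and S': "finite S'"
  shows "hom_map (M_ob W) S S' f \<in> mod_hom k (ob_map (M_ob W) S) (ob_map (M_ob W) S')"
proof -
  obtain A B \<phi> where f_eq: "f = (A, B, \<phi>)" by (metis prod_cases3)
  note f' = f[unfolded f_eq]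
  note comp = M_hom_component[OF f' S S']
  interpret M: module k "ob_map (M_ob W) S" by (rule M_module[OF S])
  have A: "A \<subseteq> S" using f' by (simp add: Hom_FIsharp)
  have closed: "hom_map (M_ob W) S S' f x \<in> carrier (ob_map (M_ob W) S')"
    if x: "x \<in> carrier (ob_map (M_ob W) S)" for x
    unfolding carrier_M[OF S']
  proof (rule PiE_I)
    fix T' assume "T' \<in> Pow S'"
    then have T': "T' \<subseteq> S'" by simp
    then have fin: "finite T'" using S' by (rule finite_subset)
    interpret N: module k "ob_map W T'" by (rule FB_module[OF fin])
    let ?T = "{a \<in> A. \<phi> a \<in> T'}"
    have T: "?T \<subseteq> S" using A by auto
    show "hom_map (M_ob W) S S' f x T' \<in> carrier (ob_map W T')"
      using mod_hom_closed[OF FB_hom[OF finite_subset[OF T S] fin preimage_Hom_FB[OF f']]]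
        M_component[OF x T] x T' by (simp add: f_eq comp)
  qed (use x in \<open>simp add: f_eq M_ob_def\<close>)
  have add: "hom_map (M_ob W) S S' f (x \<oplus>\<^bsub>ob_map (M_ob W) S\<^esub> y) T' =
      hom_map (M_ob W) S S' f x T' \<oplus>\<^bsub>ob_map W T'\<^esub> hom_map (M_ob W) S S' f y T'"
    if xy: "x \<in> carrier (ob_map (M_ob W) S)" "y \<in> carrier (ob_map (M_ob W) S)" and T': "T' \<subseteq> S'"
    for x y T'
  proof -
    have fin: "finite T'" using T' S' by (rule finite_subset)
    interpret N: module k "ob_map W T'" by (rule FB_module[OF fin])
    let ?T = "{a \<in> A. \<phi> a \<in> T'}"
    have T: "?T \<subseteq> S" using A by auto
    have "(x \<oplus>\<^bsub>ob_map (M_ob W) S\<^esub> y) ?T = x ?T \<oplus>\<^bsub>ob_map W ?T\<^esub> y ?T"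
      using T by (simp add: ob_map_M dsum_mod_simps)
    then show ?thesis
      using xy T' mod_hom_add[OF FB_hom[OF finite_subset[OF T S] fin preimage_Hom_FB[OF f']]]
        M_component[OF xy(1) T] M_component[OF xy(2) T]
      by (simp add: f_eq comp)
  qed
  have smult: "hom_map (M_ob W) S S' f (a \<odot>\<^bsub>ob_map (M_ob W) S\<^esub> x) T' =
      a \<odot>\<^bsub>ob_map W T'\<^esub> hom_map (M_ob W) S S' f x T'"
    if x: "x \<in> carrier (ob_map (M_ob W) S)" "a \<in> carrier k" and T': "T' \<subseteq> S'"
    for x a T'
  proof -
    have fin: "finite T'" using T' S' by (rule finite_subset)
    interpret N: module k "ob_map W T'" by (rule FB_module[OF fin])
    let ?T = "{a \<in> A. \<phi> a \<in> T'}"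
    have T: "?T \<subseteq> S" using A by auto
    have "(a \<odot>\<^bsub>ob_map (M_ob W) S\<^esub> x) ?T = a \<odot>\<^bsub>ob_map W ?T\<^esub> x ?T"
      using T by (simp add: ob_map_M dsum_mod_simps)
    then show ?thesis
      using x T' mod_hom_smult[OF FB_hom[OF finite_subset[OF T S] fin preimage_Hom_FB[OF f']]]
        M_component[OF x(1) T]
      by (simp add: f_eq comp)
  qed
  interpret N: module k "ob_map (M_ob W) S'" by (rule M_module[OF S'])
  show ?thesis
  proof (rule mod_homI)
    show "hom_map (M_ob W) S S' f \<in> extensional (carrier (ob_map (M_ob W) S))"
      by (simp add: f_eq M_ob_def)
    fix x assume x: "x \<in> carrier (ob_map (M_ob W) S)"
    show "hom_map (M_ob W) S S' f x \<in> carrier (ob_map (M_ob W) S')" by (rule closed[OF x])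
    show "hom_map (M_ob W) S S' f (x \<oplus>\<^bsub>ob_map (M_ob W) S\<^esub> y) =
      hom_map (M_ob W) S S' f x \<oplus>\<^bsub>ob_map (M_ob W) S'\<^esub> hom_map (M_ob W) S S' f y"
      if y: "y \<in> carrier (ob_map (M_ob W) S)" for y
    proof (rule M_eqI[of _ W S'])
      show "hom_map (M_ob W) S S' f (x \<oplus>\<^bsub>ob_map (M_ob W) S\<^esub> y) T' =
        (hom_map (M_ob W) S S' f x \<oplus>\<^bsub>ob_map (M_ob W) S'\<^esub> hom_map (M_ob W) S S' f y) T'"
        if "T' \<subseteq> S'" for T'
        using add[OF x y that] that by (simp add: ob_map_M[of W S'] dsum_mod_simps)
    qed (simp_all add: closed x y)
    show "hom_map (M_ob W) S S' f (a \<odot>\<^bsub>ob_map (M_ob W) S\<^esub> x) =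
      a \<odot>\<^bsub>ob_map (M_ob W) S'\<^esub> hom_map (M_ob W) S S' f x" if a: "a \<in> carrier k" for a
    proof (rule M_eqI[of _ W S'])
      show "hom_map (M_ob W) S S' f (a \<odot>\<^bsub>ob_map (M_ob W) S\<^esub> x) T' =
        (a \<odot>\<^bsub>ob_map (M_ob W) S'\<^esub> hom_map (M_ob W) S S' f x) T'"
        if "T' \<subseteq> S'" for T'
        using smult[OF x a that] that by (simp add: ob_map_M[of W S'] dsum_mod_simps)
    qed (simp_all add: closed x a)
  qed
qed

lemma M_partial_id:
  assumes S: "finite S" and S': "finite S'" and R: "R \<subseteq> S \<inter> S'"
    and x: "x \<in> carrier (ob_map (M_ob W) S)" and T: "T \<subseteq> S'"
  shows "hom_map (M_ob W) S S' (partial_id R) x T = (if T \<subseteq> R then x T else \<zero>\<^bsub>ob_map W T\<^esub>)"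
proof -
  have "(R, R, \<lambda>x\<in>R. x) \<in> Hom FIsharp S S'" using R partial_id_Hom[of R S S'] by (simp add: partial_id_def)
  note * = M_hom_component[OF this S S' x T]
  show ?thesis
  proof (cases "T \<subseteq> R")
    case True
    then have "T \<subseteq> S" using R by blast
    have "{a \<in> R. (\<lambda>x\<in>R. x) a \<in> T} = T" "restrict (\<lambda>x\<in>R. x) T = (\<lambda>x\<in>T. x)"
      using True by (auto simp: fun_eq_iff)
    then show ?thesis
      using True * FB_Ident[of T "x T"] M_component[OF x \<open>T \<subseteq> S\<close>] finite_subset[OF T S']
      by (simp add: partial_id_def)
  qed (simp add: * partial_id_def)
qed

lemma is_functor_M_ob: "is_functor FIsharp (kMod k) (M_ob W)"
proof (rule cmoduleI[OF _ _ _ _ is_category_FIsharp])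
  fix S :: "'u set" assume "S \<in> Ob FIsharp"
  then have S: "finite S" by simp
  show "module k (ob_map (M_ob W) S)" by (rule M_module[OF S])
  show "hom_map (M_ob W) S S (Ident FIsharp S) x = x" if x: "x \<in> carrier (ob_map (M_ob W) S)" for x
    by (rule M_eqI[of _ W S])
      (use x S in \<open>auto simp: partial_id_Ident[symmetric] M_partial_id partial_id_Hom
        intro!: mod_hom_closed[OF M_hom_mod_hom]\<close>)
  fix T :: "'u set" assume "T \<in> Ob FIsharp"
  then have T: "finite T" by simp
  fix f assume f: "f \<in> Hom FIsharp S T"
  show "hom_map (M_ob W) S T f \<in> mod_hom k (ob_map (M_ob W) S) (ob_map (M_ob W) T)"
    by (rule M_hom_mod_hom[OF f S T])
  fix U :: "'u set" assume "U \<in> Ob FIsharp"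
  then have U: "finite U" by simp
  fix g x assume g: "g \<in> Hom FIsharp T U" and x: "x \<in> carrier (ob_map (M_ob W) S)"
  obtain A B \<phi> where f_eq: "f = (A, B, \<phi>)" by (metis prod_cases3)
  obtain C D \<psi> where g_eq: "g = (C, D, \<psi>)" by (metis prod_cases3)
  note f' = f[unfolded f_eq] and g' = g[unfolded g_eq]
  have \<phi>: "A \<subseteq> S" "B \<subseteq> T" "inj_on \<phi> A" "\<phi> ` A = B" and \<psi>: "C \<subseteq> T" "D \<subseteq> U" "inj_on \<psi> C" "\<psi> ` C = D"
    using f' g' by (auto simp: Hom_FIsharp bij_betw_def)
  have gf: "Comp FIsharp S T U g f \<in> Hom FIsharp S U"
    using S T U f g by (intro category_Comp[OF is_category_FIsharp]) auto
  note gf' = gf[unfolded f_eq g_eq Comp_FIsharp]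
  have y: "hom_map (M_ob W) S T f x \<in> carrier (ob_map (M_ob W) T)"
    by (rule mod_hom_closed[OF M_hom_mod_hom[OF f S T] x])
  show "hom_map (M_ob W) S U (Comp FIsharp S T U g f) x =
      hom_map (M_ob W) T U g (hom_map (M_ob W) S T f x)"
  proof (rule M_eqI[of _ W U])
    show "hom_map (M_ob W) S U (Comp FIsharp S T U g f) x \<in> carrier (ob_map (M_ob W) U)"
      by (rule mod_hom_closed[OF M_hom_mod_hom[OF gf S U] x])
    show "hom_map (M_ob W) T U g (hom_map (M_ob W) S T f x) \<in> carrier (ob_map (M_ob W) U)"
      by (rule mod_hom_closed[OF M_hom_mod_hom[OF g T U] y])
  next
    fix Q assume Q: "Q \<subseteq> U"
    define A' where "A' = {x \<in> A. \<phi> x \<in> B \<inter> C}"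
    define R where "R = {c \<in> C. \<psi> c \<in> Q}"
    define P where "P = {a \<in> A. \<phi> a \<in> R}"
    have P_eq: "{a \<in> A'. compose A' \<psi> \<phi> a \<in> Q} = P"
      using \<phi> by (auto simp: A'_def P_def R_def compose_def)
    have R: "R \<subseteq> T" "finite R" and P: "P \<subseteq> S" "finite P" and fQ: "finite Q"
      using \<phi>(1) \<psi>(1) S T Q U finite_subset[of _ T] finite_subset[of _ S] finite_subset[of _ U]
      by (auto simp: R_def P_def)
    have sub: "Q \<subseteq> \<psi> ` (B \<inter> C) \<longleftrightarrow> Q \<subseteq> D \<and> R \<subseteq> B"
    proof
      assume *: "Q \<subseteq> \<psi> ` (B \<inter> C)"
      have "c \<in> B" if c: "c \<in> R" for c
      proof -
        obtain b where "b \<in> B \<inter> C" "\<psi> c = \<psi> b" using * c by (auto simp: R_def)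
        then show ?thesis using \<psi>(3) c by (auto simp: R_def inj_on_def)
      qed
      then show "Q \<subseteq> D \<and> R \<subseteq> B" using * \<psi>(4) by blast
    next
      assume *: "Q \<subseteq> D \<and> R \<subseteq> B"
      show "Q \<subseteq> \<psi> ` (B \<inter> C)"
      proof
        fix q assume q: "q \<in> Q"
        then obtain c where "c \<in> C" "q = \<psi> c" using * \<psi>(4) by blast
        moreover from this have "c \<in> B" using * q by (auto simp: R_def)
        ultimately show "q \<in> \<psi> ` (B \<inter> C)" by blast
      qed
    qed
    have lhs: "hom_map (M_ob W) S U (Comp FIsharp S T U g f) x Q =
        (if Q \<subseteq> D \<and> R \<subseteq> B then hom_map W P Q (restrict (compose A' \<psi> \<phi>) P) (x P)
         else \<zero>\<^bsub>ob_map W Q\<^esub>)"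
      unfolding f_eq g_eq Comp_FIsharp A'_def[symmetric]
      using M_hom_component[OF gf'[folded A'_def] S U x Q] by (simp only: P_eq sub)
    have rhs: "hom_map (M_ob W) T U g (hom_map (M_ob W) S T f x) Q =
        (if Q \<subseteq> D then hom_map W R Q (restrict \<psi> R) (hom_map (M_ob W) S T f x R) else \<zero>\<^bsub>ob_map W Q\<^esub>)"
      using M_hom_component[OF g' T U y Q] by (simp add: g_eq R_def[symmetric])
    have mid: "hom_map (M_ob W) S T f x R =
        (if R \<subseteq> B then hom_map W P R (restrict \<phi> P) (x P) else \<zero>\<^bsub>ob_map W R\<^esub>)"
      using M_hom_component[OF f' S T x R(1)] by (simp add: f_eq P_def[symmetric])
    show "hom_map (M_ob W) S U (Comp FIsharp S T U g f) x Q =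
        hom_map (M_ob W) T U g (hom_map (M_ob W) S T f x) Q"
    proof (cases "Q \<subseteq> D")
      case QD: True
      have \<psi>R: "restrict \<psi> R \<in> Hom FB R Q" unfolding R_def by (rule preimage_Hom_FB[OF g' QD])
      show ?thesis
      proof (cases "R \<subseteq> B")
        case True
        have \<phi>P: "restrict \<phi> P \<in> Hom FB P R" unfolding P_def by (rule preimage_Hom_FB[OF f' True])
        have "compose P (restrict \<psi> R) (restrict \<phi> P) = restrict (compose A' \<psi> \<phi>) P"
          using \<phi> by (auto simp: compose_def P_def R_def A'_def fun_eq_iff)
        then show ?thesis
          using QD True FB_Comp[OF P(2) R(2) fQ \<phi>P \<psi>R M_component[OF x P(1)]]
          by (simp add: lhs rhs mid)
      next
        case False
        then show ?thesis
          using QD mod_hom_zero[OF FB_module[OF R(2)] FB_module[OF fQ] FB_hom[OF R(2) fQ \<psi>R]]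
          by (simp add: lhs rhs mid)
      qed
    next
      case False
      then have "hom_map (M_ob W) S U (Comp FIsharp S T U g f) x Q = \<zero>\<^bsub>ob_map W Q\<^esub>"
        unfolding lhs by simp
      also have "\<dots> = hom_map (M_ob W) T U g (hom_map (M_ob W) S T f x) Q"
        unfolding rhs using False by simp
      finally show ?thesis .
    qed
  qed
qed

end

lemma M_map_apply:
  "finite S \<Longrightarrow> x \<in> carrier (ob_map (M_ob W) S) \<Longrightarrow> T \<subseteq> S \<Longrightarrow>
    hom_map M_functor W W' \<eta> S x T = \<eta> T (x T)"
  by (simp add: M_functor_def)

lemma M_map_nat_trans:
  fixes W W' :: "('u set, 'u \<Rightarrow> 'u, 'k, 'm) cmodule"
  assumes W: "is_functor FB (kMod k) W" and W': "is_functor FB (kMod k) W'"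
    and \<eta>: "\<eta> \<in> nat_trans FB k W W'"
  shows "hom_map M_functor W W' \<eta> \<in> nat_trans FIsharp k (M_ob W) (M_ob W')"
proof -
  have \<eta>_hom: "\<eta> S \<in> mod_hom k (ob_map W S) (ob_map W' S)" if "finite S" for S
    using nat_trans_mod_hom[OF \<eta>] that by simp
  have hom: "hom_map M_functor W W' \<eta> S \<in> mod_hom k (ob_map (M_ob W) S) (ob_map (M_ob W') S)"
    if S: "finite S" for S
  proof -
    have fin: "finite T" if "T \<subseteq> S" for T using that S by (rule finite_subset)
    note cl = mod_hom_closed[OF \<eta>_hom[OF fin] M_component]
    note add = mod_hom_add[OF \<eta>_hom[OF fin]] and smult = mod_hom_smult[OF \<eta>_hom[OF fin]]
    have "hom_map M_functor W W' \<eta> S = (\<lambda>x\<in>carrier (ob_map (M_ob W) S). \<lambda>T\<in>Pow S. \<eta> T (x T))"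
      using S by (simp add: M_functor_def)
    also have "\<dots> \<in> mod_hom k (ob_map (M_ob W) S) (ob_map (M_ob W') S)"
    proof (rule mod_hom_restrictI[OF M_module[OF W S]])
      fix x y a
      assume x: "x \<in> carrier (ob_map (M_ob W) S)"
      show "(\<lambda>T\<in>Pow S. \<eta> T (x T)) \<in> carrier (ob_map (M_ob W') S)"
        using cl[OF _ x] by (simp add: carrier_M[OF S])
      show "(\<lambda>T\<in>Pow S. \<eta> T ((x \<oplus>\<^bsub>ob_map (M_ob W) S\<^esub> y) T)) =
          (\<lambda>T\<in>Pow S. \<eta> T (x T)) \<oplus>\<^bsub>ob_map (M_ob W') S\<^esub> (\<lambda>T\<in>Pow S. \<eta> T (y T))"
        if "y \<in> carrier (ob_map (M_ob W) S)"
        using add[OF _ M_component[OF x] M_component[OF that]]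
        by (auto simp: ob_map_M dsum_mod_simps fun_eq_iff)
      show "(\<lambda>T\<in>Pow S. \<eta> T ((a \<odot>\<^bsub>ob_map (M_ob W) S\<^esub> x) T)) =
          a \<odot>\<^bsub>ob_map (M_ob W') S\<^esub> (\<lambda>T\<in>Pow S. \<eta> T (x T))" if "a \<in> carrier k"
        using smult[OF _ that M_component[OF x]]
        by (auto simp: ob_map_M dsum_mod_simps fun_eq_iff)
    qed
    finally show ?thesis .
  qed
  show ?thesis
  proof (rule nat_transI)
    show "hom_map M_functor W W' \<eta> \<in> extensional (Ob FIsharp)" by (simp add: M_functor_def)
  next
    fix S T :: "'u set" and f x
    assume "S \<in> Ob FIsharp" "T \<in> Ob FIsharp" and f: "f \<in> Hom FIsharp S T"
      and x: "x \<in> carrier (ob_map (M_ob W) S)"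
    then have S: "finite S" and T: "finite T" by auto
    obtain A B \<phi> where f_eq: "f = (A, B, \<phi>)" by (metis prod_cases3)
    note f' = f[unfolded f_eq]
    have A: "A \<subseteq> S" using f' by (auto simp: Hom_FIsharp)
    have y: "hom_map (M_ob W) S T f x \<in> carrier (ob_map (M_ob W) T)"
      by (rule mod_hom_closed[OF M_hom_mod_hom[OF W f S T] x])
    have x': "hom_map M_functor W W' \<eta> S x \<in> carrier (ob_map (M_ob W') S)"
      by (rule mod_hom_closed[OF hom[OF S] x])
    show "hom_map M_functor W W' \<eta> T (hom_map (M_ob W) S T f x) =
        hom_map (M_ob W') S T f (hom_map M_functor W W' \<eta> S x)"
    proof (rule M_eqI[of _ W' T])
      show "hom_map M_functor W W' \<eta> T (hom_map (M_ob W) S T f x) \<in> carrier (ob_map (M_ob W') T)"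
        by (rule mod_hom_closed[OF hom[OF T] y])
      show "hom_map (M_ob W') S T f (hom_map M_functor W W' \<eta> S x) \<in> carrier (ob_map (M_ob W') T)"
        by (rule mod_hom_closed[OF M_hom_mod_hom[OF W' f S T] x'])
    next
      fix T' assume T': "T' \<subseteq> T"
      then have fT': "finite T'" using T by (rule finite_subset)
      define R where "R = {a \<in> A. \<phi> a \<in> T'}"
      have R: "R \<subseteq> S" using A by (auto simp: R_def)
      then have fR: "finite R" using S by (rule finite_subset)
      show "hom_map M_functor W W' \<eta> T (hom_map (M_ob W) S T f x) T' =
        hom_map (M_ob W') S T f (hom_map M_functor W W' \<eta> S x) T'"
      proof (cases "T' \<subseteq> B")
        case True
        then have "restrict \<phi> R \<in> Hom FB R T'" unfolding R_def by (rule preimage_Hom_FB[OF f'])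
        then have "\<eta> T' (hom_map W R T' (restrict \<phi> R) (x R)) = hom_map W' R T' (restrict \<phi> R) (\<eta> R (x R))"
          using nat_trans_natural[OF \<eta>, of R T'] fR fT' M_component[OF x R] by simp
        then show ?thesis
          using True M_map_apply[OF T y T'] M_map_apply[OF S x R] M_hom_component[OF W f' S T x T']
            M_hom_component[OF W' f' S T x' [unfolded f_eq] T']
          by (simp add: f_eq R_def[symmetric])
      next
        case False
        then show ?thesis
          using M_map_apply[OF T y T'] M_hom_component[OF W f' S T x T']
            M_hom_component[OF W' f' S T x' T']
            mod_hom_zero[OF FB_module[OF W fT'] FB_module[OF W' fT'] \<eta>_hom[OF fT']]
          by (simp add: f_eq)
      qed
    qed
  qed (simp add: hom)
qed

lemma is_functor_M:
  fixes k :: "('k, 'x) ring_scheme"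
  shows "is_functor (Mod_cat FB k :: (('u set, 'u \<Rightarrow> 'u, 'k, 'm) cmodule, _) category)
    (Mod_cat FIsharp k) M_functor"
proof (rule is_functor_Mod_catI)
  fix W :: "('u set, 'u \<Rightarrow> 'u, 'k, 'm) cmodule" assume W: "is_functor FB (kMod k) W"
  show "is_functor FIsharp (kMod k) (ob_map M_functor W)"
    using is_functor_M_ob[OF W] by (simp add: M_functor_def)
  show "hom_map M_functor W W (nat_id FB W) S x = x"
    if "S \<in> Ob FIsharp" "x \<in> carrier (ob_map (ob_map M_functor W) S)" for S x
  proof -
    have S: "finite S" and x: "x \<in> carrier (ob_map (M_ob W) S)"
      using that by (simp_all add: M_functor_def)
    have "nat_id FB W \<in> nat_trans FB k W W"
      using category_Ident[OF is_category_Mod_cat[of FB k]] W by (simp add: Mod_cat_def)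
    then have "hom_map M_functor W W (nat_id FB W) S x \<in> carrier (ob_map (M_ob W) S)"
      using mod_hom_closed[OF nat_trans_mod_hom[OF M_map_nat_trans[OF W W]]] S x by simp
    then show ?thesis
      by (rule M_eqI[OF _ x])
        (use S x finite_subset[OF _ S] in \<open>auto simp: M_map_apply nat_id_apply M_component\<close>)
  qed
  fix W' :: "('u set, 'u \<Rightarrow> 'u, 'k, 'm) cmodule" and \<eta>
  assume W': "is_functor FB (kMod k) W'" and \<eta>: "\<eta> \<in> nat_trans FB k W W'"
  show "hom_map M_functor W W' \<eta> \<in> nat_trans FIsharp k (ob_map M_functor W) (ob_map M_functor W')"
    using M_map_nat_trans[OF W W' \<eta>] by (simp add: M_functor_def)
  fix X :: "('u set, 'u \<Rightarrow> 'u, 'k, 'm) cmodule" and \<theta> S x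
  assume X: "is_functor FB (kMod k) X" and \<theta>: "\<theta> \<in> nat_trans FB k W' X"
    and "S \<in> Ob FIsharp" "x \<in> carrier (ob_map (ob_map M_functor W) S)"
  then have S: "finite S" and x: "x \<in> carrier (ob_map (M_ob W) S)"
    by (simp_all add: M_functor_def)
  have y: "hom_map M_functor W W' \<eta> S x \<in> carrier (ob_map (M_ob W') S)"
    using mod_hom_closed[OF nat_trans_mod_hom[OF M_map_nat_trans[OF W W' \<eta>]]] S x by simp
  show "hom_map M_functor W X (nat_comp FB W \<theta> \<eta>) S x =
      hom_map M_functor W' X \<theta> S (hom_map M_functor W W' \<eta> S x)"
  proof (rule M_eqI)
    show "hom_map M_functor W X (nat_comp FB W \<theta> \<eta>) S x \<in> carrier (ob_map (M_ob X) S)"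
      using mod_hom_closed[OF nat_trans_mod_hom[OF M_map_nat_trans[OF W X nat_comp_nat_trans[OF W \<eta> \<theta>]]]]
        S x by simp
    show "hom_map M_functor W' X \<theta> S (hom_map M_functor W W' \<eta> S x) \<in> carrier (ob_map (M_ob X) S)"
      using mod_hom_closed[OF nat_trans_mod_hom[OF M_map_nat_trans[OF W' X \<theta>]]] S y by simp
    show "hom_map M_functor W X (nat_comp FB W \<theta> \<eta>) S x T =
        hom_map M_functor W' X \<theta> S (hom_map M_functor W W' \<eta> S x) T" if "T \<subseteq> S" for T
      using that S x y finite_subset[OF that S] by (simp add: M_map_apply nat_comp_apply M_component)
  qed
qed

section \<open>Functoriality of \<open>H\<^sub>0\<close>\<close>

lemma nat_trans_FI:
  fixes \<eta> :: "'u set \<Rightarrow> 'm \<Rightarrow> 'n"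
  assumes "\<eta> \<in> nat_trans FIsharp k V V'"
  shows "\<eta> \<in> nat_trans FI k (comp_functor V FI_to_FIsharp) (comp_functor V' FI_to_FIsharp)"
proof (rule nat_transI)
  have "Ob FIsharp = (Ob FI :: 'u set set)" by auto
  then show "\<eta> \<in> extensional (Ob FI)" using assms by (auto simp: nat_trans_def PiE_iff)
next
  fix S :: "'u set" assume "S \<in> Ob FI"
  then show "\<eta> S \<in> mod_hom k (ob_map (comp_functor V FI_to_FIsharp) S)
      (ob_map (comp_functor V' FI_to_FIsharp) S)"
    using nat_trans_mod_hom[OF assms] by (simp add: comp_FI_simps)
next
  fix S T :: "'u set" and f x
  assume *: "S \<in> Ob FI" "T \<in> Ob FI" "f \<in> Hom FI S T"
    "x \<in> carrier (ob_map (comp_functor V FI_to_FIsharp) S)"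
  then have "(S, f ` S, f) \<in> Hom FIsharp S T"
    by (auto simp: Hom_FI Hom_FIsharp bij_betw_def)
  then show "\<eta> T (hom_map (comp_functor V FI_to_FIsharp) S T f x) =
      hom_map (comp_functor V' FI_to_FIsharp) S T f (\<eta> S x)"
    using * nat_trans_natural[OF assms] by (simp add: comp_FI_simps)
qed

lemma H0_map_class:
  assumes V: "is_functor FIsharp (kMod k) V" and V': "is_functor FIsharp (kMod k) V'"
    and \<eta>: "\<eta> \<in> nat_trans FIsharp k V V'" and S: "finite S"
  shows "x \<in> carrier (ob_map V S) \<Longrightarrow>
      hom_map (H0_functor k) V V' \<eta> S (H0_class k V S x) = H0_class k V' S (\<eta> S x)"
    and "hom_map (H0_functor k) V V' \<eta> S \<in> mod_hom k (ob_map (H0_ob k V) S) (ob_map (H0_ob k V') S)"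
proof -
  have \<eta>S: "\<eta> S \<in> mod_hom k (ob_map V S) (ob_map V' S)"
    using nat_trans_mod_hom[OF \<eta>] S by simp
  note * = module_finite[OF V S] decomposables_submodule[OF V S]
    module_finite[OF V' S] decomposables_submodule[OF V' S] \<eta>S
    FI_decomposables_natural[OF cmodule_FI[OF V] cmodule_FI[OF V'] nat_trans_FI[OF \<eta>] S]
  show "x \<in> carrier (ob_map V S) \<Longrightarrow>
      hom_map (H0_functor k) V V' \<eta> S (H0_class k V S x) = H0_class k V' S (\<eta> S x)"
    using S by (simp add: H0_functor_def quot_map_coset[OF *])
  show "hom_map (H0_functor k) V V' \<eta> S \<in> mod_hom k (ob_map (H0_ob k V) S) (ob_map (H0_ob k V') S)"
    using S by (simp add: H0_functor_def ob_map_H0 quot_map_mod_hom[OF *])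
qed

lemma H0_map_nat_trans:
  assumes V: "is_functor FIsharp (kMod k) V" and V': "is_functor FIsharp (kMod k) V'"
    and \<eta>: "\<eta> \<in> nat_trans FIsharp k V V'"
  shows "hom_map (H0_functor k) V V' \<eta> \<in> nat_trans FB k (H0_ob k V) (H0_ob k V')"
proof (rule nat_transI)
  show "hom_map (H0_functor k) V V' \<eta> \<in> extensional (Ob FB)" by (simp add: H0_functor_def)
next
  fix S T f c assume "S \<in> Ob FB" "T \<in> Ob FB" and f: "f \<in> Hom FB S T"
    and c: "c \<in> carrier (ob_map (H0_ob k V) S)"
  then have S: "finite S" and T: "finite T" by auto
  obtain x where x: "x \<in> carrier (ob_map V S)" "c = H0_class k V S x"
    using c by (rule H0_class_cases[OF V S S])
  have f': "(S, T, f) \<in> Hom FIsharp S T" using f by (auto simp: Hom_FB Hom_FIsharp)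
  have "hom_map V S T (S, T, f) x \<in> carrier (ob_map V T)"
    using mod_hom_closed[OF cmodule_hom[OF V]] S T f' x by simp
  moreover have "\<eta> S x \<in> carrier (ob_map V' S)"
    using mod_hom_closed[OF nat_trans_mod_hom[OF \<eta>]] S x by simp
  moreover have "\<eta> T (hom_map V S T (S, T, f) x) = hom_map V' S T (S, T, f) (\<eta> S x)"
    using nat_trans_natural[OF \<eta>, of S T] S T f' x by simp
  ultimately show "hom_map (H0_functor k) V V' \<eta> T (hom_map (H0_ob k V) S T f c) =
      hom_map (H0_ob k V') S T f (hom_map (H0_functor k) V V' \<eta> S c)"
    using x S T f
    by (simp add: H0_hom_class[OF V] H0_hom_class[OF V'] H0_map_class(1)[OF V V' \<eta>])
qed (simp add: H0_map_class(2)[OF V V' \<eta>])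

lemma is_functor_H0:
  fixes k :: "('k, 'x) ring_scheme"
  shows "is_functor
    (Mod_cat FIsharp k :: (('u set, 'u set \<times> 'u set \<times> ('u \<Rightarrow> 'u), 'k, 'n) cmodule, _) category)
    (Mod_cat FB k) (H0_functor k)"
proof (rule is_functor_Mod_catI)
  have ob: "ob_map (H0_functor k) = H0_ob k" by (simp add: H0_functor_def)
  fix V :: "('u set, 'u set \<times> 'u set \<times> ('u \<Rightarrow> 'u), 'k, 'n) cmodule"
  assume V: "is_functor FIsharp (kMod k) V"
  show "is_functor FB (kMod k) (ob_map (H0_functor k) V)"
    by (simp add: ob is_functor_H0_ob[OF V])
  have id: "nat_id FIsharp V \<in> nat_trans FIsharp k V V"
    using category_Ident[OF is_category_Mod_cat[of FIsharp k]] V by (simp add: Mod_cat_def)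
  show "hom_map (H0_functor k) V V (nat_id FIsharp V) S c = c"
    if "S \<in> Ob FB" and c: "c \<in> carrier (ob_map (ob_map (H0_functor k) V) S)" for S c
  proof -
    have S: "finite S" using that(1) by simp
    obtain x where "x \<in> carrier (ob_map V S)" "c = H0_class k V S x"
      using c unfolding ob by (rule H0_class_cases[OF V S S])
    then show ?thesis using S by (simp add: H0_map_class(1)[OF V V id S] nat_id_apply)
  qed
  fix V' :: "('u set, 'u set \<times> 'u set \<times> ('u \<Rightarrow> 'u), 'k, 'n) cmodule" and \<eta>
  assume V': "is_functor FIsharp (kMod k) V'" and \<eta>: "\<eta> \<in> nat_trans FIsharp k V V'"
  show "hom_map (H0_functor k) V V' \<eta> \<in>
      nat_trans FB k (ob_map (H0_functor k) V) (ob_map (H0_functor k) V')"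
    unfolding ob by (rule H0_map_nat_trans[OF V V' \<eta>])
  fix X :: "('u set, 'u set \<times> 'u set \<times> ('u \<Rightarrow> 'u), 'k, 'n) cmodule" and \<theta> S c
  assume X: "is_functor FIsharp (kMod k) X" and \<theta>: "\<theta> \<in> nat_trans FIsharp k V' X"
    and "S \<in> Ob FB" and c: "c \<in> carrier (ob_map (ob_map (H0_functor k) V) S)"
  then have S: "finite S" by simp
  obtain x where x: "x \<in> carrier (ob_map V S)" "c = H0_class k V S x"
    using c unfolding ob by (rule H0_class_cases[OF V S S])
  moreover have "\<eta> S x \<in> carrier (ob_map V' S)"
    using mod_hom_closed[OF nat_trans_mod_hom[OF \<eta>]] S x by simp
  ultimately show "hom_map (H0_functor k) V X (nat_comp FIsharp V \<theta> \<eta>) S c =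
      hom_map (H0_functor k) V' X \<theta> S (hom_map (H0_functor k) V V' \<eta> S c)"
    using S by (simp add: H0_map_class(1)[OF V X nat_comp_nat_trans[OF V \<eta> \<theta>] S]
      H0_map_class(1)[OF V V' \<eta> S] H0_map_class(1)[OF V' X \<theta> S] nat_comp_apply)
qed

section \<open>Recovering an \<open>FI\<sharp>\<close>-module from its \<open>H\<^sub>0\<close>\<close>

text \<open>The comparison map goes from \<open>V\<close> to \<open>M (H\<^sub>0 V)\<close>: in this direction it needs no choice of a section
  of the quotient maps and is natural at sight.\<close>

definition restriction_classes ::
  "('k, 'x) ring_scheme \<Rightarrow> ('u set, 'u set \<times> 'u set \<times> ('u \<Rightarrow> 'u), 'k, 'm) cmodule \<Rightarrow>
    'u set \<Rightarrow> 'm \<Rightarrow> 'u set \<Rightarrow> 'm set" where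
  "restriction_classes k V = (\<lambda>S\<in>Ob FIsharp. \<lambda>v\<in>carrier (ob_map V S). \<lambda>T\<in>Pow S.
    H0_class k V T (hom_map V S T (partial_id T) v))"

lemma restriction_classes_apply:
  "finite S \<Longrightarrow> v \<in> carrier (ob_map V S) \<Longrightarrow> T \<subseteq> S \<Longrightarrow>
    restriction_classes k V S v T = H0_class k V T (hom_map V S T (partial_id T) v)"
  by (simp add: restriction_classes_def)

context
  fixes k :: "('k, 'x) ring_scheme" and V :: "('u set, 'u set \<times> 'u set \<times> ('u \<Rightarrow> 'u), 'k, 'm) cmodule"
  assumes V: "is_functor FIsharp (kMod k) V"
begin

lemma restriction_mod_hom:
  "finite S \<Longrightarrow> T \<subseteq> S \<Longrightarrow> hom_map V S T (partial_id T) \<in> mod_hom k (ob_map V S) (ob_map V T)"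
  by (rule partial_id_mod_hom[OF V]) (auto intro: rev_finite_subset)

lemma inclusion_mod_hom:
  "finite S \<Longrightarrow> T \<subseteq> S \<Longrightarrow> hom_map V T S (partial_id T) \<in> mod_hom k (ob_map V T) (ob_map V S)"
  by (rule partial_id_mod_hom[OF V]) (auto intro: rev_finite_subset)

lemma restriction_classes_mod_hom:
  assumes S: "finite S"
  shows "restriction_classes k V S \<in> mod_hom k (ob_map V S) (ob_map (M_ob (H0_ob k V)) S)"
proof -
  have "restriction_classes k V S = (\<lambda>v\<in>carrier (ob_map V S). \<lambda>T\<in>Pow S.
      H0_class k V T (hom_map V S T (partial_id T) v))"
    using S by (simp add: restriction_classes_def)
  also have "\<dots> \<in> mod_hom k (ob_map V S) (ob_map (M_ob (H0_ob k V)) S)"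
  proof (rule mod_hom_restrictI[OF module_finite[OF V S]])
    fix v w a assume v: "v \<in> carrier (ob_map V S)"
    have fin: "finite T" if "T \<subseteq> S" for T using that S by (rule finite_subset)
    note cl = mod_hom_closed[OF restriction_mod_hom[OF S]]
    show "(\<lambda>T\<in>Pow S. H0_class k V T (hom_map V S T (partial_id T) v)) \<in>
        carrier (ob_map (M_ob (H0_ob k V)) S)"
      using v cl by (simp add: carrier_M[OF S] H0_class_carrier[OF V fin fin])
    show "(\<lambda>T\<in>Pow S. H0_class k V T (hom_map V S T (partial_id T) (v \<oplus>\<^bsub>ob_map V S\<^esub> w))) =
        (\<lambda>T\<in>Pow S. H0_class k V T (hom_map V S T (partial_id T) v))
        \<oplus>\<^bsub>ob_map (M_ob (H0_ob k V)) S\<^esub>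
        (\<lambda>T\<in>Pow S. H0_class k V T (hom_map V S T (partial_id T) w))"
      if w: "w \<in> carrier (ob_map V S)"
      using v w cl by (auto simp: ob_map_M dsum_mod_simps fun_eq_iff H0_class_add[OF V fin fin]
          mod_hom_add[OF restriction_mod_hom[OF S]])
    show "(\<lambda>T\<in>Pow S. H0_class k V T (hom_map V S T (partial_id T) (a \<odot>\<^bsub>ob_map V S\<^esub> v))) =
        a \<odot>\<^bsub>ob_map (M_ob (H0_ob k V)) S\<^esub>
        (\<lambda>T\<in>Pow S. H0_class k V T (hom_map V S T (partial_id T) v))"
      if a: "a \<in> carrier k"
      using v a cl by (auto simp: ob_map_M dsum_mod_simps fun_eq_iff H0_class_smult[OF V fin fin]
          mod_hom_smult[OF restriction_mod_hom[OF S]])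
  qed
  finally show ?thesis .
qed

lemma restriction_classes_nat_trans:
  "restriction_classes k V \<in> nat_trans FIsharp k V (M_ob (H0_ob k V))"
proof (rule nat_transI)
  fix S T :: "'u set" and f x
  assume "S \<in> Ob FIsharp" "T \<in> Ob FIsharp" and f: "f \<in> Hom FIsharp S T"
    and x: "x \<in> carrier (ob_map V S)"
  then have S: "finite S" and T: "finite T" by auto
  obtain A B \<phi> where f_eq: "f = (A, B, \<phi>)" by (metis prod_cases3)
  note f' = f[unfolded f_eq]
  note W = is_functor_H0_ob[OF V]
  have y: "hom_map V S T f x \<in> carrier (ob_map V T)"
    using mod_hom_closed[OF cmodule_hom[OF V]] S T f x by simp
  have x': "restriction_classes k V S x \<in> carrier (ob_map (M_ob (H0_ob k V)) S)"
    by (rule mod_hom_closed[OF restriction_classes_mod_hom[OF S] x])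
  show "restriction_classes k V T (hom_map V S T f x) =
      hom_map (M_ob (H0_ob k V)) S T f (restriction_classes k V S x)"
  proof (rule M_eqI[of _ "H0_ob k V" T])
    show "restriction_classes k V T (hom_map V S T f x) \<in> carrier (ob_map (M_ob (H0_ob k V)) T)"
      by (rule mod_hom_closed[OF restriction_classes_mod_hom[OF T] y])
    show "hom_map (M_ob (H0_ob k V)) S T f (restriction_classes k V S x) \<in>
        carrier (ob_map (M_ob (H0_ob k V)) T)"
      by (rule mod_hom_closed[OF M_hom_mod_hom[OF W f S T] x'])
  next
    fix T' assume T': "T' \<subseteq> T"
    have "{a \<in> A. \<phi> a \<in> T'} \<subseteq> S" using f' by (auto simp: Hom_FIsharp)
    then show "restriction_classes k V T (hom_map V S T f x) T' =
        hom_map (M_ob (H0_ob k V)) S T f (restriction_classes k V S x) T'"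
      unfolding f_eq M_hom_component[OF W f' S T x' T']
      using H0_class_restriction[OF V f' S T T' x] y[unfolded f_eq] T' x S T
      by (simp add: restriction_classes_apply)
  qed
qed (simp_all add: restriction_classes_mod_hom, simp add: restriction_classes_def)

text \<open>By induction on \<open>S\<close> all restrictions of \<open>v\<close> to proper subsets vanish. Then \<open>v\<close> lies both in the
  decomposables and in their complement.\<close>

lemma restrictions_decomposable_imp_zero:
  assumes "finite S" "v \<in> carrier (ob_map V S)"
    and "\<And>T. T \<subseteq> S \<Longrightarrow> hom_map V S T (partial_id T) v \<in> decomposables k V T"
  shows "v = \<zero>\<^bsub>ob_map V S\<^esub>"
  using assms
proof (induction S arbitrary: v rule: finite_psubset_induct)
  case (psubset S)
  note S = psubset.hyps and v = psubset.prems(1)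
  have "hom_map V S R (partial_id R) v = \<zero>\<^bsub>ob_map V R\<^esub>" if R: "R \<subset> S" for R
  proof (rule psubset.IH[OF R])
    have RS: "R \<subseteq> S" using R by auto
    have fR: "finite R" using RS S by (rule finite_subset)
    show "hom_map V S R (partial_id R) v \<in> carrier (ob_map V R)"
      by (rule mod_hom_closed[OF restriction_mod_hom[OF S RS] v])
    show "hom_map V R T (partial_id T) (hom_map V S R (partial_id R) v) \<in> decomposables k V T"
      if T: "T \<subseteq> R" for T
    proof -
      have "R \<inter> T = T" using T by auto
      then have "hom_map V R T (partial_id T) (hom_map V S R (partial_id R) v) =
          hom_map V S T (partial_id T) v"
        using T RS S fR v finite_subset[OF T fR] by (subst partial_id_partial_id[OF V]) auto
      then show ?thesis using psubset.prems(2)[of T] T RS by auto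
    qed
  qed
  moreover have "v \<in> decomposables k V S"
    using psubset.prems(2)[of S] by (simp add: partial_id_self[OF V S v])
  ultimately show ?case
    using v decomposables_complement[OF V S] by metis
qed

text \<open>A family with the single nonzero component \<open>c R\<close> comes from the representative of \<open>c R\<close> in the
  complement of the decomposables, included into \<open>S\<close>: its restriction to a set not containing \<open>R\<close>
  factors through a proper subset of \<open>R\<close> and is zero, and its restriction to a proper superset of
  \<open>R\<close> is decomposable. General families are sums of such, with the components outside a finite
  set \<open>F\<close> of subsets being zero.\<close>

lemma restriction_classes_surj:
  assumes S: "finite S" and c: "c \<in> carrier (ob_map (M_ob (H0_ob k V)) S)"
  shows "\<exists>v\<in>carrier (ob_map V S). \<forall>T\<subseteq>S. H0_class k V T (hom_map V S T (partial_id T) v) = c T"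
proof -
  have fin: "finite T" if "T \<subseteq> S" for T using that S by (rule finite_subset)
  note W = is_functor_H0_ob[OF V]
  have cT: "c T \<in> carrier (ob_map (H0_ob k V) T)" if "T \<subseteq> S" for T
    by (rule M_component[OF c that])
  interpret VS: module k "ob_map V S" by (rule module_finite[OF V S])
  have "\<exists>v\<in>carrier (ob_map V S). \<forall>T\<subseteq>S. H0_class k V T (hom_map V S T (partial_id T) v) =
      (if T \<in> F then c T else \<zero>\<^bsub>ob_map (H0_ob k V) T\<^esub>)" if "finite F" "F \<subseteq> Pow S" for F
    using that
  proof (induction F rule: finite_induct)
    case empty
    show ?case
      by (rule bexI[where x = "\<zero>\<^bsub>ob_map V S\<^esub>"])
        (auto simp: mod_hom_zero[OF module_finite[OF V S] module_finite[OF V fin]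
            restriction_mod_hom[OF S]] H0_class_zero[OF V fin fin])
  next
    case (insert R F)
    then obtain v where v: "v \<in> carrier (ob_map V S)"
      and v_cl: "\<And>T. T \<subseteq> S \<Longrightarrow> H0_class k V T (hom_map V S T (partial_id T) v) =
        (if T \<in> F then c T else \<zero>\<^bsub>ob_map (H0_ob k V) T\<^esub>)" by auto
    have R: "R \<subseteq> S" and fR: "finite R" using insert fin by auto
    obtain w where w: "w \<in> carrier (ob_map V R)" "c R = H0_class k V R w"
      using cT[OF R] by (rule H0_class_cases[OF V fR fR])
    obtain p where p: "p \<in> mod_hom k (ob_map V R) (ob_map V R)"
      and p0: "\<And>v Q. v \<in> carrier (ob_map V R) \<Longrightarrow> Q \<subset> R \<Longrightarrow>
        hom_map V R Q (partial_id Q) (p v) = \<zero>\<^bsub>ob_map V Q\<^esub>"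
      and pU: "\<And>v. v \<in> carrier (ob_map V R) \<Longrightarrow> v \<ominus>\<^bsub>ob_map V R\<^esub> p v \<in> decomposables k V R"
      using decomposables_complement[OF V fR] by metis
    have pw: "p w \<in> carrier (ob_map V R)" by (rule mod_hom_closed[OF p w(1)])
    have cR: "c R = H0_class k V R (p w)"
      using w pw pU[OF w(1)] by (simp add: H0_class_eq_iff[OF V fR fR])
    define u where "u = hom_map V R S (partial_id R) (p w)"
    have u: "u \<in> carrier (ob_map V S)"
      unfolding u_def by (rule mod_hom_closed[OF inclusion_mod_hom[OF S R] pw])
    have u_cl: "H0_class k V T (hom_map V S T (partial_id T) u) =
        (if T = R then c R else \<zero>\<^bsub>ob_map (H0_ob k V) T\<^esub>)" if T: "T \<subseteq> S" for T
    proof -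
      have fT: "finite T" by (rule fin[OF T])
      have eq: "hom_map V S T (partial_id T) u = hom_map V R T (partial_id (R \<inter> T)) (p w)"
        unfolding u_def using R T S fR fT pw by (subst partial_id_partial_id[OF V]) auto
      consider "T = R" | "R \<subset> T" | "R \<inter> T \<subset> R" by auto
      then show ?thesis
      proof cases
        case 1
        then show ?thesis using eq by (simp add: cR partial_id_self[OF V fR pw])
      next
        case 2
        then have "R \<inter> T = R" by auto
        then have "hom_map V S T (partial_id T) u \<in> decomposables k V T"
          using inclusion_decomposable[OF V fT 2 pw] by (simp add: eq)
        then show ?thesis
          using 2 mod_hom_closed[OF restriction_mod_hom[OF S T] u]
          by (auto simp: H0_class_eq_zero_iff[OF V fT fT])
      next
        case 3
        have fRT: "finite (R \<inter> T)" using fT by simp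
        have "hom_map V R T (partial_id (R \<inter> T)) (p w) =
            hom_map V (R \<inter> T) T (partial_id (R \<inter> T)) (hom_map V R (R \<inter> T) (partial_id (R \<inter> T)) (p w))"
          using fR fT pw by (subst partial_id_partial_id[OF V]) auto
        also have "\<dots> = \<zero>\<^bsub>ob_map V T\<^esub>"
          by (simp add: p0[OF w(1) 3] mod_hom_zero[OF module_finite[OF V fRT] module_finite[OF V fT]
                inclusion_mod_hom[OF fT]])
        finally show ?thesis using 3 by (auto simp: eq H0_class_zero[OF V fT fT])
      qed
    qed
    show ?case
    proof (rule bexI[of _ "v \<oplus>\<^bsub>ob_map V S\<^esub> u"], intro allI impI)
      fix T assume T: "T \<subseteq> S"
      interpret H: module k "ob_map (H0_ob k V) T" by (rule FB_module[OF W fin[OF T]])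
      interpret HR: module k "ob_map (H0_ob k V) R" by (rule FB_module[OF W fR])
      have "H0_class k V T (hom_map V S T (partial_id T) (v \<oplus>\<^bsub>ob_map V S\<^esub> u)) =
        H0_class k V T (hom_map V S T (partial_id T) v) \<oplus>\<^bsub>ob_map (H0_ob k V) T\<^esub>
        H0_class k V T (hom_map V S T (partial_id T) u)"
        using u v mod_hom_closed[OF restriction_mod_hom[OF S T]]
        by (simp add: mod_hom_add[OF restriction_mod_hom[OF S T]]
            H0_class_add[OF V fin[OF T] fin[OF T]])
      then show "H0_class k V T (hom_map V S T (partial_id T) (v \<oplus>\<^bsub>ob_map V S\<^esub> u)) =
          (if T \<in> insert R F then c T else \<zero>\<^bsub>ob_map (H0_ob k V) T\<^esub>)"
        using cT[OF T] \<open>R \<notin> F\<close> by (simp add: u_cl[OF T] v_cl[OF T] split: if_splits)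
    qed (simp add: u v)
  qed
  from this[of "Pow S"] show ?thesis using S by auto
qed

lemma restriction_classes_bij:
  assumes S: "finite S"
  shows "bij_betw (restriction_classes k V S) (carrier (ob_map V S))
    (carrier (ob_map (M_ob (H0_ob k V)) S))"
proof -
  interpret VS: module k "ob_map V S" by (rule module_finite[OF V S])
  have fin: "finite T" if "T \<subseteq> S" for T using that S by (rule finite_subset)
  have inj: "x = y" if x: "x \<in> carrier (ob_map V S)" and y: "y \<in> carrier (ob_map V S)"
    and eq: "restriction_classes k V S x = restriction_classes k V S y" for x y
  proof -
    have "hom_map V S T (partial_id T) (x \<ominus>\<^bsub>ob_map V S\<^esub> y) \<in> decomposables k V T" if T: "T \<subseteq> S" for T
      using fun_cong[OF eq, of T] x y T S mod_hom_closed[OF restriction_mod_hom[OF S T]]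
      by (simp add: restriction_classes_apply H0_class_eq_iff[OF V fin[OF T] fin[OF T]]
          mod_hom_minus[OF module_finite[OF V S] module_finite[OF V fin[OF T]] restriction_mod_hom[OF S T]])
    then have "x \<ominus>\<^bsub>ob_map V S\<^esub> y = \<zero>\<^bsub>ob_map V S\<^esub>"
      using x y by (intro restrictions_decomposable_imp_zero[OF S]) auto
    then show "x = y" using minus_eq_zero_iff[OF VS.M.abelian_group_axioms x y] by simp
  qed
  have "c \<in> restriction_classes k V S ` carrier (ob_map V S)"
    if c: "c \<in> carrier (ob_map (M_ob (H0_ob k V)) S)" for c
  proof -
    obtain v where v: "v \<in> carrier (ob_map V S)"
      "\<forall>T\<subseteq>S. H0_class k V T (hom_map V S T (partial_id T) v) = c T"
      using restriction_classes_surj[OF S c] by auto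
    have "restriction_classes k V S v = c"
      by (rule M_eqI[OF mod_hom_closed[OF restriction_classes_mod_hom[OF S] v(1)] c])
        (use v S in \<open>simp add: restriction_classes_apply\<close>)
    then show ?thesis using v by auto
  qed
  then show ?thesis
    using inj mod_hom_closed[OF restriction_classes_mod_hom[OF S]]
    by (auto simp: bij_betw_def inj_on_def)
qed

end

section \<open>The FB-module \<open>H\<^sub>0 (M W)\<close>\<close>

definition top_summand :: "('u set, 'u \<Rightarrow> 'u, 'k, 'm) cmodule \<Rightarrow> 'u set \<Rightarrow> 'm \<Rightarrow> 'u set \<Rightarrow> 'm" where
  "top_summand W S w = (\<lambda>T\<in>Pow S. if T = S then w else \<zero>\<^bsub>ob_map W T\<^esub>)"

lemma top_summand_top: "top_summand W S w S = w"
  by (simp add: top_summand_def)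

definition top_class ::
  "('k, 'x) ring_scheme \<Rightarrow> ('u set, 'u \<Rightarrow> 'u, 'k, 'm) cmodule \<Rightarrow>
    'u set \<Rightarrow> 'm \<Rightarrow> ('u set \<Rightarrow> 'm) set" where
  "top_class k W = (\<lambda>S\<in>Ob FB. \<lambda>w\<in>carrier (ob_map W S). H0_class k (M_ob W) S (top_summand W S w))"

context
  fixes k :: "('k, 'x) ring_scheme" and W :: "('u set, 'u \<Rightarrow> 'u, 'k, 'm) cmodule"
  assumes W: "is_functor FB (kMod k) W"
begin

lemma top_component_mod_hom:
  assumes S: "finite S"
  shows "(\<lambda>x\<in>carrier (ob_map (M_ob W) S). x S) \<in> mod_hom k (ob_map (M_ob W) S) (ob_map W S)"
  using dsum_mod_projection[OF M_module[OF W S, unfolded ob_map_M], of S] by (simp add: ob_map_M)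

text \<open>Injections from smaller sets cannot reach the summand of the full set \<open>S\<close>, which gives one
  inclusion. For the other, let \<open>p\<close> be the projection along the decomposables. All restrictions of
  \<open>p x\<close> to proper subsets \<open>T\<close> vanish, hence so do its components there, and its component at \<open>S\<close>
  agrees with that of \<open>x\<close>. If the latter is zero then \<open>p x\<close> is zero and \<open>x\<close> is decomposable.\<close>

lemma decomposables_M:
  assumes S: "finite S"
  shows "decomposables k (M_ob W) S = {x \<in> carrier (ob_map (M_ob W) S). x S = \<zero>\<^bsub>ob_map W S\<^esub>}"
proof
  note MW = is_functor_M_ob[OF W]
  let ?top = "\<lambda>x\<in>carrier (ob_map (M_ob W) S). x S"
  have top: "?top \<in> mod_hom k (ob_map (M_ob W) S) (ob_map W S)" by (rule top_component_mod_hom[OF S])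
  have modM: "module k (ob_map (M_ob W) S)" by (rule M_module[OF W S])
  have modW: "module k (ob_map W S)" by (rule FB_module[OF W S])
  have "submodule {x \<in> carrier (ob_map (M_ob W) S). ?top x \<in> {\<zero>\<^bsub>ob_map W S\<^esub>}} k (ob_map (M_ob W) S)"
    by (rule submodule_vimage[OF modM modW top zero_submodule[OF modW]])
  also have "{x \<in> carrier (ob_map (M_ob W) S). ?top x \<in> {\<zero>\<^bsub>ob_map W S\<^esub>}} =
      {x \<in> carrier (ob_map (M_ob W) S). x S = \<zero>\<^bsub>ob_map W S\<^esub>}" by auto
  finally have sub: "submodule {x \<in> carrier (ob_map (M_ob W) S). x S = \<zero>\<^bsub>ob_map W S\<^esub>} k (ob_map (M_ob W) S)" .
  show le: "decomposables k (M_ob W) S \<subseteq> {x \<in> carrier (ob_map (M_ob W) S). x S = \<zero>\<^bsub>ob_map W S\<^esub>}"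
  proof (rule FI_decomposables_induct[OF cmodule_FI[OF MW] S], unfold comp_FI_simps)
    show "submodule {x \<in> carrier (ob_map (M_ob W) S). x S = \<zero>\<^bsub>ob_map W S\<^esub>} k (ob_map (M_ob W) S)"
      by (rule sub)
  next
    fix T f x
    assume T: "finite T" "card T < card S" and f: "f \<in> Hom FI T S" and x: "x \<in> carrier (ob_map (M_ob W) T)"
    have hom: "(T, f ` T, f) \<in> Hom FIsharp T S" using f by (auto simp: Hom_FI Hom_FIsharp bij_betw_def)
    have "\<not> S \<subseteq> f ` T"
    proof
      assume "S \<subseteq> f ` T"
      then have "card S \<le> card (f ` T)" using T by (intro card_mono) auto
      also have "\<dots> \<le> card T" by (rule card_image_le[OF T(1)])
      finally show False using T by simp
    qed
    then show "hom_map (M_ob W) T S (T, f ` T, f) x \<in>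
        {x \<in> carrier (ob_map (M_ob W) S). x S = \<zero>\<^bsub>ob_map W S\<^esub>}"
      using M_hom_component[OF W hom T(1) S x subset_refl]
        mod_hom_closed[OF M_hom_mod_hom[OF W hom T(1) S] x] by simp
  qed
  show "{x \<in> carrier (ob_map (M_ob W) S). x S = \<zero>\<^bsub>ob_map W S\<^esub>} \<subseteq> decomposables k (M_ob W) S"
  proof safe
    fix x assume x: "x \<in> carrier (ob_map (M_ob W) S)" and xS: "x S = \<zero>\<^bsub>ob_map W S\<^esub>"
    interpret M: module k "ob_map (M_ob W) S" by (rule modM)
    interpret WS: module k "ob_map W S" by (rule modW)
    obtain p where p: "p \<in> mod_hom k (ob_map (M_ob W) S) (ob_map (M_ob W) S)"
      and p0: "\<And>v R. v \<in> carrier (ob_map (M_ob W) S) \<Longrightarrow> R \<subset> S \<Longrightarrow>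
        hom_map (M_ob W) S R (partial_id R) (p v) = \<zero>\<^bsub>ob_map (M_ob W) R\<^esub>"
      and pU: "\<And>v. v \<in> carrier (ob_map (M_ob W) S) \<Longrightarrow>
        v \<ominus>\<^bsub>ob_map (M_ob W) S\<^esub> p v \<in> decomposables k (M_ob W) S"
      using decomposables_complement[OF MW S] by metis
    have px: "p x \<in> carrier (ob_map (M_ob W) S)" by (rule mod_hom_closed[OF p x])
    have "p x = \<zero>\<^bsub>ob_map (M_ob W) S\<^esub>"
    proof (rule M_eqI[OF px])
      show "\<zero>\<^bsub>ob_map (M_ob W) S\<^esub> \<in> carrier (ob_map (M_ob W) S)" by simp
      fix T assume T: "T \<subseteq> S"
      have fT: "finite T" using T S by (rule finite_subset)
      have "p x T = \<zero>\<^bsub>ob_map W T\<^esub>"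
      proof (cases "T = S")
        case True
        have "?top (x \<ominus>\<^bsub>ob_map (M_ob W) S\<^esub> p x) = \<zero>\<^bsub>ob_map W S\<^esub>"
          using pU[OF x] le x px by auto
        then have "\<zero>\<^bsub>ob_map W S\<^esub> \<ominus>\<^bsub>ob_map W S\<^esub> p x S = \<zero>\<^bsub>ob_map W S\<^esub>"
          using mod_hom_minus[OF modM modW top x px] x px xS by simp
        then show ?thesis
          using True M_component[OF px subset_refl]
            minus_eq_zero_iff[OF WS.M.abelian_group_axioms WS.M.zero_closed] by simp
      next
        case False
        then have TS: "T \<subset> S" using T by auto
        have "p x T = hom_map (M_ob W) S T (partial_id T) (p x) T"
          using M_partial_id[OF W S fT _ px subset_refl] T by simp
        also have "\<dots> = \<zero>\<^bsub>ob_map W T\<^esub>"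
          by (simp add: p0[OF x TS] ob_map_M dsum_mod_simps)
        finally show ?thesis .
      qed
      then show "p x T = \<zero>\<^bsub>ob_map (M_ob W) S\<^esub> T" using T by (simp add: ob_map_M dsum_mod_simps)
    qed
    then show "x \<in> decomposables k (M_ob W) S"
      using pU[OF x] minus_zero_right[OF M.M.abelian_group_axioms x] by simp
  qed
qed

text \<open>Linearity, naturality and bijectivity of the map from \<open>W\<close> to \<open>H\<^sub>0 (M W)\<close> are all checked through
  this criterion.\<close>

lemma H0_class_M_eq_iff:
  assumes S: "finite S" and x: "x \<in> carrier (ob_map (M_ob W) S)" and y: "y \<in> carrier (ob_map (M_ob W) S)"
  shows "H0_class k (M_ob W) S x = H0_class k (M_ob W) S y \<longleftrightarrow> x S = y S"
proof -
  interpret M: module k "ob_map (M_ob W) S" by (rule M_module[OF W S])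
  interpret WS: module k "ob_map W S" by (rule FB_module[OF W S])
  have cl: "x S \<in> carrier (ob_map W S)" "y S \<in> carrier (ob_map W S)"
    using M_component[OF x subset_refl] M_component[OF y subset_refl] .
  have "(x \<ominus>\<^bsub>ob_map (M_ob W) S\<^esub> y) S = x S \<ominus>\<^bsub>ob_map W S\<^esub> y S"
    using mod_hom_minus[OF M_module[OF W S] FB_module[OF W S] top_component_mod_hom[OF S] x y] x y by simp
  then have "H0_class k (M_ob W) S x = H0_class k (M_ob W) S y \<longleftrightarrow>
      x S \<ominus>\<^bsub>ob_map W S\<^esub> y S = \<zero>\<^bsub>ob_map W S\<^esub>"
    unfolding H0_class_eq_iff[OF is_functor_M_ob[OF W] S S x y]
    using x y by (simp add: decomposables_M[OF S])
  also have "\<dots> \<longleftrightarrow> x S = y S"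
    by (rule minus_eq_zero_iff[OF WS.M.abelian_group_axioms cl])
  finally show ?thesis .
qed

lemma top_summand_carrier:
  assumes S: "finite S" and w: "w \<in> carrier (ob_map W S)"
  shows "top_summand W S w \<in> carrier (ob_map (M_ob W) S)"
proof -
  have "\<zero>\<^bsub>ob_map W T\<^esub> \<in> carrier (ob_map W T)" if "T \<subseteq> S" for T
  proof -
    interpret module k "ob_map W T" by (rule FB_module[OF W finite_subset[OF that S]])
    show ?thesis by simp
  qed
  then show ?thesis using w by (auto simp: carrier_M[OF S] top_summand_def)
qed

lemma top_class_apply:
  "finite S \<Longrightarrow> w \<in> carrier (ob_map W S) \<Longrightarrow>
    top_class k W S w = H0_class k (M_ob W) S (top_summand W S w)"
  by (simp add: top_class_def)

lemma top_class_mod_hom: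
  assumes S: "finite S"
  shows "top_class k W S \<in> mod_hom k (ob_map W S) (ob_map (H0_ob k (M_ob W)) S)"
proof -
  note MW = is_functor_M_ob[OF W]
  interpret M: module k "ob_map (M_ob W) S" by (rule M_module[OF W S])
  interpret WS: module k "ob_map W S" by (rule FB_module[OF W S])
  note cl = top_summand_carrier[OF S]
  have "top_class k W S = (\<lambda>w\<in>carrier (ob_map W S). H0_class k (M_ob W) S (top_summand W S w))"
    using S by (simp add: top_class_def)
  also have "\<dots> \<in> mod_hom k (ob_map W S) (ob_map (H0_ob k (M_ob W)) S)"
  proof (rule mod_hom_restrictI[OF FB_module[OF W S]])
    fix w z a assume w: "w \<in> carrier (ob_map W S)"
    show "H0_class k (M_ob W) S (top_summand W S w) \<in> carrier (ob_map (H0_ob k (M_ob W)) S)"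
      by (rule H0_class_carrier[OF MW S S cl[OF w]])
    show "H0_class k (M_ob W) S (top_summand W S (w \<oplus>\<^bsub>ob_map W S\<^esub> z)) =
        H0_class k (M_ob W) S (top_summand W S w) \<oplus>\<^bsub>ob_map (H0_ob k (M_ob W)) S\<^esub>
        H0_class k (M_ob W) S (top_summand W S z)" if z: "z \<in> carrier (ob_map W S)"
    proof -
      have "(top_summand W S w \<oplus>\<^bsub>ob_map (M_ob W) S\<^esub> top_summand W S z) S = w \<oplus>\<^bsub>ob_map W S\<^esub> z"
        by (simp add: ob_map_M dsum_mod_simps top_summand_top)
      then show ?thesis
        using w z cl by (simp add: H0_class_add[OF MW S S] H0_class_M_eq_iff[OF S] top_summand_top)
    qed
    show "H0_class k (M_ob W) S (top_summand W S (a \<odot>\<^bsub>ob_map W S\<^esub> w)) =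
        a \<odot>\<^bsub>ob_map (H0_ob k (M_ob W)) S\<^esub> H0_class k (M_ob W) S (top_summand W S w)"
      if a: "a \<in> carrier k"
    proof -
      have "(a \<odot>\<^bsub>ob_map (M_ob W) S\<^esub> top_summand W S w) S = a \<odot>\<^bsub>ob_map W S\<^esub> w"
        by (simp add: ob_map_M dsum_mod_simps top_summand_top)
      then show ?thesis
        using w a cl by (simp add: H0_class_smult[OF MW S S] H0_class_M_eq_iff[OF S] top_summand_top)
    qed
  qed
  finally show ?thesis .
qed

lemma top_class_nat_trans: "top_class k W \<in> nat_trans FB k W (H0_ob k (M_ob W))"
proof (rule nat_transI)
  note MW = is_functor_M_ob[OF W]
  fix S T :: "'u set" and f w
  assume "S \<in> Ob FB" "T \<in> Ob FB" and f: "f \<in> Hom FB S T" and w: "w \<in> carrier (ob_map W S)"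
  then have S: "finite S" and T: "finite T" by auto
  have f': "(S, T, f) \<in> Hom FIsharp S T" using f by (auto simp: Hom_FB Hom_FIsharp)
  have fw: "hom_map W S T f w \<in> carrier (ob_map W T)"
    by (rule mod_hom_closed[OF FB_hom[OF W S T f] w])
  note x = top_summand_carrier[OF S w]
  have "{a \<in> S. f a \<in> T} = S" "restrict f S = f"
    using f by (auto simp: Hom_FB bij_betw_def extensional_restrict)
  then have "hom_map (M_ob W) S T (S, T, f) (top_summand W S w) T = hom_map W S T f w"
    using M_hom_component[OF W f' S T x subset_refl] by (simp add: top_summand_top)
  then show "top_class k W T (hom_map W S T f w) =
      hom_map (H0_ob k (M_ob W)) S T f (top_class k W S w)"
    using mod_hom_closed[OF M_hom_mod_hom[OF W f' S T] x]
    by (simp add: top_class_apply S T w fw H0_hom_class[OF MW S T f x] H0_class_M_eq_iff[OF T]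
        top_summand_carrier top_summand_top)
qed (simp_all add: top_class_mod_hom, simp add: top_class_def)

lemma top_class_bij:
  assumes S: "finite S"
  shows "bij_betw (top_class k W S) (carrier (ob_map W S)) (carrier (ob_map (H0_ob k (M_ob W)) S))"
proof -
  note MW = is_functor_M_ob[OF W]
  have "inj_on (top_class k W S) (carrier (ob_map W S))"
    by (rule inj_onI)
      (simp add: top_class_apply S H0_class_M_eq_iff top_summand_carrier top_summand_top)
  moreover have "c \<in> top_class k W S ` carrier (ob_map W S)"
    if c: "c \<in> carrier (ob_map (H0_ob k (M_ob W)) S)" for c
  proof -
    obtain x where x: "x \<in> carrier (ob_map (M_ob W) S)" "c = H0_class k (M_ob W) S x"
      using c by (rule H0_class_cases[OF MW S S])
    have xS: "x S \<in> carrier (ob_map W S)" by (rule M_component[OF x(1) subset_refl])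
    then have "c = top_class k W S (x S)"
      by (simp add: x top_class_apply S H0_class_M_eq_iff top_summand_carrier top_summand_top)
    then show ?thesis using xS by blast
  qed
  ultimately show ?thesis
    using mod_hom_closed[OF top_class_mod_hom[OF S]] by (auto simp: bij_betw_def)
qed

end

lemma id_isomorphic_H0_M:
  fixes k :: "('k, 'x) ring_scheme"
  shows "functors_isomorphic
    (Mod_cat FB k :: (('u set, 'u \<Rightarrow> 'u, 'k, 'm) cmodule, _) category) FB k
    id_functor (comp_functor (H0_functor k) M_functor)"
proof (rule functors_isomorphicI[where \<alpha> = "top_class k"])
  have simps: "ob_map (comp_functor (H0_functor k) M_functor) W = H0_ob k (M_ob W)"
    "ob_map id_functor W = W" for W :: "('u set, 'u \<Rightarrow> 'u, 'k, 'm) cmodule"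
    by (simp_all add: comp_functor_def id_functor_def H0_functor_def M_functor_def)
  have hom_simps: "hom_map (comp_functor (H0_functor k) M_functor) W W' \<eta> =
      hom_map (H0_functor k) (M_ob W) (M_ob W') (hom_map M_functor W W' \<eta>)"
    "hom_map id_functor W W' \<eta> = \<eta>"
    for W W' :: "('u set, 'u \<Rightarrow> 'u, 'k, 'm) cmodule" and \<eta>
    by (simp_all add: comp_functor_def id_functor_def M_functor_def)
  fix W :: "('u set, 'u \<Rightarrow> 'u, 'k, 'm) cmodule"
  assume "W \<in> Ob (Mod_cat FB k)"
  then have W: "is_functor FB (kMod k) W" by (simp add: Mod_cat_def)
  then show "is_functor FB (kMod k) (ob_map id_functor W)" by (simp add: simps)
  show "top_class k W \<in> nat_trans FB k (ob_map id_functor W)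
      (ob_map (comp_functor (H0_functor k) M_functor) W)"
    unfolding simps by (rule top_class_nat_trans[OF W])
  show "bij_betw (top_class k W S) (carrier (ob_map (ob_map id_functor W) S))
      (carrier (ob_map (ob_map (comp_functor (H0_functor k) M_functor) W) S))"
    if "S \<in> Ob FB" for S unfolding simps using top_class_bij[OF W] that by simp
  fix W' :: "('u set, 'u \<Rightarrow> 'u, 'k, 'm) cmodule" and \<eta> S w
  assume "W' \<in> Ob (Mod_cat FB k)" "\<eta> \<in> Hom (Mod_cat FB k) W W'" "S \<in> Ob FB"
    "w \<in> carrier (ob_map (ob_map id_functor W) S)"
  then have W': "is_functor FB (kMod k) W'" and \<eta>: "\<eta> \<in> nat_trans FB k W W'" and S: "finite S"
    and w: "w \<in> carrier (ob_map W S)" by (simp_all add: Mod_cat_def simps)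
  note M\<eta> = M_map_nat_trans[OF W W' \<eta>]
  have \<eta>w: "\<eta> S w \<in> carrier (ob_map W' S)"
    using mod_hom_closed[OF nat_trans_mod_hom[OF \<eta>]] S w by simp
  note x = top_summand_carrier[OF W S w]
  have "hom_map M_functor W W' \<eta> S (top_summand W S w) \<in> carrier (ob_map (M_ob W') S)"
    using mod_hom_closed[OF nat_trans_mod_hom[OF M\<eta>] x] S by simp
  then show "top_class k W' S (hom_map id_functor W W' \<eta> S w) =
      hom_map (comp_functor (H0_functor k) M_functor) W W' \<eta> S (top_class k W S w)"
    unfolding hom_simps using x w \<eta>w S
    by (simp add: top_class_apply[OF W] top_class_apply[OF W']
        H0_map_class(1)[OF is_functor_M_ob[OF W] is_functor_M_ob[OF W'] M\<eta> S]
        H0_class_M_eq_iff[OF W'] top_summand_carrier[OF W'] top_summand_top M_map_apply)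
qed

lemma M_H0_isomorphic_id:
  fixes k :: "('k, 'x) ring_scheme"
  shows "functors_isomorphic
    (Mod_cat FIsharp k :: (('u set, 'u set \<times> 'u set \<times> ('u \<Rightarrow> 'u), 'k, 'n) cmodule, _) category)
    FIsharp k (comp_functor M_functor (H0_functor k)) id_functor"
proof (rule functors_isomorphic_sym)
  let ?A = "Mod_cat FIsharp k ::
    (('u set, 'u set \<times> 'u set \<times> ('u \<Rightarrow> 'u), 'k, 'n) cmodule, 'u set \<Rightarrow> 'n \<Rightarrow> 'n) category"
  have simps: "ob_map (comp_functor M_functor (H0_functor k)) V = M_ob (H0_ob k V)"
    "ob_map id_functor V = V"
    for V :: "('u set, 'u set \<times> 'u set \<times> ('u \<Rightarrow> 'u), 'k, 'n) cmodule"
    by (simp_all add: comp_functor_def id_functor_def H0_functor_def M_functor_def)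
  have hom_simps: "hom_map (comp_functor M_functor (H0_functor k)) V V' \<eta> =
      hom_map M_functor (H0_ob k V) (H0_ob k V') (hom_map (H0_functor k) V V' \<eta>)"
    "hom_map id_functor V V' \<eta> = \<eta>"
    for V V' :: "('u set, 'u set \<times> 'u set \<times> ('u \<Rightarrow> 'u), 'k, 'n) cmodule" and \<eta>
    by (simp_all add: comp_functor_def id_functor_def H0_functor_def)
  show ob: "is_functor FIsharp (kMod k) (ob_map id_functor V)" if "V \<in> Ob ?A" for V
    using that by (simp add: Mod_cat_def simps)
  show "hom_map id_functor V V' \<eta> \<in> nat_trans FIsharp k (ob_map id_functor V) (ob_map id_functor V')"
    if "\<eta> \<in> Hom ?A V V'" for V V' \<eta>
    using that by (simp add: Mod_cat_def simps hom_simps)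
  show "functors_isomorphic ?A FIsharp k id_functor (comp_functor M_functor (H0_functor k))"
  proof (rule functors_isomorphicI[where \<alpha> = "restriction_classes k", OF ob])
    fix V assume "V \<in> Ob ?A"
    then have V: "is_functor FIsharp (kMod k) V" by (simp add: Mod_cat_def)
    show "restriction_classes k V \<in> nat_trans FIsharp k (ob_map id_functor V)
        (ob_map (comp_functor M_functor (H0_functor k)) V)"
      unfolding simps by (rule restriction_classes_nat_trans[OF V])
    show "bij_betw (restriction_classes k V S) (carrier (ob_map (ob_map id_functor V) S))
        (carrier (ob_map (ob_map (comp_functor M_functor (H0_functor k)) V) S))"
      if "S \<in> Ob FIsharp" for S unfolding simps using restriction_classes_bij[OF V] that by simp
    fix V' \<eta> S v
    assume "V' \<in> Ob ?A" "\<eta> \<in> Hom ?A V V'" "S \<in> Ob FIsharp"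
      "v \<in> carrier (ob_map (ob_map id_functor V) S)"
    then have V': "is_functor FIsharp (kMod k) V'" and \<eta>: "\<eta> \<in> nat_trans FIsharp k V V'"
      and S: "finite S" and v: "v \<in> carrier (ob_map V S)" by (simp_all add: Mod_cat_def simps)
    note H\<eta> = H0_map_nat_trans[OF V V' \<eta>]
    note M\<eta> = M_map_nat_trans[OF is_functor_H0_ob[OF V] is_functor_H0_ob[OF V'] H\<eta>]
    have \<eta>v: "\<eta> S v \<in> carrier (ob_map V' S)"
      using mod_hom_closed[OF nat_trans_mod_hom[OF \<eta>]] S v by simp
    have c: "restriction_classes k V S v \<in> carrier (ob_map (M_ob (H0_ob k V)) S)"
      by (rule mod_hom_closed[OF restriction_classes_mod_hom[OF V S] v])
    show "restriction_classes k V' S (hom_map id_functor V V' \<eta> S v) =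
        hom_map (comp_functor M_functor (H0_functor k)) V V' \<eta> S (restriction_classes k V S v)"
      unfolding hom_simps
    proof (rule M_eqI)
      show "restriction_classes k V' S (\<eta> S v) \<in> carrier (ob_map (M_ob (H0_ob k V')) S)"
        by (rule mod_hom_closed[OF restriction_classes_mod_hom[OF V' S] \<eta>v])
      show "hom_map M_functor (H0_ob k V) (H0_ob k V') (hom_map (H0_functor k) V V' \<eta>) S
          (restriction_classes k V S v) \<in> carrier (ob_map (M_ob (H0_ob k V')) S)"
        using mod_hom_closed[OF nat_trans_mod_hom[OF M\<eta>] c] S by simp
      fix T assume T: "T \<subseteq> S"
      then have fT: "finite T" using S by (rule finite_subset)
      have "\<eta> T (hom_map V S T (partial_id T) v) = hom_map V' S T (partial_id T) (\<eta> S v)"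
        using nat_trans_natural[OF \<eta>, of S T "partial_id T" v] S T fT v by (simp add: partial_id_Hom)
      then show "restriction_classes k V' S (\<eta> S v) T =
          hom_map M_functor (H0_ob k V) (H0_ob k V') (hom_map (H0_functor k) V V' \<eta>) S
            (restriction_classes k V S v) T"
        using T S v \<eta>v mod_hom_closed[OF restriction_mod_hom[OF V S T] v]
        by (simp add: M_map_apply[OF S c T] restriction_classes_apply H0_map_class(1)[OF V V' \<eta> fT])
    qed
  qed
qed

section \<open>Splitting an FB-module by cardinality\<close>

lemma representation_FB:
  assumes W: "is_functor FB (kMod k) W" and P: "finite P"
  shows "representation k (BijGroup P) (ob_map W P) (hom_map W P P)"
proof -
  have Hom: "Bij P = Hom FB P P" by (auto simp: Bij_def Hom_FB)
  have Bij: "hom_map W P P f \<in> Bij (carrier (ob_map W P))" if f: "f \<in> Bij P" for f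
  proof -
    define g where "g = (\<lambda>x\<in>P. inv_into P f x)"
    have g: "g \<in> Bij P" unfolding g_def by (rule restrict_inv_into_Bij[OF f])
    have bij: "bij_betw f P P" using f by (simp add: Bij_def)
    have gf: "compose P g f = (\<lambda>x\<in>P. x)" "compose P f g = (\<lambda>x\<in>P. x)"
      using bij bij_betw_inv_into_left[OF bij] bij_betw_inv_into_right[OF bij]
      by (auto simp: g_def compose_def fun_eq_iff bij_betw_def)
    have f': "f \<in> Hom FB P P" and g': "g \<in> Hom FB P P" using f g by (simp_all add: Hom)
    note hf = FB_hom[OF W P P f'] and hg = FB_hom[OF W P P g']
    have "bij_betw (hom_map W P P f) (carrier (ob_map W P)) (carrier (ob_map W P))"
      by (rule bij_betwI[where g = "hom_map W P P g"])
        (use mod_hom_closed[OF hf] mod_hom_closed[OF hg] in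
          \<open>auto simp: FB_Comp[OF W P P P] f' g' gf FB_Ident[OF W P]\<close>)
    then show ?thesis using mod_hom_extensional[OF hf] by (simp add: Bij_def)
  qed
  have "hom_map W P P \<in> hom (BijGroup P) (BijGroup (carrier (ob_map W P)))"
  proof (rule homI)
    fix f g assume "f \<in> carrier (BijGroup P)" "g \<in> carrier (BijGroup P)"
    then have f: "f \<in> Bij P" and g: "g \<in> Bij P" by (simp_all add: BijGroup_def)
    have "hom_map W P P (compose P f g) = compose (carrier (ob_map W P)) (hom_map W P P f) (hom_map W P P g)"
      using FB_Comp[OF W P P P] f g mod_hom_extensional[OF FB_hom[OF W P P], of "compose P f g"]
        compose_Bij[OF f g]
      by (intro extensionalityI[of _ "carrier (ob_map W P)"]) (auto simp: Hom compose_eq)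
    then show "hom_map W P P (f \<otimes>\<^bsub>BijGroup P\<^esub> g) =
        hom_map W P P f \<otimes>\<^bsub>BijGroup (carrier (ob_map W P))\<^esub> hom_map W P P g"
      using f g Bij by (simp add: BijGroup_def)
  qed (use Bij in \<open>simp add: BijGroup_def\<close>)
  then have "group_action (BijGroup P) (carrier (ob_map W P)) (hom_map W P P)"
    by (simp add: group_action_def group_hom_def group_hom_axioms_def group_BijGroup)
  then show ?thesis
    using FB_module[OF W P] FB_hom[OF W P P] by (simp add: representation_def BijGroup_def Hom)
qed

lemma frame_bij:
  assumes "finite P" "finite S" "card S = card P"
  shows "bij_betw (frame P S) P S"
proof -
  have "\<exists>e. bij_betw e P S" using assms by (intro finite_same_card_bij) auto
  then show ?thesis unfolding frame_def by (rule someI_ex)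
qed

text \<open>The permutation of \<open>P\<close> that corresponds to a bijection \<open>f\<close> from \<open>S\<close> to \<open>T\<close> under the chosen
  identifications of \<open>S\<close> and \<open>T\<close> with \<open>P\<close>.\<close>

definition frame_transport :: "'u set \<Rightarrow> 'u set \<Rightarrow> 'u set \<Rightarrow> ('u \<Rightarrow> 'u) \<Rightarrow> 'u \<Rightarrow> 'u" where
  "frame_transport P S T f = (\<lambda>x\<in>P. inv_into P (frame P T) (f (frame P S x)))"

definition frame_inv :: "'u set \<Rightarrow> 'u set \<Rightarrow> 'u \<Rightarrow> 'u" where
  "frame_inv P S = (\<lambda>s\<in>S. inv_into P (frame P S) s)"

lemma frame_inv_Hom:
  assumes "finite P" "finite S" "card S = card P"
  shows "frame_inv P S \<in> Hom FB S P"
  using bij_betw_inv_into[OF frame_bij[OF assms]] by (simp add: frame_inv_def Hom_FB)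

lemma frame_Hom:
  assumes "finite P" "finite S" "card S = card P"
  shows "restrict (frame P S) P \<in> Hom FB P S"
  using frame_bij[OF assms] by (simp add: Hom_FB)

lemma frame_cancel:
  assumes "finite P" "finite S" "card S = card P"
  shows "compose S (restrict (frame P S) P) (frame_inv P S) = (\<lambda>s\<in>S. s)"
    and "compose P (frame_inv P S) (restrict (frame P S) P) = (\<lambda>x\<in>P. x)"
  using frame_bij[OF assms] bij_betw_inv_into_left[OF frame_bij[OF assms]]
    bij_betw_inv_into_right[OF frame_bij[OF assms]]
  by (auto simp: frame_inv_def compose_def fun_eq_iff bij_betw_def inv_into_into)

text \<open>The last equation says that the identifications with \<open>P\<close> intertwine \<open>f\<close> with its permutation of
  \<open>P\<close>; naturality of the splitting by cardinality rests on it.\<close>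

lemma frame_transport_Hom:
  assumes "finite P" "finite S" "finite T" "card S = card P" "f \<in> Hom FB S T"
  shows "frame_transport P S T f \<in> Hom FB P P" and "card T = card P"
    and "compose S (frame_transport P S T f) (frame_inv P S) = compose S (frame_inv P T) f"
proof -
  have f: "bij_betw f S T" using assms(5) by (simp add: Hom_FB)
  show T: "card T = card P" using f assms(4) by (auto dest: bij_betw_same_card)
  note bS = frame_bij[OF assms(1,2,4)] and bT = frame_bij[OF assms(1,3) T]
  have "bij_betw (inv_into P (frame P T) \<circ> (f \<circ> frame P S)) P P"
    by (rule bij_betw_trans[OF bij_betw_trans[OF bS f] bij_betw_inv_into[OF bT]])
  then show "frame_transport P S T f \<in> Hom FB P P"
    unfolding frame_transport_def Hom_FB
    by (subst bij_betw_cong[where g = "inv_into P (frame P T) \<circ> (f \<circ> frame P S)"]) simp_all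
  show "compose S (frame_transport P S T f) (frame_inv P S) = compose S (frame_inv P T) f"
    using f bS bij_betw_inv_into_right[OF bS]
    by (auto simp: frame_transport_def frame_inv_def compose_def fun_eq_iff bij_betw_def inv_into_into)
qed

lemma rep_FB_simps:
  "card S = card P \<Longrightarrow> ob_map (rep_FB P W \<rho>) S = W"
  "card S \<noteq> card P \<Longrightarrow> ob_map (rep_FB P W \<rho>) S = W\<lparr>carrier := {\<zero>\<^bsub>W\<^esub>}\<rparr>"
  "card S = card P \<Longrightarrow> hom_map (rep_FB P W \<rho>) S T f = \<rho> (frame_transport P S T f)"
  "card S \<noteq> card P \<Longrightarrow> hom_map (rep_FB P W \<rho>) S T f = (\<lambda>w\<in>{\<zero>\<^bsub>W\<^esub>}. w)"
  by (simp_all add: rep_FB_def frame_transport_def)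

lemma rep_FB_operations:
  "\<zero>\<^bsub>ob_map (rep_FB P W \<rho>) S\<^esub> = \<zero>\<^bsub>W\<^esub>"
  "x \<oplus>\<^bsub>ob_map (rep_FB P W \<rho>) S\<^esub> y = x \<oplus>\<^bsub>W\<^esub> y"
  "a \<odot>\<^bsub>ob_map (rep_FB P W \<rho>) S\<^esub> x = a \<odot>\<^bsub>W\<^esub> x"
  by (simp_all add: rep_FB_def)

lemma is_functor_rep_FB:
  fixes P :: "'u set"
  assumes rep: "representation k (BijGroup P) W \<rho>" and P: "finite P"
  shows "is_functor FB (kMod k) (rep_FB P W \<rho>)"
proof (rule cmoduleI[OF _ _ _ _ is_category_FB])
  have W: "module k W" and \<rho>: "\<And>g. g \<in> Bij P \<Longrightarrow> \<rho> g \<in> mod_hom k W W"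
    using rep by (simp_all add: representation_def BijGroup_def)
  interpret group_action "BijGroup P" "carrier W" \<rho> using rep by (simp add: representation_def)
  interpret W: module k W by (rule W)
  have Hom: "Bij P = Hom FB P P" by (auto simp: Bij_def Hom_FB)
  have zero: "module k (W\<lparr>carrier := {\<zero>\<^bsub>W\<^esub>}\<rparr>)"
    by (rule submodule.submodule_is_module[OF zero_submodule[OF W] W])
  fix S :: "'u set" assume "S \<in> Ob FB"
  then have S: "finite S" by simp
  show "module k (ob_map (rep_FB P W \<rho>) S)"
    using W zero by (cases "card S = card P") (simp_all add: rep_FB_simps)
  show "hom_map (rep_FB P W \<rho>) S S (Ident FB S) x = x" if x: "x \<in> carrier (ob_map (rep_FB P W \<rho>) S)" for x
  proof (cases "card S = card P")
    case True
    have "frame_transport P S S (Ident FB S) = (\<lambda>x\<in>P. x)"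
      using bij_betw_inv_into_left[OF frame_bij[OF P S True]] bij_betwE[OF frame_bij[OF P S True]]
      by (auto simp: frame_transport_def Ident_simps fun_eq_iff)
    moreover have "\<rho> (\<lambda>x\<in>P. x) = (\<lambda>w\<in>carrier W. w)" using id_eq_one by (simp add: BijGroup_def)
    ultimately show ?thesis using True x by (simp add: rep_FB_simps)
  qed (use x in \<open>simp add: rep_FB_simps\<close>)
  fix T f assume "T \<in> Ob FB" and f: "f \<in> Hom FB S T"
  then have T: "finite T" by simp
  have card: "card S = card T" using f by (auto simp: Hom_FB dest: bij_betw_same_card)
  show "hom_map (rep_FB P W \<rho>) S T f \<in> mod_hom k (ob_map (rep_FB P W \<rho>) S) (ob_map (rep_FB P W \<rho>) T)"
  proof (cases "card S = card P")
    case True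
    then show ?thesis
      using \<rho> frame_transport_Hom(1,2)[OF P S T True f] by (simp add: rep_FB_simps Hom)
  next
    case False
    then show ?thesis
      using card by (intro mod_homI) (auto simp: rep_FB_simps)
  qed
  fix U g x assume "U \<in> Ob FB" and g: "g \<in> Hom FB T U" and x: "x \<in> carrier (ob_map (rep_FB P W \<rho>) S)"
  then have U: "finite U" by simp
  show "hom_map (rep_FB P W \<rho>) S U (Comp FB S T U g f) x =
      hom_map (rep_FB P W \<rho>) T U g (hom_map (rep_FB P W \<rho>) S T f x)"
  proof (cases "card S = card P")
    case True
    have cT: "card T = card P" using True card by simp
    have tf: "frame_transport P S T f \<in> Bij P" and tg: "frame_transport P T U g \<in> Bij P"
      using frame_transport_Hom(1)[OF P S T True f] frame_transport_Hom(1)[OF P T U cT g] by (simp_all add: Hom)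
    have "f s \<in> T" if "s \<in> S" for s using that f by (auto simp: Hom_FB bij_betw_def)
    then have "frame_transport P S U (Comp FB S T U g f) =
        compose P (frame_transport P T U g) (frame_transport P S T f)"
      using bij_betw_inv_into_right[OF frame_bij[OF P T cT]] bij_betwE[OF frame_bij[OF P S True]]
        bij_betwE[OF bij_betw_inv_into[OF frame_bij[OF P T cT]]]
      by (auto simp: frame_transport_def Comp_FB compose_def fun_eq_iff)
    also have "\<dots> = frame_transport P T U g \<otimes>\<^bsub>BijGroup P\<^esub> frame_transport P S T f"
      using tf tg by (simp add: BijGroup_def)
    finally show ?thesis
      using True cT x tf tg composition_rule[of x "frame_transport P T U g" "frame_transport P S T f"]
      by (simp add: rep_FB_simps BijGroup_def)
  qed (use x card in \<open>simp add: rep_FB_simps\<close>)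
qed

text \<open>The summand of \<open>M W\<close> at \<open>T\<close> goes to the part for \<open>i = card T\<close>, where the value on \<open>T\<close> is \<open>W\<close> of the
  model set \<open>P i\<close>.\<close>

definition split_by_cardinality ::
  "(nat \<Rightarrow> 'u set) \<Rightarrow> ('u set, 'u \<Rightarrow> 'u, 'k, 'm) cmodule \<Rightarrow>
    'u set \<Rightarrow> ('u set \<Rightarrow> 'm) \<Rightarrow> nat \<Rightarrow> 'u set \<Rightarrow> 'm" where
  "split_by_cardinality P W = (\<lambda>S\<in>Ob FIsharp. \<lambda>x\<in>carrier (ob_map (M_ob W) S). \<lambda>i. \<lambda>T\<in>Pow S.
    if card T = i then hom_map W T (P i) (frame_inv (P i) T) (x T) else \<zero>\<^bsub>ob_map W (P i)\<^esub>)"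

context
  fixes k :: "('k, 'x) ring_scheme" and W :: "('u set, 'u \<Rightarrow> 'u, 'k, 'm) cmodule"
    and P :: "nat \<Rightarrow> 'u set"
  assumes W: "is_functor FB (kMod k) W" and P: "\<And>i. finite (P i) \<and> card (P i) = i"
begin

abbreviation (input) part where
  "part i \<equiv> rep_FB (P i) (ob_map W (P i)) (hom_map W (P i) (P i))"

lemma is_functor_part: "is_functor FB (kMod k) (part i)"
  using representation_FB[OF W] P by (intro is_functor_rep_FB) auto

lemma split_apply:
  "finite S \<Longrightarrow> x \<in> carrier (ob_map (M_ob W) S) \<Longrightarrow> T \<subseteq> S \<Longrightarrow> split_by_cardinality P W S x i T =
    (if card T = i then hom_map W T (P i) (frame_inv (P i) T) (x T) else \<zero>\<^bsub>ob_map W (P i)\<^esub>)"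
  by (simp add: split_by_cardinality_def)

lemma frame_inv_mod_hom:
  assumes "finite T"
  shows "hom_map W T (P (card T)) (frame_inv (P (card T)) T) \<in> mod_hom k (ob_map W T) (ob_map W (P (card T)))"
  using assms P by (intro FB_hom[OF W] frame_inv_Hom) auto

lemma split_part_carrier:
  assumes S: "finite S" and x: "x \<in> carrier (ob_map (M_ob W) S)"
  shows "split_by_cardinality P W S x i \<in> carrier (ob_map (M_ob (part i)) S)"
  unfolding carrier_M[OF S]
proof (rule PiE_I)
  fix T assume "T \<in> Pow S"
  then have T: "T \<subseteq> S" "finite T" using S finite_subset[of T S] by auto
  show "split_by_cardinality P W S x i T \<in> carrier (ob_map (part i) T)"
    using mod_hom_closed[OF frame_inv_mod_hom[OF T(2)] M_component[OF x T(1)]] P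
    by (auto simp: split_apply[OF S x T(1)] rep_FB_simps)
qed (use S x in \<open>simp add: split_by_cardinality_def\<close>)

lemma dsum_parts_simps:
  "carrier (ob_map (dsum_cmodule UNIV V) S) =
    {y. (\<forall>i. y i \<in> carrier (ob_map (V i) S)) \<and> finite {i. y i \<noteq> \<zero>\<^bsub>ob_map (V i) S\<^esub>}}"
  "y \<oplus>\<^bsub>ob_map (dsum_cmodule UNIV V) S\<^esub> z = (\<lambda>i. y i \<oplus>\<^bsub>ob_map (V i) S\<^esub> z i)"
  "a \<odot>\<^bsub>ob_map (dsum_cmodule UNIV V) S\<^esub> y = (\<lambda>i. a \<odot>\<^bsub>ob_map (V i) S\<^esub> y i)"
  by (auto simp: dsum_cmodule_def dsum_mod_def)

text \<open>Only the parts with \<open>i \<le> card S\<close> can be nonzero.\<close>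

lemma split_carrier:
  assumes S: "finite S" and x: "x \<in> carrier (ob_map (M_ob W) S)"
  shows "split_by_cardinality P W S x \<in> carrier (ob_map (dsum_cmodule UNIV (\<lambda>i. M_ob (part i))) S)"
proof -
  have "split_by_cardinality P W S x i = \<zero>\<^bsub>ob_map (M_ob (part i)) S\<^esub>" if i: "\<not> i \<le> card S" for i
  proof -
    have "card T \<noteq> i" if "T \<subseteq> S" for T using card_mono[OF S that] i by auto
    then show ?thesis
      using S x by (auto simp: split_by_cardinality_def ob_map_M dsum_mod_simps rep_FB_operations fun_eq_iff)
  qed
  then have "{i. split_by_cardinality P W S x i \<noteq> \<zero>\<^bsub>ob_map (M_ob (part i)) S\<^esub>} \<subseteq> {..card S}" by auto
  then have "finite {i. split_by_cardinality P W S x i \<noteq> \<zero>\<^bsub>ob_map (M_ob (part i)) S\<^esub>}"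
    by (rule finite_subset) simp
  then show ?thesis using split_part_carrier[OF S x] by (simp add: dsum_parts_simps)
qed

lemma split_mod_hom:
  assumes S: "finite S"
  shows "split_by_cardinality P W S \<in>
    mod_hom k (ob_map (M_ob W) S) (ob_map (dsum_cmodule UNIV (\<lambda>i. M_ob (part i))) S)"
proof (rule mod_homI)
  interpret M: module k "ob_map (M_ob W) S" by (rule M_module[OF W S])
  have modP: "module k (ob_map W (P i))" for i using FB_module[OF W] P by simp
  note ab = abelian_groupE[OF module.axioms(2)[OF modP]]
  have fin: "finite T" if "T \<subseteq> S" for T using that S by (rule finite_subset)
  fix x assume x: "x \<in> carrier (ob_map (M_ob W) S)"
  show "split_by_cardinality P W S x \<in> carrier (ob_map (dsum_cmodule UNIV (\<lambda>i. M_ob (part i))) S)"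
    by (rule split_carrier[OF S x])
  show "split_by_cardinality P W S (x \<oplus>\<^bsub>ob_map (M_ob W) S\<^esub> y) =
      split_by_cardinality P W S x \<oplus>\<^bsub>ob_map (dsum_cmodule UNIV (\<lambda>i. M_ob (part i))) S\<^esub>
      split_by_cardinality P W S y" if y: "y \<in> carrier (ob_map (M_ob W) S)" for y
  proof (intro ext)
    fix i T
    show "split_by_cardinality P W S (x \<oplus>\<^bsub>ob_map (M_ob W) S\<^esub> y) i T =
      (split_by_cardinality P W S x \<oplus>\<^bsub>ob_map (dsum_cmodule UNIV (\<lambda>i. M_ob (part i))) S\<^esub>
      split_by_cardinality P W S y) i T"
    proof (cases "T \<subseteq> S")
      case True
      have "(x \<oplus>\<^bsub>ob_map (M_ob W) S\<^esub> y) T = x T \<oplus>\<^bsub>ob_map W T\<^esub> y T"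
        using True by (simp add: ob_map_M dsum_mod_simps)
      then show ?thesis
        using True x y mod_hom_add[OF frame_inv_mod_hom[OF fin[OF True]]] M_component[OF x True]
          M_component[OF y True] ab(2,5)
        by (auto simp: split_apply[OF S] dsum_parts_simps ob_map_M[of "part i"] dsum_mod_simps rep_FB_operations)
    qed (use S x y in \<open>auto simp: split_by_cardinality_def dsum_parts_simps ob_map_M[of "part i"] dsum_mod_simps\<close>)
  qed
  show "split_by_cardinality P W S (a \<odot>\<^bsub>ob_map (M_ob W) S\<^esub> x) =
      a \<odot>\<^bsub>ob_map (dsum_cmodule UNIV (\<lambda>i. M_ob (part i))) S\<^esub> split_by_cardinality P W S x"
    if a: "a \<in> carrier k" for a
  proof (intro ext)
    fix i T
    show "split_by_cardinality P W S (a \<odot>\<^bsub>ob_map (M_ob W) S\<^esub> x) i T =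
      (a \<odot>\<^bsub>ob_map (dsum_cmodule UNIV (\<lambda>i. M_ob (part i))) S\<^esub> split_by_cardinality P W S x) i T"
    proof (cases "T \<subseteq> S")
      case True
      have "(a \<odot>\<^bsub>ob_map (M_ob W) S\<^esub> x) T = a \<odot>\<^bsub>ob_map W T\<^esub> x T"
        using True by (simp add: ob_map_M dsum_mod_simps)
      then show ?thesis
        using True x a mod_hom_smult[OF frame_inv_mod_hom[OF fin[OF True]]] M_component[OF x True]
          module.smult_r_null[OF modP]
        by (auto simp: split_apply[OF S] dsum_parts_simps ob_map_M[of "part i"] dsum_mod_simps rep_FB_operations)
    qed (use S x a in \<open>auto simp: split_by_cardinality_def dsum_parts_simps ob_map_M[of "part i"] dsum_mod_simps\<close>)
  qed
qed (use S in \<open>simp add: split_by_cardinality_def\<close>)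

lemma split_natural:
  assumes S: "finite S" and S': "finite S'" and f: "(A, B, \<phi>) \<in> Hom FIsharp S S'"
    and x: "x \<in> carrier (ob_map (M_ob W) S)"
  shows "split_by_cardinality P W S' (hom_map (M_ob W) S S' (A, B, \<phi>) x) i =
    hom_map (M_ob (part i)) S S' (A, B, \<phi>) (split_by_cardinality P W S x i)"
proof (rule M_eqI)
  have y: "hom_map (M_ob W) S S' (A, B, \<phi>) x \<in> carrier (ob_map (M_ob W) S')"
    by (rule mod_hom_closed[OF M_hom_mod_hom[OF W f S S'] x])
  note z = split_part_carrier[OF S x, of i]
  show "split_by_cardinality P W S' (hom_map (M_ob W) S S' (A, B, \<phi>) x) i \<in>
      carrier (ob_map (M_ob (part i)) S')"
    by (rule split_part_carrier[OF S' y])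
  show "hom_map (M_ob (part i)) S S' (A, B, \<phi>) (split_by_cardinality P W S x i) \<in>
      carrier (ob_map (M_ob (part i)) S')"
    by (rule mod_hom_closed[OF M_hom_mod_hom[OF is_functor_part f S S'] z])
  fix T' assume T': "T' \<subseteq> S'"
  then have fT': "finite T'" using S' by (rule finite_subset)
  define R where "R = {a \<in> A. \<phi> a \<in> T'}"
  have R: "R \<subseteq> S" using f by (auto simp: R_def Hom_FIsharp)
  then have fR: "finite R" using S by (rule finite_subset)
  have Pi: "finite (P i)" "card (P i) = i" using P by auto
  note lhs = split_apply[OF S' y T', of i] M_hom_component[OF W f S S' x T', folded R_def]
  note rhs = M_hom_component[OF is_functor_part f S S' z T', folded R_def] split_apply[OF S x R, of i]
  show "split_by_cardinality P W S' (hom_map (M_ob W) S S' (A, B, \<phi>) x) i T' =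
      hom_map (M_ob (part i)) S S' (A, B, \<phi>) (split_by_cardinality P W S x i) T'"
  proof (cases "T' \<subseteq> B")
    case False
    then show ?thesis
      using mod_hom_zero[OF FB_module[OF W fT'] FB_module[OF W] frame_inv_mod_hom[OF fT']] P
      by (auto simp: lhs rhs(1) rep_FB_operations)
  next
    case True
    have \<phi>R: "restrict \<phi> R \<in> Hom FB R T'" unfolding R_def by (rule preimage_Hom_FB[OF f True])
    then have card: "card R = card T'" by (auto simp: Hom_FB dest: bij_betw_same_card)
    show ?thesis
    proof (cases "card T' = i")
      case False
      then show ?thesis using True card Pi by (simp add: lhs rhs rep_FB_simps)
    next
      case i: True
      then have cR: "card R = card (P i)" "card T' = card (P i)" using card Pi by auto
      note xR = M_component[OF x R]
      have "hom_map W T' (P i) (frame_inv (P i) T') (hom_map W R T' (restrict \<phi> R) (x R)) =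
          hom_map W R (P i) (compose R (frame_inv (P i) T') (restrict \<phi> R)) (x R)"
        by (rule FB_Comp[OF W fR fT' Pi(1) \<phi>R frame_inv_Hom[OF Pi(1) fT' cR(2)] xR])
      also have "\<dots> = hom_map W R (P i)
          (compose R (frame_transport (P i) R T' (restrict \<phi> R)) (frame_inv (P i) R)) (x R)"
        by (simp add: frame_transport_Hom(3)[OF Pi(1) fR fT' cR(1) \<phi>R])
      also have "\<dots> = hom_map W (P i) (P i) (frame_transport (P i) R T' (restrict \<phi> R))
          (hom_map W R (P i) (frame_inv (P i) R) (x R))"
        by (rule FB_Comp[OF W fR Pi(1) Pi(1) frame_inv_Hom[OF Pi(1) fR cR(1)]
            frame_transport_Hom(1)[OF Pi(1) fR fT' cR(1) \<phi>R] xR, symmetric])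
      finally show ?thesis
        using True i card Pi by (simp add: lhs rhs rep_FB_simps)
    qed
  qed
qed

lemma split_nat_trans:
  "split_by_cardinality P W \<in> nat_trans FIsharp k (M_ob W) (dsum_cmodule UNIV (\<lambda>i. M_ob (part i)))"
proof (rule nat_transI)
  fix S S' :: "'u set" and f x
  assume "S \<in> Ob FIsharp" "S' \<in> Ob FIsharp" and f: "f \<in> Hom FIsharp S S'"
    and x: "x \<in> carrier (ob_map (M_ob W) S)"
  then have S: "finite S" "finite S'" by auto
  obtain A B \<phi> where f_eq: "f = (A, B, \<phi>)" by (metis prod_cases3)
  have "split_by_cardinality P W S x \<in> carrier (dsum_mod UNIV (\<lambda>i. ob_map (M_ob (part i)) S))"
    using split_carrier[OF S(1) x] by (simp add: dsum_cmodule_def)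
  then show "split_by_cardinality P W S' (hom_map (M_ob W) S S' f x) =
      hom_map (dsum_cmodule UNIV (\<lambda>i. M_ob (part i))) S S' f (split_by_cardinality P W S x)"
    using split_natural[OF S f[unfolded f_eq] x] by (simp add: dsum_cmodule_def f_eq fun_eq_iff)
qed (simp_all add: split_mod_hom, simp add: split_by_cardinality_def)

lemma split_bij:
  assumes S: "finite S"
  shows "bij_betw (split_by_cardinality P W S) (carrier (ob_map (M_ob W) S))
    (carrier (ob_map (dsum_cmodule UNIV (\<lambda>i. M_ob (part i))) S))"
proof -
  have fin: "finite T" if "T \<subseteq> S" for T using that S by (rule finite_subset)
  let ?in = "\<lambda>T. frame_inv (P (card T)) T"
  let ?out = "\<lambda>T. restrict (frame (P (card T)) T) (P (card T))"
  have fP: "finite (P i)" "card (P i) = i" for i using P by auto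
  have in_hom: "?in T \<in> Hom FB T (P (card T))" and out_hom: "?out T \<in> Hom FB (P (card T)) T"
    and cancel: "compose T (?out T) (?in T) = (\<lambda>s\<in>T. s)"
      "compose (P (card T)) (?in T) (?out T) = (\<lambda>s\<in>P (card T). s)" if "T \<subseteq> S" for T
    using fin[OF that] fP by (auto intro!: frame_inv_Hom frame_Hom frame_cancel)
  define g where "g y = (\<lambda>T\<in>Pow S. hom_map W (P (card T)) T (?out T) (y (card T) T))"
    for y :: "nat \<Rightarrow> 'u set \<Rightarrow> 'm"
  have yT: "y i T \<in> carrier (ob_map (part i) T)"
    if "y \<in> carrier (ob_map (dsum_cmodule UNIV (\<lambda>i. M_ob (part i))) S)" "T \<subseteq> S" for y i T
    using that M_component[of "y i" "part i" S T] by (simp add: dsum_parts_simps)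
  then have yP: "y (card T) T \<in> carrier (ob_map W (P (card T)))"
    if "y \<in> carrier (ob_map (dsum_cmodule UNIV (\<lambda>i. M_ob (part i))) S)" "T \<subseteq> S" for y T
    using yT[OF that, of "card T"] fP by (simp add: rep_FB_simps)
  have g: "g y \<in> carrier (ob_map (M_ob W) S)"
    if y: "y \<in> carrier (ob_map (dsum_cmodule UNIV (\<lambda>i. M_ob (part i))) S)" for y
    using mod_hom_closed[OF FB_hom[OF W fP(1) fin out_hom] yP[OF y]] by (simp add: carrier_M[OF S] g_def)
  show ?thesis
  proof (rule bij_betwI[where g = g])
    show "split_by_cardinality P W S \<in> carrier (ob_map (M_ob W) S) \<rightarrow>
        carrier (ob_map (dsum_cmodule UNIV (\<lambda>i. M_ob (part i))) S)"
      using split_carrier[OF S] by auto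
    show "g \<in> carrier (ob_map (dsum_cmodule UNIV (\<lambda>i. M_ob (part i))) S) \<rightarrow> carrier (ob_map (M_ob W) S)"
      using g by auto
  next
    fix x assume x: "x \<in> carrier (ob_map (M_ob W) S)"
    show "g (split_by_cardinality P W S x) = x"
    proof (rule M_eqI[OF g[OF split_carrier[OF S x]] x])
      fix T assume T: "T \<subseteq> S"
      have "g (split_by_cardinality P W S x) T =
          hom_map W (P (card T)) T (?out T) (hom_map W T (P (card T)) (?in T) (x T))"
        using T by (simp add: g_def split_apply[OF S x T])
      also have "\<dots> = x T"
        using FB_Comp[OF W fin[OF T] fP(1) fin[OF T] in_hom[OF T] out_hom[OF T] M_component[OF x T]]
          FB_Ident[OF W fin[OF T] M_component[OF x T]] by (simp add: cancel[OF T])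
      finally show "g (split_by_cardinality P W S x) T = x T" .
    qed
  next
    fix y assume y: "y \<in> carrier (ob_map (dsum_cmodule UNIV (\<lambda>i. M_ob (part i))) S)"
    show "split_by_cardinality P W S (g y) = y"
    proof
      fix i
      show "split_by_cardinality P W S (g y) i = y i"
      proof (rule M_eqI[OF split_part_carrier[OF S g[OF y]]])
        show "y i \<in> carrier (ob_map (M_ob (part i)) S)" using y by (simp add: dsum_parts_simps)
        fix T assume T: "T \<subseteq> S"
        show "split_by_cardinality P W S (g y) i T = y i T"
        proof (cases "card T = i")
          case True
          have "split_by_cardinality P W S (g y) i T =
              hom_map W T (P (card T)) (?in T) (hom_map W (P (card T)) T (?out T) (y (card T) T))"
            unfolding split_apply[OF S g[OF y] T] using T True by (simp add: g_def)
          also have "\<dots> = y (card T) T"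
            using FB_Comp[OF W fP(1) fin[OF T] fP(1) out_hom[OF T] in_hom[OF T] yP[OF y T]]
              FB_Ident[OF W fP(1) yP[OF y T]] by (simp add: cancel[OF T])
          finally show ?thesis using True by simp
        next
          case False
          then show ?thesis
            using yT[OF y T, of i] fP by (simp add: split_apply[OF S g[OF y] T] rep_FB_simps)
        qed
      qed
    qed
  qed
qed

end

section \<open>The equivalence and the decomposition\<close>

theorem theorem4p1p5:
  fixes k :: "('k, 'x) ring_scheme"
    and P :: "nat \<Rightarrow> 'u set"
  assumes "cring k"
    and "\<And>i. finite (P i) \<and> card (P i) = i"
  shows
    "is_functor
       (Mod_cat FB k :: (('u set, 'u \<Rightarrow> 'u, 'k, 'm) cmodule, _) category)
       (Mod_cat FIsharp k)
       M_functor \<and>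
     is_functor
       (Mod_cat FIsharp k ::
          (('u set, 'u set \<times> 'u set \<times> ('u \<Rightarrow> 'u), 'k, 'n) cmodule, _) category)
       (Mod_cat FB k)
       (H0_functor k) \<and>
     functors_isomorphic
       (Mod_cat FB k :: (('u set, 'u \<Rightarrow> 'u, 'k, 'm) cmodule, _) category) FB k
       id_functor (comp_functor (H0_functor k) M_functor) \<and>
     functors_isomorphic
       (Mod_cat FIsharp k ::
          (('u set, 'u set \<times> 'u set \<times> ('u \<Rightarrow> 'u), 'k, 'n) cmodule, _) category) FIsharp k
       (comp_functor M_functor (H0_functor k)) id_functor \<and>
     (\<forall>V \<in> Ob (Mod_cat FIsharp k ::
          (('u set, 'u set \<times> 'u set \<times> ('u \<Rightarrow> 'u), 'k, 'n) cmodule, _) category).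
        (\<forall>i. representation k (BijGroup (P i))
               (ob_map (H0_ob k V) (P i)) (hom_map (H0_ob k V) (P i) (P i))) \<and>
        nat_isos FIsharp k V
          (dsum_cmodule UNIV (\<lambda>i. M_ob
             (rep_FB (P i) (ob_map (H0_ob k V) (P i)) (hom_map (H0_ob k V) (P i) (P i)))))
        \<noteq> {})"
proof (intro conjI is_functor_M is_functor_H0 id_isomorphic_H0_M M_H0_isomorphic_id ballI allI)
  fix V :: "('u set, 'u set \<times> 'u set \<times> ('u \<Rightarrow> 'u), 'k, 'n) cmodule"
  assume "V \<in> Ob (Mod_cat FIsharp k)"
  then have V: "is_functor FIsharp (kMod k) V" by (simp add: Mod_cat_def)
  note W = is_functor_H0_ob[OF V]
  show "representation k (BijGroup (P i)) (ob_map (H0_ob k V) (P i)) (hom_map (H0_ob k V) (P i) (P i))"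
    for i using representation_FB[OF W] assms(2) by simp
  let ?\<sigma> = "split_by_cardinality P (H0_ob k V)" and ?\<rho> = "restriction_classes k V"
  let ?sum = "dsum_cmodule UNIV (\<lambda>i. M_ob
    (rep_FB (P i) (ob_map (H0_ob k V) (P i)) (hom_map (H0_ob k V) (P i) (P i))))"
  have "nat_comp FIsharp V ?\<sigma> ?\<rho> \<in> nat_isos FIsharp k V ?sum"
  proof (rule nat_isosI[OF V])
    show "nat_comp FIsharp V ?\<sigma> ?\<rho> \<in> nat_trans FIsharp k V ?sum"
      by (rule nat_comp_nat_trans[OF V restriction_classes_nat_trans[OF V] split_nat_trans[OF W assms(2)]])
    fix S :: "'u set" assume "S \<in> Ob FIsharp"
    then have S: "finite S" by simp
    have "bij_betw (?\<sigma> S \<circ> ?\<rho> S) (carrier (ob_map V S)) (carrier (ob_map ?sum S))"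
      by (rule bij_betw_trans[OF restriction_classes_bij[OF V S] split_bij[OF W assms(2) S]])
    then show "bij_betw (nat_comp FIsharp V ?\<sigma> ?\<rho> S) (carrier (ob_map V S)) (carrier (ob_map ?sum S))"
      using S by (subst bij_betw_cong[where g = "?\<sigma> S \<circ> ?\<rho> S"]) (simp_all add: nat_comp_apply)
  qed
  then show "nat_isos FIsharp k V ?sum \<noteq> {}" by blast
qed

end
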